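(* Let $n_1,\dots,n_\ell$ be positive integers, $n=n_1+\dots+n_\ell$. Let $K_j\subset\mathbb{C}^{n_j}$ be compact and non-pluripolar for $j=1,\dots,\ell$, and $K=K_1\times\dots\times K_\ell$. Let $T\subset\mathbb{R}^\ell_+$ be a compact convex body, let $S_j\subset\mathbb{R}^{n_j}_+$ be compact convex and contain $0$ with $a\Sigma_j\subset S_j$ for some $a>0$, for $j=1,\dots,\ell$, such that $V^{S_j*}_{K_j}=0$ on $K_j$ for $j=1,\dots,\ell$, and let $q_j<0$ be a constant weight on $K_j$ for $j=1,\dots,\ell$. Then the function $$V(z)=\varphi_T\big(V^{S_1}_{K_1,q_1}(z_1),\dots,V^{S_\ell}_{K_\ell,q_\ell}(z_\ell)\big)=\varphi_T\big(V^{S_1}_{K_1}(z_1)+q_1,\dots,V^{S_\ell}_{K_\ell}(z_\ell)+q_\ell\big),$$ $z=(z_1,\dots,z_\ell)\in\mathbb{C}^n$, $z_j\in\mathbb{C}^{n_j}$, is not maximal on $\mathbb{C}^n\setminus K$.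
   Context: $\mathbb{R}_+=[0,\infty)$, $\mathbb{C}^{*n}=(\mathbb{C}\setminus\{0\})^n$. A convex body is a compact convex set with non-empty interior. $\Sigma_j=\{x\in\mathbb{R}^{n_j}_+\,;\,x_1+\dots+x_{n_j}\le1\}$ is the standard simplex in $\mathbb{R}^{n_j}$. For compact convex $A\subset\mathbb{R}^m$, $\varphi_A(\xi)=\sup_{x\in A}\langle x,\xi\rangle$ is its supporting function. For $S\subset\mathbb{R}^n_+$ compact convex containing $0$, the logarithmic supporting function is $H_S(z)=\varphi_S(\log|z_1|,\dots,\log|z_n|)$ for $z\in\mathbb{C}^{*n}$, extended to $\mathbb{C}^n$ by $H_S(z)=\varlimsup_{\mathbb{C}^{*n}\ni w\to z}H_S(w)$. The Lelong class $\mathcal{L}^S(\mathbb{C}^n)$ consists of all plurisubharmonic $u$ on $\mathbb{C}^n$ such that $u\le H_S+c_u$ for some constant $c_u$. For compact $K\subset\mathbb{C}^n$ and a function (weight) $q$ on $K$, $V^S_{K,q}(z)=\sup\{u(z)\,;\,u\in\mathcal{L}^S(\mathbb{C}^n),\ u|_K\le q\}$, and $V^S_K=V^S_{K,0}$. For a function $f$, $f^*$ denotes its upper semicontinuous regularization; $V^{S*}_K=(V^S_K)^*$. Maximality is in the usual sense: a plurisubharmonic function $v$ on an open set $\Omega\subset\mathbb{C}^n$ is maximal on $\Omega$ if for every relatively compact open $G\subset\Omega$ and every $u$ upper semicontinuous on $\overline G$ and plurisubharmonic in $G$, $u\le v$ on $\partial G$ implies $u\le v$ in $G$. *)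

theory Defs
  imports "HOL-Analysis.Analysis"
begin

text \<open>
  Spaces of several different dimensions occur at once: \<open>\<complex>\<^sup>n = \<complex>\<^sup>n\<^sup>1 \<times> \<dots> \<times> \<complex>\<^sup>n\<^sup>l\<close>. The ambient space is
  \<open>complex ^ 'n\<close>, and each factor is the coordinate subspace \<open>coord_space A\<close> of the vectors supported
  in a set \<open>A\<close> of coordinates, a copy of \<open>\<complex>\<^sup>m\<close> with \<open>m = card A\<close>. All notions are relative to such a
  subspace (topology, complex lines, boundaries); \<open>A = UNIV\<close> gives the usual notions on
  \<open>complex ^ 'n\<close>. The same convention is used for the real vectors in \<open>real ^ 'n\<close>.
\<close>

definition coord_space :: "'n set \<Rightarrow> ('a::zero ^ 'n) set" where
  "coord_space A = {x. \<forall>i. i \<notin> A \<longrightarrow> x $ i = 0}"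

definition coord_proj :: "'n set \<Rightarrow> 'a::zero ^ 'n \<Rightarrow> 'a ^ 'n" where
  "coord_proj A z = (\<chi> i. if i \<in> A then z $ i else 0)"

definition nonneg_orthant :: "(real ^ 'n) set" where
  "nonneg_orthant = {x. \<forall>i. 0 \<le> x $ i}"

definition std_simplex :: "'n::finite set \<Rightarrow> (real ^ 'n) set" where
  "std_simplex A = {x \<in> coord_space A \<inter> nonneg_orthant. (\<Sum>i\<in>A. x $ i) \<le> 1}"

definition support_fun :: "(real ^ 'm::finite) set \<Rightarrow> real ^ 'm \<Rightarrow> real" where
  "support_fun A \<xi> = (SUP x\<in>A. x \<bullet> \<xi>)"


subsection \<open>Subharmonic and plurisubharmonic functions\<close>

definition usc_on :: "'a::topological_space set \<Rightarrow> ('a \<Rightarrow> ereal) \<Rightarrow> bool" where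
  "usc_on X f \<longleftrightarrow> (\<forall>x\<in>X. \<forall>c>f x. \<forall>\<^sub>F y in at x within X. f y < c)"

text \<open>The limes superior at \<open>z\<close> over points of \<open>X\<close>, the point \<open>z\<close> itself being included.\<close>

definition usc_reg :: "'a::topological_space set \<Rightarrow> ('a \<Rightarrow> ereal) \<Rightarrow> 'a \<Rightarrow> ereal" where
  "usc_reg X f z = Limsup (inf (nhds z) (principal X)) f"

text \<open>
  The mean of \<open>f\<close> over the circle of centre \<open>a\<close> and radius \<open>r\<close>, as integral of the positive part
  minus integral of the negative part (\<open>e2ennreal\<close> maps negative numbers to \<open>0\<close>). For an upper
  semicontinuous \<open>f < \<infinity>\<close> the first integral is finite; the value may be \<open>-\<infinity>\<close>.
\<close>

definition circle_mean :: "(complex \<Rightarrow> ereal) \<Rightarrow> complex \<Rightarrow> real \<Rightarrow> ereal" where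
  "circle_mean f a r =
     ereal (1 / (2 * pi)) *
       (enn2ereal (\<integral>\<^sup>+\<theta>\<in>{0..2*pi}. e2ennreal (f (a + of_real r * cis \<theta>)) \<partial>lborel)
        - enn2ereal (\<integral>\<^sup>+\<theta>\<in>{0..2*pi}. e2ennreal (- f (a + of_real r * cis \<theta>)) \<partial>lborel))"

text \<open>The function identically \<open>-\<infinity>\<close> counts as subharmonic and as plurisubharmonic.\<close>

definition subharmonic_on :: "complex set \<Rightarrow> (complex \<Rightarrow> ereal) \<Rightarrow> bool" where
  "subharmonic_on U f \<longleftrightarrow>
     open U \<and> (\<forall>t\<in>U. f t < \<infinity>) \<and> usc_on U f \<and>
     (\<forall>a r. 0 < r \<longrightarrow> cball a r \<subseteq> U \<longrightarrow> f a \<le> circle_mean f a r)"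

definition psh_on :: "'n::finite set \<Rightarrow> (complex ^ 'n) set \<Rightarrow> (complex ^ 'n \<Rightarrow> ereal) \<Rightarrow> bool" where
  "psh_on A \<Omega> u \<longleftrightarrow>
     openin (top_of_set (coord_space A)) \<Omega> \<and> (\<forall>z\<in>\<Omega>. u z < \<infinity>) \<and> usc_on \<Omega> u \<and>
     (\<forall>a\<in>\<Omega>. \<forall>b\<in>coord_space A. subharmonic_on {t. a + t *s b \<in> \<Omega>} (\<lambda>t. u (a + t *s b)))"

definition pluripolar :: "'n::finite set \<Rightarrow> (complex ^ 'n) set \<Rightarrow> bool" where
  "pluripolar A E \<longleftrightarrow>
     (\<exists>u. psh_on A (coord_space A) u \<and> (\<exists>z\<in>coord_space A. u z \<noteq> -\<infinity>) \<and>
          (\<forall>z\<in>E. u z = -\<infinity>))"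

definition maximal_psh_on :: "'n::finite set \<Rightarrow> (complex ^ 'n) set \<Rightarrow> (complex ^ 'n \<Rightarrow> ereal) \<Rightarrow> bool" where
  "maximal_psh_on A \<Omega> v \<longleftrightarrow>
     psh_on A \<Omega> v \<and>
     (\<forall>G u. openin (top_of_set (coord_space A)) G \<longrightarrow> compact (closure G) \<longrightarrow> closure G \<subseteq> \<Omega> \<longrightarrow>
        usc_on (closure G) u \<longrightarrow> psh_on A G u \<longrightarrow>
        (\<forall>z \<in> top_of_set (coord_space A) frontier_of G. u z \<le> v z) \<longrightarrow>
        (\<forall>z\<in>G. u z \<le> v z))"


subsection \<open>Lelong classes and extremal functions\<close>

definition torus :: "'n set \<Rightarrow> (complex ^ 'n) set" where
  "torus A = {z \<in> coord_space A. \<forall>i\<in>A. z $ i \<noteq> 0}"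

text \<open>
  For \<open>S \<subseteq> coord_space A\<close> the value of \<open>ln (cmod (z $ i))\<close> at the coordinates \<open>i \<notin> A\<close> is irrelevant,
  as it is multiplied by \<open>0\<close> in the supporting function.
\<close>

definition log_support_fun :: "'n::finite set \<Rightarrow> (real ^ 'n) set \<Rightarrow> complex ^ 'n \<Rightarrow> ereal" where
  "log_support_fun A S z =
     (let h = (\<lambda>w. ereal (support_fun S (\<chi> i. ln (cmod (w $ i)))))
      in if z \<in> torus A then h z else Limsup (at z within torus A) h)"

definition lelong_class :: "'n::finite set \<Rightarrow> (real ^ 'n) set \<Rightarrow> (complex ^ 'n \<Rightarrow> ereal) set" where
  "lelong_class A S =
     {u. psh_on A (coord_space A) u \<and>
         (\<exists>c::real. \<forall>z\<in>coord_space A. u z \<le> log_support_fun A S z + ereal c)}"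

definition weighted_extremal ::
    "'n::finite set \<Rightarrow> (real ^ 'n) set \<Rightarrow> (complex ^ 'n) set \<Rightarrow> (complex ^ 'n \<Rightarrow> ereal) \<Rightarrow> complex ^ 'n \<Rightarrow> ereal" where
  "weighted_extremal A S K q z = (SUP u \<in> {u \<in> lelong_class A S. \<forall>w\<in>K. u w \<le> q w}. u z)"

abbreviation extremal ::
    "'n::finite set \<Rightarrow> (real ^ 'n) set \<Rightarrow> (complex ^ 'n) set \<Rightarrow> complex ^ 'n \<Rightarrow> ereal" where
  "extremal A S K \<equiv> weighted_extremal A S K (\<lambda>_. 0)"

end

theory Submission
  imports Defs "HOL-Complex_Analysis.Cauchy_Integral_Formula"
begin

text \<open>
  Write \<open>\<psi>\<^sub>j = V\<^sub>j + q\<^sub>j\<close>, where \<open>V\<^sub>j\<close> is the extremal function of the \<open>j\<close>-th factor. If \<open>T\<close> contains the ball of radius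
  \<open>\<rho> > 0\<close> about \<open>c\<close>, then \<open>V \<ge> \<langle>c, \<psi>\<rangle> + \<rho> \<bar>\<psi>\<bar>\<close> (\<open>support_fun_ball\<close>). For \<open>\<eta> > 0\<close> the plurisubharmonic function
  \<open>u = \<langle>c, \<psi>\<rangle> + \<rho> \<eta>\<close> is therefore at most \<open>V\<close> wherever \<open>\<bar>\<psi>\<bar> \<ge> \<eta>\<close>, but \<open>u = \<rho> \<eta> > 0 = V\<close> at a zero of \<open>\<psi>\<close>: the kink of the
  supporting function at the origin is what destroys maximality. As \<open>q\<^sub>j < 0\<close> and \<open>V\<^sub>j\<close> is small near its compact set,
  all \<open>\<psi>\<^sub>j\<close> lie below \<open>-\<eta>\<close> near \<open>K\<close> if \<open>\<eta>\<close> is small (\<open>V_small_near_K\<close>); far away some \<open>\<psi>\<^sub>j\<close> is at least \<open>\<eta>\<close>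
  (\<open>V_sublevel_bounded\<close>). So a large ball with a closed neighbourhood of \<open>K\<close> removed has \<open>\<bar>\<psi>\<bar> \<ge> \<eta>\<close> on its
  boundary. It contains a zero of \<open>\<psi>\<close>, because every \<open>V\<^sub>j\<close> takes the value \<open>-q\<^sub>j\<close> (\<open>V_attains\<close>); this
  is a continuity argument along a ray, based on \<open>V_dilate\<close>.

  It remains to see that the extremal function of a regular set is finite and plurisubharmonic (\<open>psh_V\<close>). Its
  upper semicontinuous regularization satisfies the mean value inequality (\<open>psh_usc_reg_SUP\<close>) and vanishes on
  the compact set, so it equals the extremal function as soon as it has the growth required in the
  Lelong class. This is a matter of one growth constant for all competitors, and it follows from two
  applications of the maximum principle. The first (\<open>bernstein_walsh\<close>) passes from a ball to bounded sets, the second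
  (\<open>torus_growth\<close>) from a neighbourhood of the unit torus to the whole torus. In both, a quadratic
  term makes the comparison strict, so that an interior maximum contradicts the mean value inequality over
  a single circle in a complex line.
\<close>

section \<open>Upper semicontinuous functions\<close>

lemma usc_on_iff:
  "usc_on X f \<longleftrightarrow> (\<forall>x\<in>X. \<forall>c. f x < c \<longrightarrow> (\<exists>W. open W \<and> x \<in> W \<and> (\<forall>y\<in>W \<inter> X. f y < c)))"
proof
  assume usc: "usc_on X f"
  show "\<forall>x\<in>X. \<forall>c. f x < c \<longrightarrow> (\<exists>W. open W \<and> x \<in> W \<and> (\<forall>y\<in>W \<inter> X. f y < c))"
  proof (intro ballI allI impI)
    fix x c assume x: "x \<in> X" "f x < c"
    then have "\<forall>\<^sub>F y in at x within X. f y < c"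
      using usc by (simp add: usc_on_def)
    then obtain W where W: "open W" "x \<in> W" "\<forall>y\<in>W. y \<noteq> x \<longrightarrow> y \<in> X \<longrightarrow> f y < c"
      unfolding eventually_at_topological by blast
    have "\<forall>y\<in>W \<inter> X. f y < c"
    proof
      fix y assume "y \<in> W \<inter> X"
      then show "f y < c"
        using W(3) x(2) by (cases "y = x") auto
    qed
    then show "\<exists>W. open W \<and> x \<in> W \<and> (\<forall>y\<in>W \<inter> X. f y < c)"
      using W(1,2) by blast
  qed
next
  assume "\<forall>x\<in>X. \<forall>c. f x < c \<longrightarrow> (\<exists>W. open W \<and> x \<in> W \<and> (\<forall>y\<in>W \<inter> X. f y < c))"
  then show "usc_on X f"
    unfolding usc_on_def eventually_at_topological by (metis Int_iff)
qed

lemma usc_onD: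
  "usc_on X f \<Longrightarrow> x \<in> X \<Longrightarrow> f x < c \<Longrightarrow> \<exists>W. open W \<and> x \<in> W \<and> (\<forall>y\<in>W \<inter> X. f y < c)"
  by (simp add: usc_on_iff)

lemma usc_onI:
  assumes "\<And>x c. x \<in> X \<Longrightarrow> f x < c \<Longrightarrow> \<exists>W. open W \<and> x \<in> W \<and> (\<forall>y\<in>W \<inter> X. f y < c)"
  shows "usc_on X f"
  using assms by (simp add: usc_on_iff)

lemma usc_on_subset:
  assumes "usc_on X f" "Y \<subseteq> X"
  shows "usc_on Y f"
proof (rule usc_onI)
  fix x c assume x: "x \<in> Y" "f x < c"
  then have "x \<in> X"
    using assms(2) by auto
  then obtain W where "open W" "x \<in> W" "\<forall>y\<in>W \<inter> X. f y < c"
    using usc_onD[OF assms(1) _ x(2)] by auto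
  then show "\<exists>W. open W \<and> x \<in> W \<and> (\<forall>y\<in>W \<inter> Y. f y < c)"
    using assms(2) by (intro exI[of _ W]) auto
qed

lemma usc_on_cong:
  assumes "usc_on X f" "\<And>x. x \<in> X \<Longrightarrow> f x = g x"
  shows "usc_on X g"
proof (rule usc_onI)
  fix x c assume "x \<in> X" "g x < c"
  with assms usc_onD[of X f x c] obtain W where "open W" "x \<in> W" "\<forall>y\<in>W \<inter> X. f y < c"
    by auto
  then show "\<exists>W. open W \<and> x \<in> W \<and> (\<forall>y\<in>W \<inter> X. g y < c)"
    using assms(2) by (intro exI[of _ W]) auto
qed

lemma usc_on_compose:
  assumes "usc_on X f" "continuous_on Y g" "g ` Y \<subseteq> X"
  shows "usc_on Y (\<lambda>y. f (g y))"
proof (rule usc_onI)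
  fix y c assume y: "y \<in> Y" "f (g y) < c"
  then have "g y \<in> X"
    using assms(3) by auto
  then obtain W where W: "open W" "g y \<in> W" "\<forall>x\<in>W \<inter> X. f x < c"
    using usc_onD[OF assms(1) _ y(2)] by auto
  obtain U where U: "open U" "U \<inter> Y = g -` W \<inter> Y"
    using continuous_on_open_invariant[THEN iffD1, rule_format, OF assms(2) W(1)] by auto
  show "\<exists>W. open W \<and> y \<in> W \<and> (\<forall>y\<in>W \<inter> Y. f (g y) < c)"
  proof (intro exI[of _ U] conjI ballI)
    show "y \<in> U"
      using U(2) W(2) y(1) by blast
    fix x assume x: "x \<in> U \<inter> Y"
    then have "g x \<in> W \<inter> X"
      using U(2) assms(3) by blast
    then show "f (g x) < c"
      using W(3) by simp
  qed (rule U(1))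
qed

lemma usc_on_continuous:
  assumes "continuous_on X f"
  shows "usc_on X (\<lambda>x. ereal (f x))"
proof (rule usc_onI)
  fix x c assume x: "x \<in> X" "ereal (f x) < c"
  have "continuous_on X (\<lambda>x. ereal (f x))"
    using assms by (intro continuous_on_ereal)
  then obtain U where "open U" "U \<inter> X = (\<lambda>x. ereal (f x)) -` {..<c} \<inter> X"
    using continuous_on_open_invariant[THEN iffD1, rule_format, OF _ open_lessThan, of X _ c] by auto
  then show "\<exists>W. open W \<and> x \<in> W \<and> (\<forall>y\<in>W \<inter> X. ereal (f y) < c)"
    using x by (intro exI[of _ U]) (auto simp: set_eq_iff)
qed

lemma usc_on_add_continuous:
  assumes "usc_on X f" "continuous_on X g"
  shows "usc_on X (\<lambda>x. f x + ereal (g x))"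
proof (rule usc_onI)
  fix x c assume x: "x \<in> X" "f x + ereal (g x) < c"
  then obtain d where d: "f x + ereal (g x) < ereal d" "ereal d < c"
    using ereal_dense2 by blast
  then have "f x < ereal (d - g x)"
    by (cases "f x") (auto simp: algebra_simps)
  then obtain e where e: "f x < ereal e" "e < d - g x"
    using ereal_dense2[of "f x" "ereal (d - g x)"] by auto
  have gx: "ereal (g x) < ereal (d - e)"
    using e by simp
  obtain W1 where W1: "open W1" "x \<in> W1" "\<forall>y\<in>W1 \<inter> X. f y < ereal e"
    using usc_onD[OF assms(1) x(1) e(1)] by auto
  obtain W2 where W2: "open W2" "x \<in> W2" "\<forall>y\<in>W2 \<inter> X. ereal (g y) < ereal (d - e)"
    using usc_onD[OF usc_on_continuous[OF assms(2)] x(1) gx] by auto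
  have "f y + ereal (g y) < c" if "y \<in> W1 \<inter> W2 \<inter> X" for y
  proof -
    have "f y \<le> ereal e" "g y < d - e"
      using bspec[OF W1(3), of y] bspec[OF W2(3), of y] that by (auto intro: less_imp_le)
    then have "f y + ereal (g y) < ereal d"
      by (cases "f y") auto
    then show ?thesis
      using d(2) by (rule less_trans)
  qed
  then show "\<exists>W. open W \<and> x \<in> W \<and> (\<forall>y\<in>W \<inter> X. f y + ereal (g y) < c)"
    using W1 W2 by (intro exI[of _ "W1 \<inter> W2"]) auto
qed

lemma usc_attains_max:
  assumes "compact X" "X \<noteq> {}" "usc_on X f"
  obtains x where "x \<in> X" "\<And>y. y \<in> X \<Longrightarrow> f y \<le> f x"
proof (rule ccontr)
  assume "\<not> thesis"
  then have "\<forall>x\<in>X. \<exists>y\<in>X. f x < f y"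
    using that by (meson not_le_imp_less)
  then obtain g where g: "\<And>x. x \<in> X \<Longrightarrow> g x \<in> X \<and> f x < f (g x)"
    by metis
  have "\<forall>x\<in>X. \<exists>W. open W \<and> x \<in> W \<and> (\<forall>y\<in>W \<inter> X. f y < f (g x))"
    using g by (intro ballI usc_onD[OF assms(3)]) auto
  then obtain W where W: "\<And>x. x \<in> X \<Longrightarrow> open (W x) \<and> x \<in> W x \<and> (\<forall>y\<in>W x \<inter> X. f y < f (g x))"
    by metis
  obtain D where D: "D \<subseteq> X" "finite D" "X \<subseteq> (\<Union>x\<in>D. W x)"
    by (rule compactE_image[OF assms(1), of X W]) (use W in auto)
  have "D \<noteq> {}"
    using D assms(2) by auto
  define m where "m = Max ((\<lambda>x. f (g x)) ` D)"
  have "m \<in> (\<lambda>x. f (g x)) ` D"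
    unfolding m_def using D(2) \<open>D \<noteq> {}\<close> by (intro Max_in) auto
  then obtain x0 where x0: "x0 \<in> D" "m = f (g x0)"
    by auto
  have "g x0 \<in> X"
    using x0 D g by auto
  then obtain x1 where x1: "x1 \<in> D" "g x0 \<in> W x1"
    using D by blast
  then have "f (g x0) < f (g x1)"
    using W D \<open>g x0 \<in> X\<close> by blast
  also have "\<dots> \<le> m"
    unfolding m_def using x1 D by (intro Max_ge) auto
  finally show False
    using x0 by simp
qed

lemma usc_bounded_above:
  assumes "compact X" "usc_on X f" "\<And>x. x \<in> X \<Longrightarrow> f x < \<infinity>"
  obtains m where "\<And>y. y \<in> X \<Longrightarrow> f y \<le> ereal m"
proof (cases "X = {}")
  case False
  then obtain x where x: "x \<in> X" "\<And>y. y \<in> X \<Longrightarrow> f y \<le> f x"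
    using usc_attains_max[OF assms(1) False assms(2)] by blast
  have "f x \<noteq> \<infinity>" using assms(3)[OF x(1)] by auto
  then obtain m where "f x \<le> ereal m"
    by (cases "f x") auto
  then show ?thesis
    using x by (intro that) (blast intro: order_trans)
qed (use that in auto)

lemma usc_measurable:
  fixes f :: "'a::topological_space \<Rightarrow> ereal"
  assumes "usc_on UNIV f"
  shows "f \<in> borel_measurable borel"
proof (rule borel_measurableI_less)
  fix c
  have "open {x. f x < c}"
    unfolding open_subopen[of "{x. f x < c}"]
  proof clarify
    fix x assume x: "f x < c"
    obtain W where "open W" "x \<in> W" "\<forall>y\<in>W \<inter> UNIV. f y < c"
      using usc_onD[OF assms UNIV_I x] by auto
    then show "\<exists>T. open T \<and> x \<in> T \<and> T \<subseteq> {x. f x < c}"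
      by auto
  qed
  then show "{x \<in> space borel. f x < c} \<in> sets borel"
    by simp
qed

section \<open>Means over circles\<close>

text \<open>The circle mean in terms of the angle: a bound on the circle is then any function of the angle.\<close>

definition arc_mean :: "(real \<Rightarrow> ereal) \<Rightarrow> ereal" where
  "arc_mean h = ereal (1 / (2 * pi)) *
       (enn2ereal (\<integral>\<^sup>+\<theta>\<in>{0..2*pi}. e2ennreal (h \<theta>) \<partial>lborel)
        - enn2ereal (\<integral>\<^sup>+\<theta>\<in>{0..2*pi}. e2ennreal (- h \<theta>) \<partial>lborel))"

lemma circle_mean_eq_arc_mean: "circle_mean f a r = arc_mean (\<lambda>\<theta>. f (a + of_real r * cis \<theta>))"
  by (simp add: circle_mean_def arc_mean_def)

lemma arc_mean_nonneg:
  assumes "\<And>\<theta>. 0 \<le> h \<theta>"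
  shows "arc_mean h = ereal (1 / (2 * pi)) * enn2ereal (\<integral>\<^sup>+\<theta>\<in>{0..2*pi}. e2ennreal (h \<theta>) \<partial>lborel)"
proof -
  have "e2ennreal (- h \<theta>) = 0" for \<theta>
    using assms by (intro e2ennreal_neg) simp
  then show ?thesis
    by (simp add: arc_mean_def zero_ennreal.rep_eq)
qed

lemma arc_mean_mono:
  assumes "\<And>\<theta>. \<theta> \<in> {0..2*pi} \<Longrightarrow> h \<theta> \<le> k \<theta>"
  shows "arc_mean h \<le> arc_mean k"
  unfolding arc_mean_def
  using assms
  by (intro ereal_mult_left_mono ereal_minus_mono iffD1[OF less_eq_ennreal.rep_eq] nn_integral_mono)
     (auto simp: indicator_def intro!: e2ennreal_mono)

lemma arc_mean_integrable:
  assumes k: "set_integrable lborel {0..2*pi} k" and h: "\<And>\<theta>. \<theta> \<in> {0..2*pi} \<Longrightarrow> h \<theta> = ereal (k \<theta>)"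
  shows "arc_mean h = ereal ((LINT \<theta>:{0..2*pi}|lborel. k \<theta>) / (2 * pi))"
proof -
  let ?k = "\<lambda>\<theta>. indicator {0..2*pi} \<theta> * k \<theta>"
  have int: "integrable lborel ?k"
    using k by (simp add: set_integrable_def)
  have p: "(\<integral>\<^sup>+\<theta>\<in>{0..2*pi}. e2ennreal (h \<theta>) \<partial>lborel) = (\<integral>\<^sup>+\<theta>. ennreal (?k \<theta>) \<partial>lborel)"
    by (intro nn_integral_cong) (auto simp: h e2ennreal_ereal indicator_def)
  have n: "(\<integral>\<^sup>+\<theta>\<in>{0..2*pi}. e2ennreal (- h \<theta>) \<partial>lborel) = (\<integral>\<^sup>+\<theta>. ennreal (- ?k \<theta>) \<partial>lborel)"
    by (intro nn_integral_cong) (auto simp: h e2ennreal_ereal indicator_def)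
  have fin: "(\<integral>\<^sup>+\<theta>. ennreal (?k \<theta>) \<partial>lborel) < \<infinity>" "(\<integral>\<^sup>+\<theta>. ennreal (- ?k \<theta>) \<partial>lborel) < \<infinity>"
    using int unfolding real_integrable_def by (auto simp: less_top)
  have "(LINT \<theta>:{0..2*pi}|lborel. k \<theta>)
      = enn2real (\<integral>\<^sup>+\<theta>. ennreal (?k \<theta>) \<partial>lborel) - enn2real (\<integral>\<^sup>+\<theta>. ennreal (- ?k \<theta>) \<partial>lborel)"
    using real_lebesgue_integral_def[OF int] by (simp add: set_lebesgue_integral_def)
  moreover have "enn2ereal x = ereal (enn2real x)" if "x < \<infinity>" for x
    using that by (cases x) auto
  ultimately show ?thesis
    using fin by (simp add: arc_mean_def p n)
qed

lemma has_integral_const_circle: "((\<lambda>_. c) has_integral 2 * pi * c) {0..2*pi}" for c :: real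
  using has_integral_const_real[of c 0 "2*pi"] by simp

lemma arc_mean_continuous:
  assumes "continuous_on {0..2*pi} k" "(k has_integral 2 * pi * m) {0..2*pi}"
  shows "arc_mean (\<lambda>\<theta>. ereal (k \<theta>)) = ereal m"
proof -
  have k: "set_integrable lborel {0..2*pi} k"
    using assms(1) by (intro borel_integrable_atLeastAtMost')
  have "(LINT \<theta>:{0..2*pi}|lborel. k \<theta>) = 2 * pi * m"
    using set_borel_integral_eq_integral(2)[OF k] assms(2) by (simp add: integral_unique)
  then show ?thesis
    using arc_mean_integrable[OF k, of "\<lambda>\<theta>. ereal (k \<theta>)"] by simp
qed

lemma arc_mean_le_continuous:
  assumes "\<And>\<theta>. \<theta> \<in> {0..2*pi} \<Longrightarrow> h \<theta> \<le> ereal (k \<theta>)"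
    and "continuous_on {0..2*pi} k" "(k has_integral 2 * pi * m) {0..2*pi}"
  shows "arc_mean h \<le> ereal m"
proof -
  have "arc_mean h \<le> arc_mean (\<lambda>\<theta>. ereal (k \<theta>))"
    using assms(1) by (rule arc_mean_mono)
  then show ?thesis
    using arc_mean_continuous[OF assms(2,3)] by simp
qed

lemma arc_mean_const: "arc_mean (\<lambda>_. ereal c) = ereal c"
  by (intro arc_mean_continuous has_integral_const_circle continuous_on_const)
lemma set_integrable_bounded_borel:
  assumes "k \<in> borel_measurable borel" "\<And>\<theta>. \<theta> \<in> {0..2*pi} \<Longrightarrow> \<bar>k \<theta>\<bar> \<le> M"
  shows "set_integrable lborel {0..2*pi} (k :: real \<Rightarrow> real)"
  unfolding set_integrable_def
proof (rule Bochner_Integration.integrable_bound)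
  show "integrable lborel (\<lambda>\<theta>. indicator {0..2*pi} \<theta> * M)"
    using borel_integrable_atLeastAtMost'[of 0 "2*pi" "\<lambda>_. M"] by (simp add: set_integrable_def)
  show "(\<lambda>x. indicat_real {0..2 * pi} x *\<^sub>R k x) \<in> borel_measurable lborel"
    using assms(1) by measurable
  show "AE x in lborel. norm (indicat_real {0..2 * pi} x *\<^sub>R k x) \<le> norm (indicat_real {0..2 * pi} x * M)"
    using assms(2) by (intro AE_I2) (force simp: indicator_def)
qed

lemma has_integral_Re_cis:
  "((\<lambda>\<theta>. Re (c * cis \<theta>)) has_integral 0) {0..2*pi}"
proof -
  have "((\<lambda>\<theta>. Re (c * cis \<theta>)) has_integral
          (Re c * sin (2*pi) + Im c * cos (2*pi)) - (Re c * sin 0 + Im c * cos 0)) {0..2*pi}"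
    by (intro fundamental_theorem_of_calculus)
       (auto intro!: derivative_eq_intros simp flip: has_real_derivative_iff_has_vector_derivative)
  then show ?thesis by simp
qed

lemma has_integral_cos_squared:
  "((\<lambda>\<theta>. (cos \<theta>)\<^sup>2) has_integral pi) {0..2*pi}"
proof -
  have "((\<lambda>\<theta>. (cos \<theta>)\<^sup>2) has_integral
          (2*pi + sin (2*pi) * cos (2*pi)) / 2 - (0 + sin 0 * cos 0) / 2) {0..2*pi}"
  proof (intro fundamental_theorem_of_calculus)
    fix x :: real
    have "((\<lambda>x. (x + sin x * cos x) / 2) has_real_derivative (1 + (cos x * cos x - sin x * sin x)) / 2)
            (at x within {0..2*pi})"
      by (auto intro!: derivative_eq_intros)
    moreover have "(1 + (cos x * cos x - sin x * sin x)) / 2 = (cos x)\<^sup>2"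
      using sin_cos_squared_add[of x] by (simp add: power2_eq_square algebra_simps)
    ultimately show "((\<lambda>x. (x + sin x * cos x) / 2) has_vector_derivative (cos x)\<^sup>2) (at x within {0..2*pi})"
      by (simp flip: has_real_derivative_iff_has_vector_derivative)
  qed auto
  then show ?thesis by simp
qed

text \<open>The mean value property of the real part of the holomorphic function \<open>Ln (1 + w z)\<close>.\<close>

lemma has_integral_ln_cmod:
  assumes "cmod w < 1"
  shows "((\<lambda>\<theta>. ln (cmod (1 + w * cis \<theta>))) has_integral 0) {0..2*pi}"
proof -
  have nz: "0 < Re (1 + w * u)" if "cmod u \<le> 1" for u
  proof -
    have "cmod (w * u) < 1"
      using assms that mult_left_le[of "cmod u" "cmod w"] by (simp add: norm_mult)
    then show ?thesis
      using abs_Re_le_cmod[of "w * u"] by simp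
  qed
  have "(\<lambda>u. Ln (1 + w * u)) holomorphic_on cball 0 1"
    by (intro holomorphic_intros) (use nz in \<open>force simp: complex_nonpos_Reals_iff\<close>)
  from Cauchy_integral_circlepath_simple[OF this, of 0]
  have "((\<lambda>u. Ln (1 + w * u) / u) has_contour_integral 0) (part_circlepath 0 1 0 (2*pi))"
    by (simp add: circlepath_def)
  then have "((\<lambda>\<theta>. Ln (1 + w * cis \<theta>) / cis \<theta> * \<i> * cis \<theta>) has_integral 0) {0..2*pi}"
    by (subst (asm) has_contour_integral_part_circlepath_iff) auto
  then have "((\<lambda>\<theta>. Im (Ln (1 + w * cis \<theta>) / cis \<theta> * \<i> * cis \<theta>)) has_integral Im 0) {0..2*pi}"
    by (rule has_integral_Im)
  moreover have "Im (Ln (1 + w * cis \<theta>) / cis \<theta> * \<i> * cis \<theta>) = ln (cmod (1 + w * cis \<theta>))" for \<theta>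
  proof -
    have "1 + w * cis \<theta> \<noteq> 0"
      using nz[of "cis \<theta>"] by (metis norm_cis order_refl zero_complex.sel(1) less_irrefl)
    then show ?thesis
      by simp
  qed
  ultimately show ?thesis
    by simp
qed

lemma cmod_one_plus_cis_pos:
  assumes "cmod w < 1"
  shows "0 < cmod (1 + w * cis \<theta>)"
proof -
  have "cmod (w * cis \<theta>) < 1"
    using assms by (simp add: norm_mult)
  moreover have "cmod (1::complex) \<le> cmod (1 + w * cis \<theta>) + cmod (w * cis \<theta>)"
    using norm_triangle_ineq4[of "1 + w * cis \<theta>" "w * cis \<theta>"] by simp
  ultimately show ?thesis
    unfolding norm_one by linarith
qed

lemma continuous_on_ln_cmod:
  assumes "cmod w < 1"
  shows "continuous_on {0..2*pi} (\<lambda>\<theta>. ln (cmod (1 + w * cis \<theta>)))"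
  using cmod_one_plus_cis_pos[OF assms]
  by (intro continuous_intros ballI) (simp add: less_imp_neq[symmetric])

lemma abs_ln_cmod_minus_Re:
  assumes "cmod w \<le> 1/2"
  shows "\<bar>ln (cmod (1 + w)) - Re w\<bar> \<le> 2 * (cmod w)\<^sup>2"
proof -
  have "1 + w \<noteq> 0"
    using cmod_one_plus_cis_pos[of w 0] assms by auto
  then have "ln (cmod (1 + w)) - Re w = Re (Ln (1 + w) - w)"
    by simp
  also have "\<bar>\<dots>\<bar> \<le> cmod (Ln (1 + w) - w)"
    by (rule abs_Re_le_cmod)
  also have "\<dots> \<le> (cmod w)\<^sup>2 / (1 - cmod w)"
    using assms by (intro Ln_approx_linear) auto
  also have "\<dots> \<le> (cmod w)\<^sup>2 / (1/2)"
    using assms by (intro divide_left_mono) auto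
  finally show ?thesis by simp
qed

section \<open>Plurisubharmonic functions\<close>

lemma coord_space_add [intro]: "x \<in> coord_space A \<Longrightarrow> y \<in> coord_space A \<Longrightarrow> x + y \<in> coord_space A"
  for x y :: "'a::monoid_add ^ 'n"
  by (simp add: coord_space_def)

lemma coord_space_mult [intro]: "x \<in> coord_space A \<Longrightarrow> t *s x \<in> coord_space A"
  for x :: "'a::mult_zero ^ 'n"
  by (simp add: coord_space_def)

lemma zero_in_coord_space [simp]: "0 \<in> coord_space A"
  by (simp add: coord_space_def)

lemma coord_space_UNIV [simp]: "coord_space UNIV = UNIV"
  by (simp add: coord_space_def)

lemma coord_proj_in [simp]: "coord_proj A z \<in> coord_space A"
  by (simp add: coord_space_def coord_proj_def)

lemma closed_coord_space: "closed (coord_space A :: (complex ^ 'n::finite) set)"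
proof -
  have "coord_space A = (\<Inter>i\<in>-A. {x :: complex ^ 'n. x $ i = 0})"
    by (auto simp: coord_space_def)
  then show ?thesis
    by (auto intro!: closed_INT closed_Collect_eq continuous_intros)
qed

lemma continuous_on_line [continuous_intros]:
  fixes b :: "complex ^ 'n::finite"
  assumes "continuous_on X f" "continuous_on X g"
  shows "continuous_on X (\<lambda>t. f t + g t *s b)"
proof -
  have "(\<lambda>t. f t + g t *s b) = (\<lambda>t. \<chi> i. f t $ i + g t * b $ i)"
    by (simp add: fun_eq_iff vec_eq_iff)
  moreover have "continuous_on X (\<lambda>t. \<chi> i. f t $ i + g t * b $ i)"
    using assms by (intro continuous_intros)
  ultimately show ?thesis
    by (simp only:)
qed

lemma norm_smult_complex: "norm (t *s b) = cmod t * norm b" for b :: "complex ^ 'n::finite"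
  by (simp add: norm_vec_def norm_mult L2_set_right_distrib)

text \<open>
  The definition by complex lines asks for the mean value inequality on every disc of a slice. Moving
  the base point to the centre of the disc leaves discs centred at the parameter \<open>0\<close> only.
\<close>

lemma psh_on_iff:
  "psh_on A \<Omega> u \<longleftrightarrow>
     openin (top_of_set (coord_space A)) \<Omega> \<and> (\<forall>z\<in>\<Omega>. u z < \<infinity>) \<and> usc_on \<Omega> u \<and>
     (\<forall>a\<in>\<Omega>. \<forall>b\<in>coord_space A. \<forall>r>0. (\<forall>t. cmod t \<le> r \<longrightarrow> a + t *s b \<in> \<Omega>) \<longrightarrow>
        u a \<le> arc_mean (\<lambda>\<theta>. u (a + (of_real r * cis \<theta>) *s b)))"
  (is "_ \<longleftrightarrow> ?rhs") for A :: "'n::finite set"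
proof
  assume psh: "psh_on A \<Omega> u"
  from psh have basic: "openin (top_of_set (coord_space A)) \<Omega>" "\<forall>z\<in>\<Omega>. u z < \<infinity>" "usc_on \<Omega> u"
    and slice: "\<forall>a\<in>\<Omega>. \<forall>b\<in>coord_space A. subharmonic_on {t. a + t *s b \<in> \<Omega>} (\<lambda>t. u (a + t *s b))"
    unfolding psh_on_def by - (elim conjE, assumption)+
  show ?rhs
  proof (intro conjI ballI allI impI)
    fix a b and r :: real
    assume a: "a \<in> \<Omega>" "b \<in> coord_space A" "0 < r" "\<forall>t. cmod t \<le> r \<longrightarrow> a + t *s b \<in> \<Omega>"
    then have "subharmonic_on {t. a + t *s b \<in> \<Omega>} (\<lambda>t. u (a + t *s b))"
      by (intro slice[rule_format])
    then have "0 < r \<longrightarrow> cball 0 r \<subseteq> {t. a + t *s b \<in> \<Omega>} \<longrightarrow>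
        u (a + 0 *s b) \<le> circle_mean (\<lambda>t. u (a + t *s b)) 0 r"
      unfolding subharmonic_on_def by (elim conjE allE)
    moreover have "cball 0 r \<subseteq> {t. a + t *s b \<in> \<Omega>}"
      using a by auto
    ultimately have "u (a + 0 *s b) \<le> circle_mean (\<lambda>t. u (a + t *s b)) 0 r"
      using a(3) by (simp only: simp_thms)
    then show "u a \<le> arc_mean (\<lambda>\<theta>. u (a + (of_real r * cis \<theta>) *s b))"
      by (simp add: circle_mean_eq_arc_mean)
  qed (use basic in simp_all)
next
  assume rhs: ?rhs
  then have basic: "openin (top_of_set (coord_space A)) \<Omega>" "\<forall>z\<in>\<Omega>. u z < \<infinity>" "usc_on \<Omega> u"
    by - (elim conjE, assumption)+
  from rhs have mean: "\<forall>a\<in>\<Omega>. \<forall>b\<in>coord_space A. \<forall>r>0. (\<forall>t. cmod t \<le> r \<longrightarrow> a + t *s b \<in> \<Omega>) \<longrightarrow>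
        u a \<le> arc_mean (\<lambda>\<theta>. u (a + (of_real r * cis \<theta>) *s b))"
    by (elim conjE)
  show "psh_on A \<Omega> u"
    unfolding psh_on_def
  proof (intro conjI ballI)
    fix a b :: "complex ^ 'n" assume a: "a \<in> \<Omega>" "b \<in> coord_space A"
    have ac: "a \<in> coord_space A"
      using basic(1) a openin_subset by fastforce
    have line: "a + t *s b \<in> coord_space A" for t
      using ac a by auto
    have cont: "continuous_on UNIV (\<lambda>t. a + t *s b)"
      by (intro continuous_intros)
    show "subharmonic_on {t. a + t *s b \<in> \<Omega>} (\<lambda>t. u (a + t *s b))"
      unfolding subharmonic_on_def
    proof (intro conjI ballI allI impI)
      obtain W where W: "open W" "\<Omega> = coord_space A \<inter> W"
        using basic(1) by (auto simp: openin_open)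
      have "{t. a + t *s b \<in> \<Omega>} = (\<lambda>t. a + t *s b) -` W"
        using W line by auto
      then show "open {t. a + t *s b \<in> \<Omega>}"
        using open_vimage[OF W(1) cont] by (simp only:)
      show "usc_on {t. a + t *s b \<in> \<Omega>} (\<lambda>t. u (a + t *s b))"
        by (rule usc_on_compose[OF basic(3) continuous_on_subset[OF cont subset_UNIV]]) blast
    next
      fix t0 and r :: real
      assume r: "0 < r" "cball t0 r \<subseteq> {t. a + t *s b \<in> \<Omega>}"
      have shift: "(a + t0 *s b) + t *s b = a + (t0 + t) *s b" for t
        by (simp add: vec_eq_iff algebra_simps)
      have mem: "a + (t0 + t) *s b \<in> \<Omega>" if "cmod t \<le> r" for t
      proof -
        have "t0 + t \<in> cball t0 r"
          using that by (simp add: dist_norm)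
        then show ?thesis
          using r(2) by auto
      qed
      have "a + t0 *s b \<in> \<Omega>" "\<And>t. cmod t \<le> r \<Longrightarrow> (a + t0 *s b) + t *s b \<in> \<Omega>"
        using mem[of 0] mem r(1) by (simp_all only: shift norm_zero less_imp_le add_0_right)
      then have "u (a + t0 *s b) \<le> arc_mean (\<lambda>\<theta>. u ((a + t0 *s b) + (of_real r * cis \<theta>) *s b))"
        using a(2) r(1) by (intro mean[rule_format]) auto
      then show "u (a + t0 *s b) \<le> circle_mean (\<lambda>t. u (a + t *s b)) t0 r"
        by (simp add: circle_mean_eq_arc_mean shift)
    qed (use basic in simp)
  qed (use basic in simp_all)
qed

lemma psh_onD:
  assumes "psh_on A \<Omega> u"
  shows "openin (top_of_set (coord_space A)) \<Omega>" "usc_on \<Omega> u" "z \<in> \<Omega> \<Longrightarrow> u z < \<infinity>"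
  using assms by (simp_all add: psh_on_def)

lemma psh_arc_mean:
  assumes "psh_on A \<Omega> u" "a \<in> \<Omega>" "b \<in> coord_space A" "0 < r"
    and "\<And>t. cmod t \<le> r \<Longrightarrow> a + t *s b \<in> \<Omega>"
  shows "u a \<le> arc_mean (\<lambda>\<theta>. u (a + (of_real r * cis \<theta>) *s b))"
  using assms by (simp add: psh_on_iff)

lemma psh_on_cong:
  assumes "psh_on A \<Omega> u" "\<And>z. z \<in> \<Omega> \<Longrightarrow> u z = v z"
  shows "psh_on A \<Omega> v"
proof -
  have *: "arc_mean (\<lambda>\<theta>. u (a + (of_real r * cis \<theta>) *s b)) = arc_mean (\<lambda>\<theta>. v (a + (of_real r * cis \<theta>) *s b))"
    if "\<forall>t. cmod t \<le> r \<longrightarrow> a + t *s b \<in> \<Omega>" "0 < r" for a b r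
  proof -
    have "u (a + (of_real r * cis \<theta>) *s b) = v (a + (of_real r * cis \<theta>) *s b)" for \<theta>
      using that by (intro assms(2)) (simp add: norm_mult)
    then show ?thesis by simp
  qed
  show ?thesis
    using assms usc_on_cong[of \<Omega> u v] * unfolding psh_on_iff by simp
qed

lemma psh_on_subset:
  assumes "psh_on A \<Omega> u" "openin (top_of_set (coord_space A)) \<Omega>'" "\<Omega>' \<subseteq> \<Omega>"
  shows "psh_on A \<Omega>' u"
  using assms usc_on_subset[of \<Omega> u \<Omega>'] unfolding psh_on_iff by (simp add: subset_iff)

text \<open>
  The form in which the mean value inequality is used: a continuous bound on a circle, with a mean that
  can be computed, bounds the value at the centre. It also applies to functions that take
  the value \<open>-\<infinity>\<close>.
\<close>

lemma psh_submean:
  assumes "psh_on A \<Omega> u" "a \<in> \<Omega>" "b \<in> coord_space A" "0 < r"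
    and "\<And>t. cmod t \<le> r \<Longrightarrow> a + t *s b \<in> \<Omega>"
    and "\<And>\<theta>. \<theta> \<in> {0..2*pi} \<Longrightarrow> u (a + (of_real r * cis \<theta>) *s b) \<le> ereal (k \<theta>)"
    and "continuous_on {0..2*pi} k" "(k has_integral 2 * pi * m) {0..2*pi}"
  shows "u a \<le> ereal m"
proof -
  have "u a \<le> arc_mean (\<lambda>\<theta>. u (a + (of_real r * cis \<theta>) *s b))"
    using assms(1-5) by (simp add: psh_on_iff)
  also have "\<dots> \<le> ereal m"
    using assms(6-8) by (rule arc_mean_le_continuous)
  finally show ?thesis .
qed

lemma usc_on_circle:
  assumes "usc_on (coord_space A) u" "a \<in> coord_space A" "b \<in> coord_space A"
  shows "usc_on UNIV (\<lambda>\<theta>. u (a + (of_real r * cis \<theta>) *s b))"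
  using assms by (intro usc_on_compose[OF assms(1)] continuous_intros) auto

text \<open>
  A function that is bounded below by a real constant is integrable over every circle, since upper
  semicontinuity bounds it above.
\<close>

lemma usc_circle_integrable:
  assumes "usc_on \<Omega> u" "\<And>z. z \<in> \<Omega> \<Longrightarrow> u z < \<infinity>" "\<And>z. z \<in> \<Omega> \<Longrightarrow> ereal m \<le> u z"
    and "\<And>\<theta>. a + (of_real r * cis \<theta>) *s b \<in> \<Omega>"
  shows "set_integrable lborel {0..2*pi} (\<lambda>\<theta>. real_of_ereal (u (a + (of_real r * cis \<theta>) *s b)))"
proof -
  let ?c = "\<lambda>\<theta>. a + (of_real r * cis \<theta>) *s b"
  have usc: "usc_on UNIV (\<lambda>\<theta>. u (?c \<theta>))"
    using assms(4) by (intro usc_on_compose[OF assms(1)] continuous_intros) auto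
  obtain M where M: "\<And>\<theta>. \<theta> \<in> {0..2*pi} \<Longrightarrow> u (?c \<theta>) \<le> ereal M"
    using assms(2)[OF assms(4)] usc_bounded_above[OF compact_Icc usc_on_subset[OF usc subset_UNIV], of 0 "2*pi"]
    by metis
  have "(\<lambda>\<theta>. real_of_ereal (u (?c \<theta>))) \<in> borel_measurable borel"
    using usc_measurable[OF usc] by measurable
  moreover have "\<bar>real_of_ereal (u (?c \<theta>))\<bar> \<le> \<bar>m\<bar> + \<bar>M\<bar>" if "\<theta> \<in> {0..2*pi}" for \<theta>
    using M[OF that] assms(3)[OF assms(4), of \<theta>] by (cases "u (?c \<theta>)") auto
  ultimately show ?thesis
    by (rule set_integrable_bounded_borel)
qed

lemma psh_submean_integral:
  assumes "psh_on A \<Omega> u" "\<And>z. z \<in> \<Omega> \<Longrightarrow> ereal m \<le> u z" "a \<in> \<Omega>" "b \<in> coord_space A" "0 < r"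
    and "\<And>t. cmod t \<le> r \<Longrightarrow> a + t *s b \<in> \<Omega>"
  shows "real_of_ereal (u a) \<le> (LINT \<theta>:{0..2*pi}|lborel. real_of_ereal (u (a + (of_real r * cis \<theta>) *s b))) / (2*pi)"
proof -
  have c: "a + (of_real r * cis \<theta>) *s b \<in> \<Omega>" for \<theta>
    using assms(5) by (intro assms(6)) (simp add: norm_mult)
  have u: "usc_on \<Omega> u" "\<And>z. z \<in> \<Omega> \<Longrightarrow> u z < \<infinity>"
    using assms(1) by (auto simp: psh_on_iff)
  have fin: "u z = ereal (real_of_ereal (u z))" if "z \<in> \<Omega>" for z
    using u(2)[OF that] assms(2)[OF that] by (cases "u z") auto
  have "u a \<le> arc_mean (\<lambda>\<theta>. u (a + (of_real r * cis \<theta>) *s b))"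
    using assms(1,3-6) by (simp add: psh_on_iff)
  also have "\<dots> = ereal ((LINT \<theta>:{0..2*pi}|lborel. real_of_ereal (u (a + (of_real r * cis \<theta>) *s b))) / (2*pi))"
    using fin[OF c] by (intro arc_mean_integrable usc_circle_integrable[OF u assms(2) c]) auto
  finally show ?thesis
    using fin[OF assms(3)] by (metis ereal_less_eq(3))
qed

lemma psh_onI_integral:
  assumes "openin (top_of_set (coord_space A)) \<Omega>" "usc_on \<Omega> (\<lambda>z. ereal (v z))" "\<And>z. z \<in> \<Omega> \<Longrightarrow> m \<le> v z"
    and "\<And>a b r. a \<in> \<Omega> \<Longrightarrow> b \<in> coord_space A \<Longrightarrow> 0 < r \<Longrightarrow> (\<And>t. cmod t \<le> r \<Longrightarrow> a + t *s b \<in> \<Omega>) \<Longrightarrow>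
        set_integrable lborel {0..2*pi} (\<lambda>\<theta>. v (a + (of_real r * cis \<theta>) *s b)) \<Longrightarrow>
        v a \<le> (LINT \<theta>:{0..2*pi}|lborel. v (a + (of_real r * cis \<theta>) *s b)) / (2*pi)"
  shows "psh_on A \<Omega> (\<lambda>z. ereal (v z))"
  unfolding psh_on_iff
proof (intro conjI ballI allI impI)
  fix a b and r :: real
  assume a: "a \<in> \<Omega>" "b \<in> coord_space A" "0 < r" "\<forall>t. cmod t \<le> r \<longrightarrow> a + t *s b \<in> \<Omega>"
  have c: "a + (of_real r * cis \<theta>) *s b \<in> \<Omega>" for \<theta>
    using a by (simp add: norm_mult)
  have int: "set_integrable lborel {0..2*pi} (\<lambda>\<theta>. v (a + (of_real r * cis \<theta>) *s b))"
    using usc_circle_integrable[OF assms(2) _ _ c, of m] assms(3) by simp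
  have "ereal (v a) \<le> ereal ((LINT \<theta>:{0..2*pi}|lborel. v (a + (of_real r * cis \<theta>) *s b)) / (2*pi))"
    using assms(4)[OF a(1-3) _ int] a(4) by simp
  also have "\<dots> = arc_mean (\<lambda>\<theta>. ereal (v (a + (of_real r * cis \<theta>) *s b)))"
    by (rule arc_mean_integrable[OF int, symmetric]) simp
  finally show "ereal (v a) \<le> arc_mean (\<lambda>\<theta>. ereal (v (a + (of_real r * cis \<theta>) *s b)))" .
qed (use assms in auto)

lemma psh_max_const:
  assumes "psh_on A \<Omega> u"
  shows "psh_on A \<Omega> (\<lambda>z. max (u z) (ereal c))"
  unfolding psh_on_iff
proof (intro conjI ballI allI impI)
  show "usc_on \<Omega> (\<lambda>z. max (u z) (ereal c))"
  proof (rule usc_onI)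
    fix x d assume "x \<in> \<Omega>" "max (u x) (ereal c) < d"
    then show "\<exists>W. open W \<and> x \<in> W \<and> (\<forall>y\<in>W \<inter> \<Omega>. max (u y) (ereal c) < d)"
      using assms usc_onD[of \<Omega> u x d] by (simp add: psh_on_iff)
  qed
next
  fix a b and r :: real
  assume a: "a \<in> \<Omega>" "b \<in> coord_space A" "0 < r" "\<forall>t. cmod t \<le> r \<longrightarrow> a + t *s b \<in> \<Omega>"
  let ?M = "arc_mean (\<lambda>\<theta>. max (u (a + (of_real r * cis \<theta>) *s b)) (ereal c))"
  have "u a \<le> arc_mean (\<lambda>\<theta>. u (a + (of_real r * cis \<theta>) *s b))"
    using assms a by (simp add: psh_on_iff)
  also have "\<dots> \<le> ?M"
    by (intro arc_mean_mono) simp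
  finally have "u a \<le> ?M" .
  moreover have "arc_mean (\<lambda>_. ereal c) \<le> ?M"
    by (intro arc_mean_mono) simp
  ultimately show "max (u a) (ereal c) \<le> ?M"
    by (simp add: arc_mean_const)
qed (use assms in \<open>auto simp: psh_on_iff max_def\<close>)

lemma psh_const:
  assumes "openin (top_of_set (coord_space A)) \<Omega>"
  shows "psh_on A \<Omega> (\<lambda>_. ereal c)"
  unfolding psh_on_iff using assms by (simp add: arc_mean_const usc_on_continuous)

text \<open>For functions bounded below, the means are ordinary integrals, and the shift commutes with them.\<close>

lemma psh_shift:
  assumes "psh_on A \<Omega> u" "\<And>z. z \<in> \<Omega> \<Longrightarrow> ereal m \<le> u z"
  shows "psh_on A \<Omega> (\<lambda>z. u z + ereal c)"
proof -
  let ?v = "\<lambda>z. real_of_ereal (u z) + c"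
  have u: "openin (top_of_set (coord_space A)) \<Omega>" "usc_on \<Omega> u" "\<And>z. z \<in> \<Omega> \<Longrightarrow> u z < \<infinity>"
    using assms(1) by (auto simp: psh_on_iff)
  have fin: "u z = ereal (real_of_ereal (u z))" if "z \<in> \<Omega>" for z
    using u(3)[OF that] assms(2)[OF that] by (cases "u z") auto
  have eq: "u z + ereal c = ereal (?v z)" if "z \<in> \<Omega>" for z
    using fin[OF that] by (metis plus_ereal.simps(1))
  have "psh_on A \<Omega> (\<lambda>z. ereal (?v z))"
  proof (rule psh_onI_integral)
    show "usc_on \<Omega> (\<lambda>z. ereal (?v z))"
      using usc_on_add_continuous[OF u(2), of "\<lambda>_. c"] eq by (auto intro: usc_on_cong)
    show "m + c \<le> ?v z" if "z \<in> \<Omega>" for z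
      using assms(2)[OF that] fin[OF that] by (metis add_right_mono ereal_less_eq(3))
  next
    fix a b and r :: real
    assume a: "a \<in> \<Omega>" "b \<in> coord_space A" "0 < r" "\<And>t. cmod t \<le> r \<Longrightarrow> a + t *s b \<in> \<Omega>"
    let ?c = "\<lambda>\<theta>. a + (of_real r * cis \<theta>) *s b"
    have c: "?c \<theta> \<in> \<Omega>" for \<theta>
      using a by (simp add: norm_mult)
    have "(LINT \<theta>:{0..2*pi}|lborel. ?v (?c \<theta>))
        = (LINT \<theta>:{0..2*pi}|lborel. real_of_ereal (u (?c \<theta>))) + (LINT \<theta>:{0..2*pi}|lborel. c)"
      by (intro set_integral_add usc_circle_integrable[OF u(2,3) assms(2) c]
          borel_integrable_atLeastAtMost') auto
    moreover have "(LINT \<theta>:{0..2*pi}|lborel. c) = 2 * pi * c"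
      using set_borel_integral_eq_integral(2)[OF borel_integrable_atLeastAtMost', of 0 "2*pi" "\<lambda>_. c"]
      by simp
    ultimately show "?v a \<le> (LINT \<theta>:{0..2*pi}|lborel. ?v (?c \<theta>)) / (2*pi)"
      using psh_submean_integral[OF assms a] by (simp add: add_divide_distrib)
  qed (rule u(1))
  then show ?thesis
    by (rule psh_on_cong) (simp add: eq)
qed

lemma psh_dilate:
  fixes A :: "'n::finite set"
  assumes "psh_on A (coord_space A) u"
  shows "psh_on A (coord_space A) (\<lambda>z. u (w *s z))"
  unfolding psh_on_iff
proof (intro conjI ballI allI impI)
  have "continuous_on (coord_space A) (\<lambda>z. \<chi> i. w * z $ i)"
    by (intro continuous_intros)
  then have "continuous_on (coord_space A) (\<lambda>z. w *s z)"
    by (simp add: vector_scalar_mult_def)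
  then show "usc_on (coord_space A) (\<lambda>z. u (w *s z))"
    by (rule usc_on_compose[OF psh_onD(2)[OF assms]]) auto
next
  fix a b :: "complex ^ 'n" and r :: real
  assume a: "a \<in> coord_space A" "b \<in> coord_space A" "0 < r"
  have "u (w *s a) \<le> arc_mean (\<lambda>\<theta>. u (w *s a + (of_real r * cis \<theta>) *s (w *s b)))"
    by (rule psh_arc_mean[OF assms]) (use a in auto)
  also have "(\<lambda>\<theta>. w *s a + (of_real r * cis \<theta>) *s (w *s b)) = (\<lambda>\<theta>. w *s (a + (of_real r * cis \<theta>) *s b))"
    by (simp add: fun_eq_iff vec_eq_iff algebra_simps)
  then have "arc_mean (\<lambda>\<theta>. u (w *s a + (of_real r * cis \<theta>) *s (w *s b)))
      = arc_mean (\<lambda>\<theta>. u (w *s (a + (of_real r * cis \<theta>) *s b)))"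
    by (metis (no_types))
  finally show "u (w *s a) \<le> arc_mean (\<lambda>\<theta>. u (w *s (a + (of_real r * cis \<theta>) *s b)))" .
qed (use psh_onD[OF assms] in auto)

section \<open>Growth of functions in the Lelong classes\<close>

lemma support_fun_upper:
  assumes "compact S" "x \<in> S"
  shows "x \<bullet> \<xi> \<le> support_fun S \<xi>"
proof -
  have "compact ((\<lambda>x. x \<bullet> \<xi>) ` S)"
    using assms(1) by (intro compact_continuous_image continuous_intros)
  then have "bdd_above ((\<lambda>x. x \<bullet> \<xi>) ` S)"
    by (intro bounded_imp_bdd_above compact_imp_bounded)
  then show ?thesis
    unfolding support_fun_def using assms(2) by (intro cSUP_upper)
qed

lemma support_fun_least:
  assumes "S \<noteq> {}" "\<And>x. x \<in> S \<Longrightarrow> x \<bullet> \<xi> \<le> c"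
  shows "support_fun S \<xi> \<le> c"
  unfolding support_fun_def using assms by (intro cSUP_least)

abbreviation logabs :: "complex ^ 'n \<Rightarrow> real ^ 'n" where
  "logabs w \<equiv> (\<chi> i. ln (cmod (w $ i)))"

text \<open>
  The direction \<open>b\<close> moves exactly the coordinates that vanish at \<open>z\<close>, so that the line meets the coordinate
  hyperplanes at \<open>z\<close> only.
\<close>

lemma line_into_torus:
  fixes A :: "'n::finite set"
  assumes "z \<in> coord_space A"
  obtains b where "b \<in> coord_space A" "\<And>t. t \<noteq> 0 \<Longrightarrow> z + t *s b \<in> torus A"
proof -
  define b :: "complex ^ 'n" where "b = (\<chi> i. if i \<in> A \<and> z $ i = 0 then 1 else 0)"
  have "b \<in> coord_space A"
    by (simp add: b_def coord_space_def)
  moreover have "z + t *s b \<in> torus A" if "t \<noteq> 0" for t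
    using assms that by (auto simp: torus_def coord_space_def b_def)
  ultimately show ?thesis
    by (rule that)
qed

lemma line_in_nbhd:
  fixes b :: "complex ^ 'n::finite"
  assumes "open W" "z \<in> W"
  obtains r where "0 < r" "\<And>t. cmod t \<le> r \<Longrightarrow> z + t *s b \<in> W"
proof -
  have "open ((\<lambda>t. z + t *s b) -` W)"
    by (intro open_vimage assms continuous_intros)
  moreover have "0 \<in> (\<lambda>t. z + t *s b) -` W"
    using assms by simp
  ultimately obtain r where "r > 0" "cball 0 r \<subseteq> (\<lambda>t. z + t *s b) -` W"
    using open_contains_cball by blast
  then show ?thesis
    by (intro that[of r]) (auto simp: subset_iff)
qed

text \<open>
  The supporting function \<open>\<phi>\<close> of \<open>S\<close> measures the growth in a Lelong class. The constant \<open>C\<close> bounds the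
  coordinates of \<open>S\<close> and thus serves as a Lipschitz constant of \<open>\<phi>\<close>.
\<close>

locale growth_body =
  fixes A :: "'n::finite set" and S :: "(real ^ 'n) set" and C :: real
  assumes body_subset: "S \<subseteq> coord_space A \<inter> nonneg_orthant"
    and body_compact: "compact S" and body_zero: "0 \<in> S"
    and C_nonneg: "0 \<le> C" and body_le_C: "x \<in> S \<Longrightarrow> x $ i \<le> C"
begin

abbreviation "\<phi> \<equiv> support_fun S"

lemma inner_body: "x \<in> S \<Longrightarrow> x \<bullet> \<xi> = (\<Sum>i\<in>A. x $ i * \<xi> $ i)"
proof -
  assume "x \<in> S"
  then have "x $ i = 0" if "i \<notin> A" for i
    using body_subset that by (auto simp: coord_space_def)
  then show ?thesis
    by (simp add: inner_vec_def) (intro sum.mono_neutral_right, auto)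
qed

lemma body_nonneg: "x \<in> S \<Longrightarrow> 0 \<le> x $ i"
  using body_subset by (auto simp: nonneg_orthant_def)

lemma phi_nonneg: "0 \<le> \<phi> \<xi>"
  using support_fun_upper[OF body_compact body_zero, of \<xi>] by simp

lemma phi_shift: "\<phi> \<xi>' \<le> \<phi> \<xi> + C * (\<Sum>i\<in>A. \<bar>\<xi>' $ i - \<xi> $ i\<bar>)"
proof (rule support_fun_least)
  fix x assume x: "x \<in> S"
  have "x \<bullet> \<xi>' = (\<Sum>i\<in>A. x $ i * \<xi> $ i) + (\<Sum>i\<in>A. x $ i * (\<xi>' $ i - \<xi> $ i))"
    by (simp add: inner_body[OF x] algebra_simps flip: sum.distrib)
  also have "(\<Sum>i\<in>A. x $ i * (\<xi>' $ i - \<xi> $ i)) \<le> (\<Sum>i\<in>A. C * \<bar>\<xi>' $ i - \<xi> $ i\<bar>)"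
  proof (rule sum_mono)
    fix i
    have "x $ i * (\<xi>' $ i - \<xi> $ i) \<le> x $ i * \<bar>\<xi>' $ i - \<xi> $ i\<bar>"
      using body_nonneg[OF x] by (intro mult_left_mono) auto
    also have "\<dots> \<le> C * \<bar>\<xi>' $ i - \<xi> $ i\<bar>"
      using body_le_C[OF x] by (intro mult_right_mono) auto
    finally show "x $ i * (\<xi>' $ i - \<xi> $ i) \<le> C * \<bar>\<xi>' $ i - \<xi> $ i\<bar>" .
  qed
  also have "(\<Sum>i\<in>A. x $ i * \<xi> $ i) \<le> \<phi> \<xi>"
    using support_fun_upper[OF body_compact x, of \<xi>] by (simp add: inner_body[OF x])
  finally show "x \<bullet> \<xi>' \<le> \<phi> \<xi> + C * (\<Sum>i\<in>A. \<bar>\<xi>' $ i - \<xi> $ i\<bar>)"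
    by (simp add: sum_distrib_left)
qed (use body_zero in auto)

lemma phi_near:
  assumes "\<And>i. i \<in> A \<Longrightarrow> \<bar>\<xi>' $ i - \<xi> $ i\<bar> \<le> d" "0 \<le> d"
  shows "\<phi> \<xi>' \<le> \<phi> \<xi> + C * CARD('n) * d"
proof -
  have "(\<Sum>i\<in>A. \<bar>\<xi>' $ i - \<xi> $ i\<bar>) \<le> card A * d"
    using assms(1) by (intro sum_bounded_above) auto
  also have "\<dots> \<le> CARD('n) * d"
    using assms(2) card_mono[of UNIV A] by (intro mult_right_mono) auto
  finally show ?thesis
    using phi_shift[of \<xi>' \<xi>] C_nonneg by (smt (verit, best) mult.assoc mult_left_mono)
qed

lemma phi_scale: "0 \<le> s \<Longrightarrow> \<phi> (s *\<^sub>R \<xi>) \<le> s * \<phi> \<xi>"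
  using body_zero support_fun_upper[OF body_compact, of _ \<xi>]
  by (intro support_fun_least) (auto intro!: mult_left_mono)

lemma phi_growth: "\<phi> (logabs w) \<le> C * CARD('n) * ln (1 + norm w)"
proof (rule support_fun_least)
  fix x assume x: "x \<in> S"
  have l: "0 \<le> ln (1 + norm w)"
    by simp
  have "x \<bullet> logabs w = (\<Sum>i\<in>A. x $ i * ln (cmod (w $ i)))"
    by (simp add: inner_body[OF x])
  also have "\<dots> \<le> (\<Sum>i\<in>A. C * ln (1 + norm w))"
  proof (rule sum_mono)
    fix i
    have "ln (cmod (w $ i)) \<le> ln (1 + norm w)"
    proof (cases "w $ i = 0")
      case False
      then show ?thesis
        using Finite_Cartesian_Product.norm_nth_le[of w i] by (intro ln_mono) auto
    qed (use l in simp)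
    then have "x $ i * ln (cmod (w $ i)) \<le> x $ i * ln (1 + norm w)"
      using body_nonneg[OF x] by (intro mult_left_mono)
    also have "\<dots> \<le> C * ln (1 + norm w)"
      using body_le_C[OF x] l by (intro mult_right_mono)
    finally show "x $ i * ln (cmod (w $ i)) \<le> C * ln (1 + norm w)" .
  qed
  also have "\<dots> \<le> CARD('n) * (C * ln (1 + norm w))"
    using C_nonneg l card_mono[of UNIV A] by (simp add: mult_right_mono)
  finally show "x \<bullet> logabs w \<le> C * CARD('n) * ln (1 + norm w)"
    by (simp add: mult_ac)
qed (use body_zero in auto)

lemma log_support_torus: "z \<in> torus A \<Longrightarrow> log_support_fun A S z = ereal (\<phi> (logabs z))"
  by (simp add: log_support_fun_def)

lemma log_support_not_torus:
  "z \<notin> torus A \<Longrightarrow> log_support_fun A S z = Limsup (at z within torus A) (\<lambda>w. ereal (\<phi> (logabs w)))"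
  by (simp add: log_support_fun_def)

lemma log_support_le:
  "log_support_fun A S z \<le> ereal (C * CARD('n) * ln (1 + norm z))"
proof (cases "z \<in> torus A")
  case False
  let ?g = "\<lambda>w. ereal (C * CARD('n) * ln (1 + norm w))"
  show ?thesis
  proof (cases "trivial_limit (at z within torus A)")
    case True
    then show ?thesis
      unfolding log_support_not_torus[OF False] by simp
  next
    case nt: False
    have "((\<lambda>w. ln (1 + norm w)) \<longlongrightarrow> ln (1 + norm z)) (at z within torus A)"
      using norm_ge_zero[of z] by (intro tendsto_intros) linarith
    then have "(?g \<longlongrightarrow> ?g z) (at z within torus A)"
      by (intro tendsto_ereal tendsto_mult_left)
    then have "Limsup (at z within torus A) ?g = ?g z"
      using nt lim_imp_Limsup by blast
    then show ?thesis
      unfolding log_support_not_torus[OF False]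
      by (metis (no_types, lifting) Limsup_mono always_eventually ereal_less_eq(3) phi_growth)
  qed
qed (simp add: log_support_torus phi_growth)

text \<open>
  Off the torus, a plurisubharmonic function is controlled by its values on the torus: a complex line
  through the point that meets the complement of the torus in no other point
  gives a circle inside the torus over which the mean dominates the value at the centre.
\<close>

lemma psh_le_log_support:
  assumes u: "psh_on A (coord_space A) u" and le: "\<And>w. w \<in> torus A \<Longrightarrow> u w \<le> ereal (\<phi> (logabs w) + c)"
    and z: "z \<in> coord_space A"
  shows "u z \<le> log_support_fun A S z + ereal c"
proof (cases "z \<in> torus A")
  case True
  then show ?thesis
    using le[OF True] by (simp add: log_support_torus)
next
  case False
  show ?thesis
  proof (rule ccontr)
    assume "\<not> ?thesis"
    then obtain d where d: "log_support_fun A S z + ereal c < ereal d" "ereal d < u z"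
      using ereal_dense2[of "log_support_fun A S z + ereal c" "u z"] by (auto simp: not_le)
    then have "log_support_fun A S z < ereal (d - c)"
      by (cases "log_support_fun A S z") auto
    then have "\<forall>\<^sub>F w in at z within torus A. ereal (\<phi> (logabs w)) < ereal (d - c)"
      unfolding log_support_not_torus[OF False] by (rule Limsup_lessD)
    then obtain W where W: "open W" "z \<in> W"
        "\<And>w. w \<in> W \<Longrightarrow> w \<noteq> z \<Longrightarrow> w \<in> torus A \<Longrightarrow> \<phi> (logabs w) < d - c"
      unfolding eventually_at_topological by auto
    obtain b where b: "b \<in> coord_space A" "\<And>t. t \<noteq> 0 \<Longrightarrow> z + t *s b \<in> torus A"
      using line_into_torus[OF z] by metis
    obtain r where r: "0 < r" "\<And>t. cmod t \<le> r \<Longrightarrow> z + t *s b \<in> W"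
      using line_in_nbhd[OF W(1,2), of b] by metis
    have "u z \<le> ereal d"
    proof (rule psh_submean[OF u z b(1) r(1)])
      fix \<theta> :: real
      let ?t = "of_real r * cis \<theta>"
      have t: "?t \<noteq> 0" "cmod ?t \<le> r"
        using r(1) by (auto simp: norm_mult)
      have "u (z + ?t *s b) \<le> ereal (\<phi> (logabs (z + ?t *s b)) + c)"
        by (rule le[OF b(2)[OF t(1)]])
      also have "\<dots> \<le> ereal d"
        using W(3)[OF r(2)[OF t(2)] _ b(2)[OF t(1)]] False b(2)[OF t(1)] by force
      finally show "u (z + ?t *s b) \<le> ereal d" .
    qed (use z b in \<open>auto intro: has_integral_const_circle\<close>)
    then show False
      using d(2) by simp
  qed
qed

end

text \<open>
  A Bernstein--Walsh estimate on complex lines. On the line through the centre \<open>z0\<close> the function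
  is compared with \<open>(C + 1) ln \<bar>t\<bar>\<close>, which is harmonic off the origin and beats the growth of \<open>u\<close>
  on large circles; subtracting a small multiple of \<open>\<bar>t\<bar>\<^sup>2\<close> from the comparison function makes it
  strictly superharmonic, so that the difference cannot have an interior maximum. The bound does not
  depend on the constant \<open>c\<close>.
\<close>

lemma bernstein_walsh:
  fixes u :: "complex ^ 'n::finite \<Rightarrow> ereal"
  assumes u: "psh_on A (coord_space A) u" and z0: "z0 \<in> coord_space A"
    and ball: "\<And>z. z \<in> coord_space A \<Longrightarrow> dist z0 z < r \<Longrightarrow> u z \<le> 1" and r: "0 < r"
    and growth: "\<And>z. z \<in> coord_space A \<Longrightarrow> u z \<le> ereal (C * ln (1 + norm z) + c)" and C: "0 \<le> C"
    and z: "z \<in> coord_space A" and far: "r / 2 \<le> dist z0 z"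
  shows "u z \<le> ereal (1 + (C + 1) * ln (2 * dist z0 z / r))"
proof -
  define b where "b = z - z0"
  define \<beta> where "\<beta> = norm b"
  have \<beta>: "\<beta> = dist z0 z" "\<beta> > 0" "r / 2 \<le> \<beta>"
    using r far by (auto simp: \<beta>_def b_def dist_norm norm_minus_commute)
  have b: "b \<in> coord_space A"
    using z z0 by (simp add: b_def coord_space_def)
  define \<rho> where "\<rho> = r / (2 * \<beta>)"
  have \<rho>: "0 < \<rho>" "\<rho> \<le> 1"
    using \<beta> r by (auto simp: \<rho>_def field_simps)
  have ln\<rho>: "ln (2 * dist z0 z / r) = - ln \<rho>"
    using \<beta> r by (simp add: \<rho>_def ln_div ln_mult)
  \<comment> \<open>The radius \<open>R\<close> of the outer circle is the only place where the growth constant \<open>c\<close> of \<open>u\<close> enters.\<close>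
  define K where "K = 1 + \<bar>C * ln (1 + norm z0 + \<beta>) + c\<bar>"
  define R where "R = exp K"
  have R: "1 < R" "ln R = K"
    by (auto simp: R_def K_def)
  define g where "g t = u (z0 + t *s b)" for t
  have line: "z0 + t *s b \<in> coord_space A" for t
    using z0 b by auto
  have "u z + ereal \<eta> \<le> ereal (1 - (C + 1) * ln \<rho> + \<eta> * R\<^sup>2)" if \<eta>: "0 < \<eta>" for \<eta>
  proof -
    define h where "h t = \<eta> * (cmod t)\<^sup>2 - (C + 1) * ln (cmod t)" for t
    define X where "X = {t. \<rho> \<le> cmod t \<and> cmod t \<le> R}"
    have X: "compact X"
    proof -
      have "X = cball 0 R - ball 0 \<rho>"
        by (auto simp: X_def)
      then show ?thesis
        by (simp add: compact_diff)
    qed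
    have one: "1 \<in> X"
      using \<rho> R by (auto simp: X_def)
    have hc: "continuous_on X h"
      unfolding h_def using \<rho> by (intro continuous_intros) (auto simp: X_def)
    have lc: "continuous_on X (\<lambda>t. z0 + t *s b)"
      by (intro continuous_intros)
    have "usc_on X g"
      unfolding g_def by (rule usc_on_compose[OF psh_onD(2)[OF u] lc]) (use line in auto)
    then have usc: "usc_on X (\<lambda>t. g t + ereal (h t))"
      using hc by (rule usc_on_add_continuous)
    have "X \<noteq> {}"
      using one by auto
    then obtain t0 where t0: "t0 \<in> X" "\<And>t. t \<in> X \<Longrightarrow> g t + ereal (h t) \<le> g t0 + ereal (h t0)"
      using usc_attains_max[OF X _ usc] by blast
    have "g t0 + ereal (h t0) \<le> ereal (1 - (C + 1) * ln \<rho> + \<eta> * R\<^sup>2)"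
    proof (rule ccontr)
      assume neg: "\<not> ?thesis"
      have t0_nz: "cmod t0 > 0"
        using t0(1) \<rho> by (auto simp: X_def)
      have ub: "h t0 \<le> \<eta> * R\<^sup>2 - (C + 1) * ln (cmod t0)"
        using t0(1) \<eta> \<rho> by (auto simp: h_def X_def intro!: power_mono)
      have "g t0 \<noteq> \<infinity>"
        using psh_onD(3)[OF u line] by (auto simp: g_def)
      moreover have "g t0 \<noteq> -\<infinity>"
        using neg by auto
      ultimately obtain g0 where g0: "g t0 = ereal g0"
        by (cases "g t0") auto
      have inner: "\<rho> < cmod t0"
      proof (rule ccontr)
        assume "\<not> \<rho> < cmod t0"
        then have eq: "cmod t0 = \<rho>"
          using t0(1) by (simp add: X_def)
        have "dist z0 (z0 + t0 *s b) = \<rho> * \<beta>"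
          by (simp add: dist_norm norm_smult_complex eq \<beta>_def)
        also have "\<dots> < r"
          using \<beta>(2) r by (simp add: \<rho>_def)
        finally have "g t0 \<le> 1"
          unfolding g_def by (intro ball line)
        then show False
          using neg ub g0 eq by simp
      qed
      have outer: "cmod t0 < R"
      proof (rule ccontr)
        assume "\<not> cmod t0 < R"
        then have eq: "cmod t0 = R"
          using t0(1) by (simp add: X_def)
        have "norm (z0 + t0 *s b) \<le> norm z0 + R * \<beta>"
          using norm_triangle_ineq[of z0 "t0 *s b"] by (simp add: norm_smult_complex eq \<beta>_def)
        then have "1 + norm (z0 + t0 *s b) \<le> (1 + norm z0 + \<beta>) * R"
          using R(1) mult_right_mono[of 1 R "1 + norm z0"] by (simp add: algebra_simps)
        then have "ln (1 + norm (z0 + t0 *s b)) \<le> ln ((1 + norm z0 + \<beta>) * R)"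
          using R(1) \<beta>(2) by (intro ln_mono) (auto intro: add_pos_nonneg mult_pos_pos)
        also have "\<dots> = ln (1 + norm z0 + \<beta>) + K"
          using R \<beta>(2) norm_ge_zero[of z0] by (subst ln_mult_pos) linarith+
        finally have "C * ln (1 + norm (z0 + t0 *s b)) \<le> C * ln (1 + norm z0 + \<beta>) + C * K"
          using C by (metis distrib_left mult_left_mono)
        moreover have "C * ln (1 + norm z0 + \<beta>) + c \<le> K"
          by (simp add: K_def)
        ultimately have "C * ln (1 + norm (z0 + t0 *s b)) + c \<le> (C + 1) * K"
          by (simp add: algebra_simps)
        moreover have "g t0 \<le> ereal (C * ln (1 + norm (z0 + t0 *s b)) + c)"
          unfolding g_def by (intro growth line)
        ultimately have "g0 \<le> (C + 1) * K"
          using g0 by simp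
        moreover have "(C + 1) * ln \<rho> \<le> 0"
          using C \<rho> by (simp add: mult_nonneg_nonpos)
        ultimately show False
          using neg ub g0 eq R(2) by simp
      qed
      define s where "s = min (cmod t0 - \<rho>) (R - cmod t0)"
      have s: "0 < s" "s < cmod t0"
        using inner outer \<rho> by (auto simp: s_def)
      let ?w = "of_real s / t0"
      have w: "cmod ?w < 1"
        using s t0_nz by (simp add: norm_divide)
      define k where "k \<theta> = g0 + (C + 1) * ln (cmod (1 + ?w * cis \<theta>)) - \<eta> * (s\<^sup>2 + 2 * s * Re (cnj t0 * cis \<theta>))" for \<theta>
      have "u (z0 + t0 *s b) \<le> ereal (g0 - \<eta> * s\<^sup>2)"
      proof (rule psh_submean[OF u line b s(1)])
        fix \<theta> :: real
        let ?t = "t0 + of_real s * cis \<theta>"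
        have t: "?t = t0 * (1 + ?w * cis \<theta>)"
          using t0_nz by (simp add: field_simps)
        have "cmod (of_real s * cis \<theta>) = s"
          using s by (simp add: norm_mult)
        then have "?t \<in> X"
          using norm_triangle_ineq[of t0 "of_real s * cis \<theta>"] norm_diff_ineq[of t0 "of_real s * cis \<theta>"]
          by (auto simp: X_def s_def)
        then have le: "g ?t + ereal (h ?t) \<le> ereal (g0 + h t0)"
          using t0(2)[of ?t] g0 by simp
        have "ln (cmod ?t) = ln (cmod t0) + ln (cmod (1 + ?w * cis \<theta>))"
          using t0_nz cmod_one_plus_cis_pos[OF w, of \<theta>] by (simp only: t norm_mult) (rule ln_mult_pos)
        moreover have "(cmod ?t)\<^sup>2 = (cmod t0)\<^sup>2 + s\<^sup>2 + 2 * s * Re (cnj t0 * cis \<theta>)"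
        proof -
          have "(x + s * c)\<^sup>2 + (y + s * d)\<^sup>2 = x\<^sup>2 + y\<^sup>2 + s\<^sup>2 * (c\<^sup>2 + d\<^sup>2) + 2 * s * (x * c + y * d)" for x y c d
            by (simp add: power2_eq_square algebra_simps)
          from this[of "Re t0" "cos \<theta>" "Im t0" "sin \<theta>"] show ?thesis
            by (simp add: cmod_power2)
        qed
        ultimately have "h ?t = h t0 + \<eta> * (s\<^sup>2 + 2 * s * Re (cnj t0 * cis \<theta>)) - (C + 1) * ln (cmod (1 + ?w * cis \<theta>))"
          by (simp add: h_def algebra_simps)
        then have "g ?t \<le> ereal (k \<theta>)"
          using le unfolding k_def by (cases "g ?t") (auto simp: algebra_simps)
        moreover have "z0 + t0 *s b + (of_real s * cis \<theta>) *s b = z0 + ?t *s b"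
          by (simp add: vec_eq_iff algebra_simps)
        ultimately show "u (z0 + t0 *s b + (of_real s * cis \<theta>) *s b) \<le> ereal (k \<theta>)"
          by (simp only: g_def)
      next
        show "continuous_on {0..2*pi} k"
          unfolding k_def by (intro continuous_intros continuous_on_ln_cmod[OF w])
        have "(k has_integral 2 * pi * g0 + (C + 1) * 0 - \<eta> * (2 * pi * s\<^sup>2 + 2 * s * 0)) {0..2*pi}"
          unfolding k_def
          by (intro has_integral_add has_integral_diff has_integral_mult_right has_integral_ln_cmod[OF w]
              has_integral_Re_cis has_integral_const_circle)
        then show "(k has_integral 2 * pi * (g0 - \<eta> * s\<^sup>2)) {0..2*pi}"
          by (simp add: algebra_simps)
      next
        show "z0 + t0 *s b + t *s b \<in> coord_space A" for t
          using line b by auto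
      qed
      then have "g0 \<le> g0 - \<eta> * s\<^sup>2"
        using g0 by (simp add: g_def)
      then show False
        using mult_pos_pos[OF \<eta> zero_less_power[OF s(1), of 2]] by linarith
    qed
    moreover have "g 1 = u z" "h 1 = \<eta>"
      by (simp_all add: g_def h_def b_def)
    ultimately show ?thesis
      using t0(2)[OF one] by simp
  qed
  note main = this
  show ?thesis
    unfolding ln\<rho>
  proof (rule ereal_le_epsilon2)
    fix e :: real assume e: "0 < e"
    define \<eta> where "\<eta> = e / R\<^sup>2"
    have \<eta>: "0 < \<eta>" "\<eta> * R\<^sup>2 = e"
      using e R by (auto simp: \<eta>_def)
    have "u z \<le> u z + ereal \<eta>"
      using \<eta>(1) by (cases "u z") auto
    also have "\<dots> \<le> ereal (1 - (C + 1) * ln \<rho> + \<eta> * R\<^sup>2)"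
      by (rule main[OF \<eta>(1)])
    also have "\<dots> = ereal (1 + (C + 1) * - ln \<rho>) + ereal e"
      using \<eta>(2) by simp
    finally show "u z \<le> ereal (1 + (C + 1) * - ln \<rho>) + ereal e" .
  qed
qed

context growth_body
begin

text \<open>
  If \<open>u \<le> M\<close> near the unit torus, then \<open>u\<close> exceeds \<open>\<phi>\<close> by at most \<open>M\<close>, whatever the constant \<open>c\<close> in its own
  growth condition. The classical argument restricts \<open>u\<close> to the exponential curve with coordinates
  \<open>a\<^sub>i exp (t \<xi>\<^sub>i)\<close>, where \<open>\<xi> = logabs z\<close>, and applies the maximum principle to the subharmonic function
  obtained in the half-plane \<open>Re t > 0\<close>. Plurisubharmonicity on complex lines is enough for
  this when the variables are doubled. The quantity
  \<open>u a - D \<Sum>\<^sub>i (ln \<bar>a\<^sub>i\<bar> - s \<xi>\<^sub>i)\<^sup>2 - (\<phi> \<xi> + \<delta>) s + \<eta> s\<^sup>2\<close>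
  is maximized over points \<open>a\<close> and parameters \<open>s \<in> [0, R]\<close> for which \<open>ln \<bar>a\<^sub>i\<bar>\<close> is close to \<open>s \<xi>\<^sub>i\<close>.
  At an interior maximum \<open>a\<close> is moved along the complex line with coordinates \<open>a\<^sub>i (1 + t \<xi>\<^sub>i)\<close>,
  tangent to the exponential curve, and \<open>s\<close> to \<open>s + Re t\<close>. The deviations \<open>ln \<bar>a\<^sub>i\<bar> - s \<xi>\<^sub>i\<close> then change by
  harmonic functions of size \<open>O(\<bar>t\<bar>\<^sup>2)\<close> with mean \<open>0\<close>. Hence the mean of the penalty over the circle
  \<open>\<bar>t\<bar> = r\<close> grows by \<open>O(r\<^sup>4)\<close> only, while \<open>\<eta> s\<^sup>2\<close> gains \<open>\<eta> r\<^sup>2 / 2\<close>: a contradiction for small \<open>r\<close>.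
\<close>

lemma torus_growth:
  assumes u: "psh_on A (coord_space A) u"
    and le: "\<And>w. w \<in> torus A \<Longrightarrow> u w \<le> ereal (\<phi> (logabs w) + c)"
    and M: "\<And>w. w \<in> torus A \<Longrightarrow> (\<And>i. i \<in> A \<Longrightarrow> \<bar>ln (cmod (w $ i))\<bar> \<le> 1) \<Longrightarrow> u w \<le> ereal M"
    and z: "z \<in> torus A"
  shows "u z \<le> ereal (\<phi> (logabs z) + M)"
proof -
  define \<xi> where "\<xi> = logabs z"
  \<comment> \<open>The weight \<open>D\<close> of the penalty outweighs all constants in the growth of \<open>u\<close> once some deviation reaches \<open>1\<close>.\<close>
  define D where "D = C * CARD('n) + \<bar>c\<bar> + \<bar>M\<bar>"
  have D: "0 \<le> D"
    using C_nonneg by (simp add: D_def)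
  have "u z \<le> ereal (\<phi> \<xi> + M) + ereal (2 * \<delta>)" if \<delta>: "0 < \<delta>" for \<delta>
  proof -
    \<comment> \<open>\<open>R\<close> is so large that \<open>\<delta> R\<close> absorbs the constant \<open>c\<close> at the end \<open>s = R\<close>, and \<open>\<eta> s\<^sup>2 \<le> \<delta>\<close> throughout.\<close>
    define R where "R = 1 + D / \<delta>"
    define \<eta> where "\<eta> = \<delta> / R\<^sup>2"
    have R: "1 \<le> R" "\<delta> * R = \<delta> + D"
      using D \<delta> by (auto simp: R_def field_simps)
    have \<eta>: "0 < \<eta>" "\<eta> * R\<^sup>2 = \<delta>"
      using R(1) \<delta> by (auto simp: \<eta>_def)
    have \<eta>s: "\<eta> * s\<^sup>2 \<le> \<delta>" if "0 \<le> s" "s \<le> R" for s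
      using \<eta> mult_left_mono[OF power_mono[OF that(2,1), of 2], of \<eta>] by simp
    define dev where "dev p i = ln (cmod (fst p $ i)) - snd p * \<xi> $ i" for p :: "(complex ^ 'n) \<times> real" and i
    define pen where "pen p = - D * (\<Sum>i\<in>A. (dev p i)\<^sup>2) - (\<phi> \<xi> + \<delta>) * snd p + \<eta> * (snd p)\<^sup>2" for p
    define X where "X = {p :: (complex ^ 'n) \<times> real. fst p \<in> coord_space A \<and> 0 \<le> snd p \<and> snd p \<le> R \<and>
        (\<forall>i\<in>A. exp (snd p * \<xi> $ i - 1) \<le> cmod (fst p $ i) \<and> cmod (fst p $ i) \<le> exp (snd p * \<xi> $ i + 1))}"
    have X_iff: "p \<in> X \<longleftrightarrow> fst p \<in> torus A \<and> 0 \<le> snd p \<and> snd p \<le> R \<and> (\<forall>i\<in>A. \<bar>dev p i\<bar> \<le> 1)" for p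
    proof -
      have *: "exp a \<le> cmod x \<and> cmod x \<le> exp b \<longleftrightarrow> x \<noteq> 0 \<and> a \<le> ln (cmod x) \<and> ln (cmod x) \<le> b" for a b x
      proof (cases "x = 0")
        case False
        then have "exp a \<le> cmod x \<longleftrightarrow> a \<le> ln (cmod x)" "cmod x \<le> exp b \<longleftrightarrow> ln (cmod x) \<le> b"
          using ln_le_cancel_iff[of "cmod x" "exp b"] by (simp_all add: ln_ge_iff del: ln_le_cancel_iff)
        then show ?thesis
          using False by simp
      qed (simp add: not_le)
      show ?thesis
        unfolding X_def dev_def torus_def mem_Collect_eq * by (auto simp: abs_le_iff)
    qed
    have X: "compact X"
    proof -
      define B where "B = (\<Sum>i\<in>UNIV. exp (R * \<bar>\<xi> $ i\<bar> + 1))"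
      have "X \<subseteq> cball 0 B \<times> {0..R}"
      proof
        fix p assume p: "p \<in> X"
        have "norm (fst p) \<le> (\<Sum>i\<in>UNIV. cmod (fst p $ i))"
          unfolding norm_vec_def by (intro L2_set_le_sum) simp
        also have "\<dots> \<le> B"
          unfolding B_def
        proof (rule sum_mono)
          fix i
          show "cmod (fst p $ i) \<le> exp (R * \<bar>\<xi> $ i\<bar> + 1)"
          proof (cases "i \<in> A")
            case True
            have "snd p * \<xi> $ i \<le> snd p * \<bar>\<xi> $ i\<bar>"
              using p by (intro mult_left_mono) (auto simp: X_def)
            also have "\<dots> \<le> R * \<bar>\<xi> $ i\<bar>"
              using p by (intro mult_right_mono) (auto simp: X_def)
            finally have "exp (snd p * \<xi> $ i + 1) \<le> exp (R * \<bar>\<xi> $ i\<bar> + 1)"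
              by simp
            moreover have "cmod (fst p $ i) \<le> exp (snd p * \<xi> $ i + 1)"
              using p True by (auto simp: X_def)
            ultimately show ?thesis
              by linarith
          next
            case False
            then show ?thesis
              using p by (auto simp: X_def coord_space_def)
          qed
        qed
        finally show "p \<in> cball 0 B \<times> {0..R}"
          using p by (cases p) (auto simp: X_def)
      qed
      moreover have "closed X"
      proof -
        have "X = (fst -` coord_space A \<inter> {p. 0 \<le> snd p} \<inter> {p. snd p \<le> R}) \<inter>
            (\<Inter>i\<in>A. {p. exp (snd p * \<xi> $ i - 1) \<le> cmod (fst p $ i)} \<inter> {p. cmod (fst p $ i) \<le> exp (snd p * \<xi> $ i + 1)})"
          by (auto simp: X_def)
        moreover have "closed (fst -` coord_space A :: ((complex ^ 'n) \<times> real) set)"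
          by (intro closed_vimage closed_coord_space continuous_intros)
        ultimately show ?thesis
          by (auto intro!: closed_Int closed_INT closed_Collect_le continuous_intros)
      qed
      ultimately show ?thesis
        using compact_Times[OF compact_cball compact_Icc] by (metis compact_Int_closed inf.absorb_iff2)
    qed
    have zX: "(z, 1) \<in> X"
      using z R by (simp add: X_iff dev_def \<xi>_def)
    have pc: "continuous_on X pen"
      unfolding pen_def dev_def by (intro continuous_intros) (auto simp: X_iff torus_def)
    have "usc_on X (\<lambda>p. u (fst p))"
      by (rule usc_on_compose[OF psh_onD(2)[OF u] continuous_on_fst[OF continuous_on_id]])
         (auto simp: X_def)
    then have usc: "usc_on X (\<lambda>p. u (fst p) + ereal (pen p))"
      using pc by (rule usc_on_add_continuous)
    have "X \<noteq> {}"
      using zX by auto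
    then obtain p where p: "p \<in> X" "\<And>p'. p' \<in> X \<Longrightarrow> u (fst p') + ereal (pen p') \<le> u (fst p) + ereal (pen p)"
      using usc_attains_max[OF X _ usc] by blast
    define a where "a = fst p"
    define s where "s = snd p"
    have pt: "a \<in> torus A" "0 \<le> s" "s \<le> R" "\<And>i. i \<in> A \<Longrightarrow> \<bar>dev p i\<bar> \<le> 1"
      using p(1) by (auto simp: X_iff a_def s_def)
    have aA: "a \<in> coord_space A"
      using pt(1) by (simp add: torus_def)
    have "u a + ereal (pen p) \<le> ereal (M + \<delta>)"
    proof (rule ccontr)
      assume neg: "\<not> ?thesis"
      have "u a \<noteq> \<infinity>"
        using psh_onD(3)[OF u aA] by auto
      moreover have "u a \<noteq> -\<infinity>"
        using neg by auto
      ultimately obtain u0 where u0: "u a = ereal u0"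
        by (cases "u a") auto
      have neg': "M + \<delta> < u0 + pen p"
        using neg u0 by simp
      have pen_le: "pen p \<le> - D * (\<Sum>i\<in>A. (dev p i)\<^sup>2) - (\<phi> \<xi> + \<delta>) * s + \<delta>"
        using \<eta>s[OF pt(2,3)] by (simp add: pen_def s_def)
      have sq: "0 \<le> D * (\<Sum>i\<in>A. (dev p i)\<^sup>2)"
        using D by (intro mult_nonneg_nonneg sum_nonneg) auto
      have u0_le: "u0 \<le> s * \<phi> \<xi> + D + M"
      proof -
        have "\<phi> (logabs a) \<le> \<phi> (s *\<^sub>R \<xi>) + C * CARD('n) * 1"
          using pt(4) by (intro phi_near) (auto simp: dev_def a_def s_def)
        also have "\<phi> (s *\<^sub>R \<xi>) \<le> s * \<phi> \<xi>"
          by (rule phi_scale[OF pt(2)])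
        finally have "u0 \<le> s * \<phi> \<xi> + C * CARD('n) + c"
          using le[OF pt(1)] u0 by simp
        then show ?thesis
          by (simp add: D_def)
      qed
      \<comment> \<open>The three parts of the boundary, \<open>s = 0\<close>, \<open>s = R\<close> and \<open>\<bar>dev p i\<bar> = 1\<close>, do not contain the maximum.\<close>
      have "s \<noteq> 0"
      proof
        assume s0: "s = 0"
        have "u a \<le> ereal M"
          using pt(4) s0 by (intro M pt(1)) (auto simp: dev_def a_def s_def)
        then show False
          using u0 neg' pen_le s0 sq by simp
      qed
      then have s_pos: "0 < s"
        using pt(2) by simp
      have "s \<noteq> R"
      proof
        assume "s = R"
        then show False
          using R(2) u0_le neg' pen_le sq \<delta> by (simp add: algebra_simps)
      qed
      then have s_lt: "s < R"
        using pt(3) by simp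
      have dev_lt: "\<bar>dev p i\<bar> < 1" if i: "i \<in> A" for i
      proof (rule ccontr)
        assume "\<not> \<bar>dev p i\<bar> < 1"
        then have "\<bar>dev p i\<bar> = 1"
          using pt(4)[OF i] by simp
        then have "(dev p i)\<^sup>2 = 1"
          by (metis power2_abs one_power2)
        then have "1 \<le> (\<Sum>i\<in>A. (dev p i)\<^sup>2)"
          using member_le_sum[of i A "\<lambda>i. (dev p i)\<^sup>2"] i by simp
        then have "D \<le> D * (\<Sum>i\<in>A. (dev p i)\<^sup>2)"
          using D by (metis mult_left_mono mult_1_right)
        moreover have "0 \<le> \<delta> * s"
          using \<delta> pt(2) by simp
        ultimately show False
          using u0_le neg' pen_le \<delta> by (simp add: algebra_simps)
      qed
      \<comment> \<open>The radius keeps the circle inside \<open>X\<close> and makes the gain \<open>\<eta> r\<^sup>2 / 2\<close> exceed the penalty \<open>D Q r\<^sup>4\<close>.\<close>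
      define Q where "Q = (\<Sum>i\<in>A. 4 * (\<xi> $ i) ^ 4)"
      have "\<forall>\<^sub>F r in at_right 0. 0 < r \<and> r < s \<and> r < R - s \<and>
          (\<forall>i\<in>A. r * \<bar>\<xi> $ i\<bar> < 1/2 \<and> 2 * (r * \<xi> $ i)\<^sup>2 < 1 - \<bar>dev p i\<bar>) \<and> D * Q * r\<^sup>2 < \<eta> / 2"
      proof (intro eventually_conj eventually_ball_finite ballI finite)
        show "\<forall>\<^sub>F r in at_right (0::real). 0 < r"
          by (rule eventually_at_right_less)
        show "\<forall>\<^sub>F r in at_right 0. r < s" "\<forall>\<^sub>F r in at_right 0. r < R - s"
          using s_pos s_lt by (auto intro!: order_tendstoD(2)[OF tendsto_ident_at])
        have "((\<lambda>r. D * Q * r\<^sup>2) \<longlongrightarrow> D * Q * 0\<^sup>2) (at_right 0)"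
          by (intro tendsto_intros)
        then show "\<forall>\<^sub>F r in at_right 0. D * Q * r\<^sup>2 < \<eta> / 2"
          using \<eta>(1) by (intro order_tendstoD(2)) auto
        fix i assume i: "i \<in> A"
        have "((\<lambda>r. r * \<bar>\<xi> $ i\<bar>) \<longlongrightarrow> 0 * \<bar>\<xi> $ i\<bar>) (at_right 0)"
          by (intro tendsto_intros)
        then show "\<forall>\<^sub>F r in at_right 0. r * \<bar>\<xi> $ i\<bar> < 1/2"
          by (intro order_tendstoD(2)) auto
        have "((\<lambda>r. 2 * (r * \<xi> $ i)\<^sup>2) \<longlongrightarrow> 2 * (0 * \<xi> $ i)\<^sup>2) (at_right 0)"
          by (intro tendsto_intros)
        then show "\<forall>\<^sub>F r in at_right 0. 2 * (r * \<xi> $ i)\<^sup>2 < 1 - \<bar>dev p i\<bar>"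
          using dev_lt[OF i] by (intro order_tendstoD(2)) auto
      qed
      then obtain r where r: "0 < r" "r < s" "r < R - s" "\<And>i. i \<in> A \<Longrightarrow> r * \<bar>\<xi> $ i\<bar> < 1/2"
          "\<And>i. i \<in> A \<Longrightarrow> 2 * (r * \<xi> $ i)\<^sup>2 < 1 - \<bar>dev p i\<bar>" "D * Q * r\<^sup>2 < \<eta> / 2"
        using eventually_happens'[OF trivial_limit_at_right_real] by (smt (verit, ccfv_threshold))
      define b where "b = (\<chi> i. of_real (\<xi> $ i) * a $ i)"
      have b: "b \<in> coord_space A"
        using aA by (simp add: b_def coord_space_def)
      let ?w = "\<lambda>i. of_real (r * \<xi> $ i) :: complex"
      have w: "cmod (?w i) \<le> 1/2" "cmod (?w i) < 1" if "i \<in> A" for i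
        using r(4)[OF that] r(1) by (auto simp: norm_mult abs_mult simp del: of_real_mult)
      define e where "e \<theta> i = ln (cmod (1 + ?w i * cis \<theta>)) - r * \<xi> $ i * cos \<theta>" for \<theta> i
      have e: "\<bar>e \<theta> i\<bar> \<le> 2 * (r * \<xi> $ i)\<^sup>2" if "i \<in> A" for \<theta> i
        using abs_ln_cmod_minus_Re[of "?w i * cis \<theta>"] w(1)[OF that]
        by (simp add: e_def norm_mult power_mult_distrib abs_mult)
      define k where "k \<theta> = u0 + D * ((\<Sum>i\<in>A. 2 * dev p i * e \<theta> i) + Q * r ^ 4)
          + (\<phi> \<xi> + \<delta> - 2 * \<eta> * s) * (r * cos \<theta>) - \<eta> * r\<^sup>2 * (cos \<theta>)\<^sup>2" for \<theta>
      have "u a \<le> ereal (u0 + D * Q * r ^ 4 - \<eta> * r\<^sup>2 / 2)"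
      proof (rule psh_submean[OF u aA b r(1)])
        fix \<theta> :: real
        let ?t = "of_real r * cis \<theta>"
        define p' where "p' = (a + ?t *s b, s + r * cos \<theta>)"
        have comp: "fst p' $ i = a $ i * (1 + ?w i * cis \<theta>)" for i
          by (simp add: p'_def b_def algebra_simps)
        have dev': "dev p' i = dev p i + e \<theta> i" if i: "i \<in> A" for i
        proof -
          have "a $ i \<noteq> 0"
            using pt(1) i by (simp add: torus_def)
          then have "ln (cmod (fst p' $ i)) = ln (cmod (a $ i)) + ln (cmod (1 + ?w i * cis \<theta>))"
            unfolding comp norm_mult using cmod_one_plus_cis_pos[OF w(2)[OF i], of \<theta>] by (intro ln_mult_pos) auto
          moreover have "snd p' = s + r * cos \<theta>"
            by (simp add: p'_def)
          ultimately show ?thesis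
            by (simp only: dev_def e_def a_def s_def) (simp add: algebra_simps)
        qed
        have rcos: "\<bar>r * cos \<theta>\<bar> \<le> r"
          using r(1) abs_cos_le_one[of \<theta>] by (simp add: abs_mult mult_left_le)
        have "p' \<in> X"
          unfolding X_iff
        proof (intro conjI ballI)
          show "fst p' \<in> torus A"
            unfolding torus_def
          proof (intro CollectI conjI ballI)
            show "fst p' \<in> coord_space A"
              using aA b by (auto simp: p'_def)
            fix i assume i: "i \<in> A"
            then show "fst p' $ i \<noteq> 0"
              unfolding comp using pt(1) cmod_one_plus_cis_pos[OF w(2)[OF i], of \<theta>] by (auto simp: torus_def)
          qed
          show "0 \<le> snd p'" "snd p' \<le> R"
            using rcos r(2,3) by (auto simp: p'_def abs_le_iff)
          fix i assume i: "i \<in> A"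
          show "\<bar>dev p' i\<bar> \<le> 1"
            using dev'[OF i] e[OF i, of \<theta>] r(5)[OF i] by linarith
        qed
        from p(2)[OF this] have max: "u (fst p') \<le> ereal (u0 + pen p - pen p')"
          unfolding a_def[symmetric] u0 by (cases "u (fst p')") auto
        have "(\<Sum>i\<in>A. (dev p' i)\<^sup>2) \<le> (\<Sum>i\<in>A. (dev p i)\<^sup>2 + 2 * dev p i * e \<theta> i + 4 * (\<xi> $ i) ^ 4 * r ^ 4)"
        proof (rule sum_mono)
          fix i assume i: "i \<in> A"
          have "(e \<theta> i)\<^sup>2 \<le> (2 * (r * \<xi> $ i)\<^sup>2)\<^sup>2"
            using power_mono[OF e[OF i, of \<theta>] abs_ge_zero, of 2] by simp
          also have "\<dots> = 4 * (\<xi> $ i) ^ 4 * r ^ 4"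
            by (simp add: power2_eq_square power4_eq_xxxx mult_ac)
          finally show "(dev p' i)\<^sup>2 \<le> (dev p i)\<^sup>2 + 2 * dev p i * e \<theta> i + 4 * (\<xi> $ i) ^ 4 * r ^ 4"
            by (simp add: dev'[OF i] power2_sum)
        qed
        also have "\<dots> = (\<Sum>i\<in>A. (dev p i)\<^sup>2) + ((\<Sum>i\<in>A. 2 * dev p i * e \<theta> i) + Q * r ^ 4)"
          by (simp add: Q_def sum.distrib sum_distrib_right)
        finally have "D * (\<Sum>i\<in>A. (dev p' i)\<^sup>2)
            \<le> D * ((\<Sum>i\<in>A. (dev p i)\<^sup>2) + ((\<Sum>i\<in>A. 2 * dev p i * e \<theta> i) + Q * r ^ 4))"
          using D by (rule mult_left_mono)
        moreover have "snd p' = s + r * cos \<theta>" "snd p = s"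
          by (simp_all add: p'_def s_def)
        ultimately have "u0 + pen p - pen p' \<le> k \<theta>"
          by (simp add: pen_def k_def power2_sum algebra_simps power_mult_distrib)
        then have "ereal (u0 + pen p - pen p') \<le> ereal (k \<theta>)"
          by simp
        with max have "u (fst p') \<le> ereal (k \<theta>)"
          by (rule order_trans)
        then show "u (a + ?t *s b) \<le> ereal (k \<theta>)"
          by (simp add: p'_def)
      next
        show "continuous_on {0..2*pi} k"
          unfolding k_def e_def by (intro continuous_intros continuous_on_ln_cmod w)
        have cos: "((\<lambda>\<theta>. cos \<theta>) has_integral 0) {0..2*pi}"
          using has_integral_Re_cis[of 1] by simp
        have ei: "((\<lambda>\<theta>. e \<theta> i) has_integral 0 - r * \<xi> $ i * 0) {0..2*pi}" if "i \<in> A" for i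
          unfolding e_def
          by (intro has_integral_diff has_integral_mult_right has_integral_ln_cmod w that cos)
        have "(k has_integral 2 * pi * u0 + D * ((\<Sum>i\<in>A. 2 * dev p i * (0 - r * \<xi> $ i * 0)) + 2 * pi * (Q * r ^ 4))
            + (\<phi> \<xi> + \<delta> - 2 * \<eta> * s) * (r * 0) - \<eta> * r\<^sup>2 * pi) {0..2*pi}"
          unfolding k_def
          by (intro has_integral_add has_integral_diff has_integral_mult_right has_integral_sum finite
              has_integral_const_circle cos has_integral_cos_squared ei)
        then show "(k has_integral 2 * pi * (u0 + D * Q * r ^ 4 - \<eta> * r\<^sup>2 / 2)) {0..2*pi}"
          by (simp add: algebra_simps)
      next
        show "a + t *s b \<in> coord_space A" for t
          using aA b by auto
      qed
      then have "\<eta> / 2 * r\<^sup>2 \<le> (D * Q * r\<^sup>2) * r\<^sup>2"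
        using u0 by (simp add: power2_eq_square power4_eq_xxxx mult_ac)
      moreover have "(D * Q * r\<^sup>2) * r\<^sup>2 < \<eta> / 2 * r\<^sup>2"
        using r(1,6) by (intro mult_strict_right_mono) auto
      ultimately show False
        by linarith
    qed
    moreover have "u z + ereal (pen (z, 1)) \<le> u a + ereal (pen p)"
      using p(2)[OF zX] by (simp add: a_def)
    moreover have "pen (z, 1) = - (\<phi> \<xi> + \<delta>) + \<eta>"
      by (simp add: pen_def dev_def \<xi>_def)
    ultimately have "u z + ereal (- (\<phi> \<xi> + \<delta>) + \<eta>) \<le> ereal (M + \<delta>)"
      by simp
    then show ?thesis
      using \<eta>(1) by (cases "u z") auto
  qed
  note main = this
  show ?thesis
    unfolding \<xi>_def[symmetric]
  proof (rule ereal_le_epsilon2)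
    fix e :: real assume "0 < e"
    then show "u z \<le> ereal (\<phi> \<xi> + M) + ereal e"
      using main[of "e / 2"] by simp
  qed
qed

end

section \<open>Regularized suprema of plurisubharmonic functions\<close>

lemma eventually_usc_reg_filter:
  "eventually P (inf (nhds z) (principal X)) \<longleftrightarrow> (\<exists>W. open W \<and> z \<in> W \<and> (\<forall>y\<in>W \<inter> X. P y))"
  unfolding eventually_inf_principal eventually_nhds Ball_def Int_iff by (simp only: imp_conjL)

lemma usc_on_usc_reg: "usc_on X (usc_reg X f)"
proof (rule usc_onI)
  fix x c assume "x \<in> X" "usc_reg X f x < c"
  then obtain d where d: "usc_reg X f x < d" "d < c"
    using dense by blast
  then have "eventually (\<lambda>y. f y < d) (inf (nhds x) (principal X))"
    unfolding usc_reg_def by (intro Limsup_lessD) auto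
  then obtain W where W: "open W" "x \<in> W" "\<forall>y\<in>W \<inter> X. f y < d"
    unfolding eventually_usc_reg_filter by auto
  have "usc_reg X f y < c" if "y \<in> W \<inter> X" for y
  proof -
    have "eventually (\<lambda>y. f y \<le> d) (inf (nhds y) (principal X))"
      unfolding eventually_usc_reg_filter using W that by (intro exI[of _ W]) (auto intro: less_imp_le)
    then have "usc_reg X f y \<le> d"
      unfolding usc_reg_def by (rule Limsup_bounded)
    then show ?thesis
      using d(2) by (rule le_less_trans)
  qed
  then show "\<exists>W. open W \<and> x \<in> W \<and> (\<forall>y\<in>W \<inter> X. usc_reg X f y < c)"
    using W by (intro exI[of _ W]) auto
qed

lemma usc_reg_ge:
  assumes "z \<in> X"
  shows "f z \<le> usc_reg X f z"
proof (rule ccontr)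
  assume "\<not> ?thesis"
  then have "eventually (\<lambda>y. f y < f z) (inf (nhds z) (principal X))"
    unfolding usc_reg_def by (intro Limsup_lessD) auto
  then show False
    unfolding eventually_usc_reg_filter using assms by auto
qed

lemma usc_reg_le:
  assumes z: "z \<in> X" and W: "open W" "z \<in> W" and le: "\<And>y. y \<in> W \<Longrightarrow> y \<in> X \<Longrightarrow> f y \<le> ereal (g y)"
    and g: "continuous_on (W \<inter> X) g"
  shows "usc_reg X f z \<le> ereal (g z)"
proof (rule ereal_le_epsilon2)
  fix e :: real assume "0 < e"
  then have lt: "ereal (g z) < ereal (g z + e)"
    by simp
  obtain U where U: "open U" "z \<in> U" "\<forall>y\<in>U \<inter> (W \<inter> X). ereal (g y) < ereal (g z + e)"
    using usc_onD[OF usc_on_continuous[OF g] _ lt] z W(2) by auto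
  have "f y \<le> ereal (g z + e)" if "y \<in> (U \<inter> W) \<inter> X" for y
    using order_trans[OF le[of y] less_imp_le[OF bspec[OF U(3), of y]]] that by blast
  then have "eventually (\<lambda>y. f y \<le> ereal (g z + e)) (inf (nhds z) (principal X))"
    unfolding eventually_usc_reg_filter using U W by (intro exI[of _ "U \<inter> W"]) auto
  then show "usc_reg X f z \<le> ereal (g z) + ereal e"
    unfolding usc_reg_def by (simp add: Limsup_bounded)
qed

text \<open>
  Every member of the family satisfies the mean value inequality with its values on the circle
  replaced by the regularized supremum. Along a sequence of centres on which the supremum tends to
  its upper limit, the reverse Fatou lemma carries the inequality over to the limit, because
  the regularization is upper semicontinuous.
\<close>

lemma psh_usc_reg_SUP:
  fixes A :: "'n::finite set"
  assumes psh: "\<And>u. u \<in> \<F> \<Longrightarrow> psh_on A (coord_space A) u"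
    and V: "\<And>z. V z = (SUP u\<in>\<F>. u z)"
    and V0: "\<And>z. z \<in> coord_space A \<Longrightarrow> 0 \<le> V z"
    and g: "\<And>z. z \<in> coord_space A \<Longrightarrow> V z \<le> ereal (g z)" "continuous_on (coord_space A) g"
  shows "psh_on A (coord_space A) (usc_reg (coord_space A) V)"
proof -
  let ?X = "coord_space A :: (complex ^ 'n) set"
  define Vs where "Vs = usc_reg ?X V"
  have Vs_usc: "usc_on ?X Vs"
    unfolding Vs_def by (rule usc_on_usc_reg)
  have Vs_ge: "V z \<le> Vs z" if "z \<in> ?X" for z
    unfolding Vs_def using that by (rule usc_reg_ge)
  have Vs_le: "Vs z \<le> ereal (g z)" if "z \<in> ?X" for z
    unfolding Vs_def using that g by (intro usc_reg_le[of z ?X UNIV]) auto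
  have Vs0: "0 \<le> Vs z" if "z \<in> ?X" for z
    using V0[OF that] Vs_ge[OF that] by (rule order_trans)
  have V_mean: "V z \<le> arc_mean (\<lambda>\<theta>. Vs (z + (of_real r * cis \<theta>) *s b))"
    if z: "z \<in> ?X" and b: "b \<in> ?X" and r: "0 < r" for z b r
    unfolding V
  proof (rule SUP_least)
    fix u assume u: "u \<in> \<F>"
    have "u z \<le> arc_mean (\<lambda>\<theta>. u (z + (of_real r * cis \<theta>) *s b))"
      by (rule psh_arc_mean[OF psh[OF u] z b r]) (use z b in auto)
    also have "\<dots> \<le> arc_mean (\<lambda>\<theta>. Vs (z + (of_real r * cis \<theta>) *s b))"
    proof (rule arc_mean_mono)
      fix \<theta> :: real
      let ?p = "z + (of_real r * cis \<theta>) *s b"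
      have p: "?p \<in> ?X"
        using z b by auto
      have "u ?p \<le> V ?p"
        unfolding V using u by (rule SUP_upper)
      also have "\<dots> \<le> Vs ?p"
        using p by (rule Vs_ge)
      finally show "u ?p \<le> Vs ?p" .
    qed
    finally show "u z \<le> arc_mean (\<lambda>\<theta>. Vs (z + (of_real r * cis \<theta>) *s b))" .
  qed
  show ?thesis
    unfolding Vs_def[symmetric] psh_on_iff
  proof (intro conjI ballI allI impI)
    fix a b :: "complex ^ 'n" and r :: real
    assume a: "a \<in> ?X" and b: "b \<in> ?X" and r: "0 < r"
    define I where "I x = (\<integral>\<^sup>+\<theta>\<in>{0..2*pi}. e2ennreal (Vs (x + (of_real r * cis \<theta>) *s b)) \<partial>lborel)" for x
    have mean_eq: "arc_mean (\<lambda>\<theta>. Vs (x + (of_real r * cis \<theta>) *s b)) = ereal (1 / (2 * pi)) * enn2ereal (I x)"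
      if "x \<in> ?X" for x
      unfolding I_def using that b by (intro arc_mean_nonneg Vs0) auto
    obtain v where v: "Vs a = ereal v"
      using Vs0[OF a] Vs_le[OF a] by (cases "Vs a") auto
    have "\<exists>x. x \<in> ?X \<and> dist x a < inverse (real (Suc n)) \<and> ereal (v - inverse (real (Suc n))) < V x" for n
    proof (rule ccontr)
      assume neg: "\<not> ?thesis"
      have "V x \<le> ereal (v - inverse (real (Suc n)))" if "x \<in> ball a (inverse (real (Suc n))) \<inter> ?X" for x
      proof (rule ccontr)
        assume "\<not> ?thesis"
        then show False
          using neg that by (auto simp: dist_commute not_le)
      qed
      moreover have "a \<in> ball a (inverse (real (Suc n)))"
        by simp
      ultimately have "eventually (\<lambda>x. V x \<le> ereal (v - inverse (real (Suc n)))) (inf (nhds a) (principal ?X))"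
        unfolding eventually_usc_reg_filter by (intro exI[of _ "ball a (inverse (real (Suc n)))"] conjI open_ball) auto
      then have "Vs a \<le> ereal (v - inverse (real (Suc n)))"
        unfolding Vs_def usc_reg_def by (rule Limsup_bounded)
      then show False
        using v by simp
    qed
    then obtain x where x: "\<And>n. x n \<in> ?X" "\<And>n. dist (x n) a < inverse (real (Suc n))"
        "\<And>n. ereal (v - inverse (real (Suc n))) < V (x n)"
      by metis
    have xa: "x \<longlonglongrightarrow> a"
      unfolding tendsto_dist_iff[of x]
      by (rule tendsto_sandwich[OF _ _ tendsto_const LIMSEQ_inverse_real_of_nat])
         (intro always_eventually allI zero_le_dist less_imp_le x(2))+
    define p where "p y \<theta> = y + (of_real r * cis \<theta>) *s b" for y \<theta>
    have pX: "p y \<theta> \<in> ?X" if "y \<in> ?X" for y \<theta>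
      using that b by (auto simp: p_def)
    have pc: "(\<lambda>n. p (x n) \<theta>) \<longlonglongrightarrow> p a \<theta>" for \<theta>
      unfolding p_def by (intro tendsto_add xa tendsto_const)
    define \<rho> where "\<rho> = norm a + 1 + r * norm b"
    have "compact (?X \<inter> cball 0 \<rho>)"
      by (intro closed_Int_compact closed_coord_space compact_cball)
    then have "compact (g ` (?X \<inter> cball 0 \<rho>))"
      by (intro compact_continuous_image continuous_on_subset[OF g(2)]) auto
    then obtain G where G: "\<And>z. z \<in> ?X \<Longrightarrow> norm z \<le> \<rho> \<Longrightarrow> g z \<le> G"
      using bounded_imp_bdd_above[OF compact_imp_bounded] unfolding bdd_above_def by fastforce
    have norm_p: "norm (p (x n) \<theta>) \<le> \<rho>" for n \<theta>
    proof -
      have "norm (x n) \<le> norm a + dist (x n) a"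
        using norm_triangle_sub[of "x n" a] by (simp add: dist_norm)
      moreover have "dist (x n) a \<le> 1"
        using x(2)[of n] by (rule order_trans[OF less_imp_le]) (simp add: field_simps)
      moreover have "norm (p (x n) \<theta>) \<le> norm (x n) + r * norm b"
        using norm_triangle_ineq[of "x n" "(of_real r * cis \<theta>) *s b"] r
        by (simp add: p_def norm_smult_complex norm_mult)
      ultimately show ?thesis
        by (simp add: \<rho>_def)
    qed
    have meas: "(\<lambda>\<theta>. e2ennreal (Vs (p y \<theta>))) \<in> borel_measurable borel" if "y \<in> ?X" for y
      using usc_measurable[OF usc_on_circle[OF Vs_usc that b, of r]] by (simp add: p_def)
    have "limsup (\<lambda>n. I (x n)) \<le> (\<integral>\<^sup>+\<theta>. limsup (\<lambda>n. e2ennreal (Vs (p (x n) \<theta>)) * indicator {0..2*pi} \<theta>) \<partial>lborel)"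
      unfolding I_def p_def[symmetric]
    proof (rule nn_integral_limsup)
      show "(\<lambda>\<theta>. e2ennreal (Vs (p (x n) \<theta>)) * indicator {0..2*pi} \<theta>) \<in> borel_measurable lborel" for n
        using meas[OF x(1)[of n]] by measurable
      show "(\<lambda>\<theta>. ennreal G * indicator {0..2*pi} \<theta>) \<in> borel_measurable lborel"
        by measurable
      show "AE \<theta> in lborel. e2ennreal (Vs (p (x n) \<theta>)) * indicator {0..2*pi} \<theta> \<le> ennreal G * indicator {0..2*pi} \<theta>" for n
      proof (intro AE_I2 mult_right_mono)
        fix \<theta> :: real
        have "Vs (p (x n) \<theta>) \<le> ereal (g (p (x n) \<theta>))"
          by (intro Vs_le pX x)
        also have "\<dots> \<le> ereal G"
          using G[OF pX[OF x(1)] norm_p] by simp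
        finally show "e2ennreal (Vs (p (x n) \<theta>)) \<le> ennreal G"
          using e2ennreal_mono by fastforce
      qed simp
      show "(\<integral>\<^sup>+\<theta>. ennreal G * indicator {0..2*pi} \<theta> \<partial>lborel) < \<infinity>"
        by (simp add: nn_integral_cmult_indicator ennreal_mult_less_top)
    qed
    also have "\<dots> \<le> I a"
      unfolding I_def p_def[symmetric]
    proof (rule nn_integral_mono)
      fix \<theta> :: real
      have "limsup (\<lambda>n. e2ennreal (Vs (p (x n) \<theta>))) \<le> e2ennreal (Vs (p a \<theta>))"
        unfolding Limsup_le_iff
      proof (intro allI impI)
        fix y assume "e2ennreal (Vs (p a \<theta>)) < y"
        then have lt: "Vs (p a \<theta>) < enn2ereal y"
          using Vs0[OF pX[OF a]] by (simp add: less_ennreal.rep_eq enn2ereal_e2ennreal)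
        obtain W where W: "open W" "p a \<theta> \<in> W" "\<forall>z\<in>W \<inter> ?X. Vs z < enn2ereal y"
          using usc_onD[OF Vs_usc pX[OF a] lt] by auto
        have "eventually (\<lambda>n. p (x n) \<theta> \<in> W) sequentially"
          using topological_tendstoD[OF pc W(1,2)] .
        then show "eventually (\<lambda>n. e2ennreal (Vs (p (x n) \<theta>)) < y) sequentially"
        proof eventually_elim
          case (elim n)
          then have "Vs (p (x n) \<theta>) < enn2ereal y"
            using W(3) pX[OF x(1)[of n]] by auto
          then show ?case
            using Vs0[OF pX[OF x(1)]] by (simp add: less_ennreal.rep_eq enn2ereal_e2ennreal)
        qed
      qed
      then show "limsup (\<lambda>n. e2ennreal (Vs (p (x n) \<theta>)) * indicator {0..2*pi} \<theta>) \<le> e2ennreal (Vs (p a \<theta>)) * indicator {0..2*pi} \<theta>"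
        by (cases "\<theta> \<in> {0..2*pi}") (auto simp: Limsup_const)
    qed
    finally have lim: "limsup (\<lambda>n. I (x n)) \<le> I a" .
    have "ereal v \<le> ereal (1 / (2 * pi)) * enn2ereal (I a)"
    proof (cases "I a = top")
      case True
      then show ?thesis
        by (simp add: top_ennreal.rep_eq top_ereal_def)
    next
      case False
      then obtain i where i: "0 \<le> i" "I a = ennreal i"
        by (cases "I a") auto
      have "v \<le> i / (2 * pi) + e" if e: "0 < e" for e
      proof -
        have "I a < ennreal (i + pi * e)"
          unfolding i using i(1) e by (simp add: ennreal_less_iff)
        then have "eventually (\<lambda>n. I (x n) < ennreal (i + pi * e)) sequentially"
          using lim by (intro Limsup_lessD) (rule le_less_trans)
        moreover have "eventually (\<lambda>n. inverse (real (Suc n)) < e / 2) sequentially"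
          using e by (intro order_tendstoD(2)[OF LIMSEQ_inverse_real_of_nat]) auto
        ultimately have "eventually (\<lambda>n. I (x n) < ennreal (i + pi * e) \<and> inverse (real (Suc n)) < e / 2) sequentially"
          by (rule eventually_conj)
        then obtain n where n: "I (x n) < ennreal (i + pi * e)" "inverse (real (Suc n)) < e / 2"
          using eventually_happens' sequentially_bot by blast
        obtain j where j: "0 \<le> j" "I (x n) = ennreal j"
          using n(1) by (cases "I (x n)") auto
        have "j < i + pi * e"
          using n(1) j by (simp only: ennreal_less_iff)
        have "V (x n) \<le> ereal (1 / (2 * pi)) * enn2ereal (I (x n))"
          using V_mean[OF x(1) b r] mean_eq[OF x(1)] by (simp only:)
        also have "\<dots> = ereal (j / (2 * pi))"
          using j by (simp add: enn2ereal_ennreal)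
        finally have "ereal (v - inverse (real (Suc n))) < ereal (j / (2 * pi))"
          using x(3)[of n] by (rule order.strict_trans2[rotated])
        then have "v < j / (2 * pi) + e / 2"
          using n(2) by simp
        also have "j / (2 * pi) \<le> (i + pi * e) / (2 * pi)"
          using \<open>j < i + pi * e\<close> by (intro divide_right_mono) auto
        finally show ?thesis
          by (simp add: field_simps)
      qed
      then have "v \<le> i / (2 * pi)"
        by (rule field_le_epsilon)
      then show ?thesis
        using i by (simp add: enn2ereal_ennreal)
    qed
    then show "Vs a \<le> arc_mean (\<lambda>\<theta>. Vs (a + (of_real r * cis \<theta>) *s b))"
      using v mean_eq[OF a] by simp
  next
    fix z assume "z \<in> ?X"
    then show "Vs z < \<infinity>"
      using Vs_le[of z] by auto
  qed (simp_all add: Vs_usc)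
qed

section \<open>A logarithmic plurisubharmonic function\<close>

text \<open>
  On a circle, \<open>1 + \<bar>p + c h\<bar>\<^sup>2\<close> with \<open>\<bar>h\<bar> = 1\<close> is a trigonometric polynomial of degree one, positive
  everywhere, hence of the form \<open>x \<bar>1 + w h\<bar>\<^sup>2\<close> with \<open>\<bar>w\<bar> < 1\<close>. Here \<open>x\<close> is the larger root of
  \<open>x\<^sup>2 - (1 + \<bar>p\<bar>\<^sup>2 + \<bar>c\<bar>\<^sup>2) x + \<bar>c p\<bar>\<^sup>2\<close>, which is at least \<open>1 + \<bar>p\<bar>\<^sup>2\<close>, and \<open>ln x\<close> is the mean of the logarithm.
\<close>

lemma one_plus_square_on_circle:
  fixes p c :: complex
  obtains x w where "1 + (cmod p)\<^sup>2 \<le> x" "cmod w < 1"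
    "\<And>\<theta>. 1 + (cmod (p + c * cis \<theta>))\<^sup>2 = x * (cmod (1 + w * cis \<theta>))\<^sup>2"
proof -
  define P where "P = cmod p"
  define \<rho> where "\<rho> = cmod c"
  define s where "s = 1 + P\<^sup>2 + \<rho>\<^sup>2"
  have P: "0 \<le> P" "0 \<le> \<rho>"
    by (simp_all add: P_def \<rho>_def)
  have s: "2 * (\<rho> * P) < s"
    using zero_le_power2[of "P - \<rho>"] by (simp add: s_def power2_diff algebra_simps)
  define d where "d = sqrt (s\<^sup>2 - 4 * (\<rho> * P)\<^sup>2)"
  have "(2 * (\<rho> * P))\<^sup>2 \<le> s\<^sup>2"
    using s P by (intro power_mono) auto
  then have d2: "d\<^sup>2 = s\<^sup>2 - 4 * (\<rho> * P)\<^sup>2"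
    by (simp add: d_def power_mult_distrib)
  have d0: "0 \<le> d"
    using \<open>(2 * (\<rho> * P))\<^sup>2 \<le> s\<^sup>2\<close> by (simp add: d_def power_mult_distrib)
  define x where "x = (s + d) / 2"
  have root: "x * x + (\<rho> * P)\<^sup>2 = s * x"
    using d2 by (simp add: x_def power2_eq_square field_simps)
  have "(1 + P\<^sup>2 - \<rho>\<^sup>2)\<^sup>2 + 4 * \<rho>\<^sup>2 = d\<^sup>2"
    unfolding d2 s_def by (simp add: power2_eq_square algebra_simps)
  then have "(1 + P\<^sup>2 - \<rho>\<^sup>2)\<^sup>2 \<le> d\<^sup>2"
    using zero_le_power2[of \<rho>] by linarith
  then have "1 + P\<^sup>2 - \<rho>\<^sup>2 \<le> d"
    using d0 by (rule power2_le_imp_le)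
  then have x1: "1 + P\<^sup>2 \<le> x"
    by (simp add: x_def s_def field_simps)
  then have x0: "0 < x"
    using zero_le_power2[of P] by linarith
  have xP: "\<rho> * P < x"
    using s d0 by (simp add: x_def)
  define w where "w = cnj p * c / of_real x"
  have cw: "cmod w = \<rho> * P / x"
    using x0 by (simp add: w_def norm_divide norm_mult P_def \<rho>_def mult.commute)
  have "1 + (cmod (p + c * cis \<theta>))\<^sup>2 = x * (cmod (1 + w * cis \<theta>))\<^sup>2" for \<theta>
  proof -
    have sum: "(cmod (y + v))\<^sup>2 = (cmod y)\<^sup>2 + (cmod v)\<^sup>2 + 2 * Re (cnj y * v)" for y v
      unfolding cmod_power2 by (simp add: power2_eq_square algebra_simps)
    have "x * (cmod (1 + w * cis \<theta>))\<^sup>2 = x + x * (cmod w)\<^sup>2 + 2 * (x * Re (w * cis \<theta>))"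
      by (simp add: sum norm_mult algebra_simps)
    also have "x * Re (w * cis \<theta>) = Re (of_real x * (w * cis \<theta>))"
      by simp
    also have "of_real x * (w * cis \<theta>) = cnj p * (c * cis \<theta>)"
      using x0 by (simp add: w_def)
    also have "x + x * (cmod w)\<^sup>2 = s"
      using root x0 by (simp add: cw power2_eq_square field_simps)
    finally show ?thesis
      by (simp add: sum norm_mult s_def P_def \<rho>_def)
  qed
  moreover have "cmod w < 1"
    using xP x0 by (simp add: cw)
  ultimately show ?thesis
    using that x1 by (auto simp: P_def)
qed

lemma psh_half_ln:
  fixes A :: "'n::finite set"
  assumes "0 \<le> a"
  shows "psh_on A (coord_space A) (\<lambda>z. ereal (a * ln (1 + (cmod (z $ i))\<^sup>2) + c))"
  unfolding psh_on_iff
proof (intro conjI ballI allI impI)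
  have nz: "1 + (cmod y)\<^sup>2 \<noteq> 0" for y
    using zero_le_power2[of "cmod y"] by linarith
  have "continuous_on (coord_space A :: (complex ^ 'n) set) (\<lambda>z. a * ln (1 + (cmod (z $ i))\<^sup>2) + c)"
    using nz by (intro continuous_intros) auto
  then show "usc_on (coord_space A) (\<lambda>z :: complex ^ 'n. ereal (a * ln (1 + (cmod (z $ i))\<^sup>2) + c))"
    by (rule usc_on_continuous)
next
  fix z b :: "complex ^ 'n" and r :: real
  obtain x w where x: "1 + (cmod (z $ i))\<^sup>2 \<le> x" and w: "cmod w < 1"
    and eq: "\<And>\<theta>. 1 + (cmod (z $ i + (of_real r * b $ i) * cis \<theta>))\<^sup>2 = x * (cmod (1 + w * cis \<theta>))\<^sup>2"
    using one_plus_square_on_circle by metis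
  have x0: "0 < x"
    using x zero_le_power2[of "cmod (z $ i)"] by linarith
  define k where "k \<theta> = a * (ln x + 2 * ln (cmod (1 + w * cis \<theta>))) + c" for \<theta>
  have "ln (1 + (cmod ((z + (of_real r * cis \<theta>) *s b) $ i))\<^sup>2) = ln x + 2 * ln (cmod (1 + w * cis \<theta>))" for \<theta>
  proof -
    have "(z + (of_real r * cis \<theta>) *s b) $ i = z $ i + (of_real r * b $ i) * cis \<theta>"
      by simp
    then have "ln (1 + (cmod ((z + (of_real r * cis \<theta>) *s b) $ i))\<^sup>2) = ln (x * (cmod (1 + w * cis \<theta>))\<^sup>2)"
      by (simp only: eq)
    also have "\<dots> = ln x + ln ((cmod (1 + w * cis \<theta>))\<^sup>2)"
      using x0 cmod_one_plus_cis_pos[OF w, of \<theta>] by (intro ln_mult_pos) auto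
    also have "ln ((cmod (1 + w * cis \<theta>))\<^sup>2) = 2 * ln (cmod (1 + w * cis \<theta>))"
      using cmod_one_plus_cis_pos[OF w, of \<theta>] by (subst ln_realpow) auto
    finally show ?thesis .
  qed
  then have k: "a * ln (1 + (cmod ((z + (of_real r * cis \<theta>) *s b) $ i))\<^sup>2) + c = k \<theta>" for \<theta>
    by (simp only: k_def)
  have "arc_mean (\<lambda>\<theta>. ereal (k \<theta>)) = ereal (a * ln x + c)"
  proof (rule arc_mean_continuous)
    show "continuous_on {0..2*pi} k"
      unfolding k_def by (intro continuous_intros continuous_on_ln_cmod[OF w])
    have "(k has_integral a * (2 * pi * ln x + 2 * 0) + 2 * pi * c) {0..2*pi}"
      unfolding k_def
      by (intro has_integral_add has_integral_mult_right has_integral_ln_cmod[OF w] has_integral_const_circle)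
    then show "(k has_integral 2 * pi * (a * ln x + c)) {0..2*pi}"
      by (simp add: algebra_simps)
  qed
  moreover have "ln (1 + (cmod (z $ i))\<^sup>2) \<le> ln x"
    using x x0 zero_le_power2[of "cmod (z $ i)"] by (intro ln_mono) linarith+
  then have "a * ln (1 + (cmod (z $ i))\<^sup>2) \<le> a * ln x"
    using assms by (rule mult_left_mono)
  ultimately show "ereal (a * ln (1 + (cmod (z $ i))\<^sup>2) + c)
      \<le> arc_mean (\<lambda>\<theta>. ereal (a * ln (1 + (cmod ((z + (of_real r * cis \<theta>) *s b) $ i))\<^sup>2) + c))"
    unfolding k by simp
qed auto

section \<open>Extremal functions of regular sets\<close>

context growth_body
begin

lemma lelong_torus:
  assumes "u \<in> lelong_class A S"
  obtains c where "\<And>w. w \<in> torus A \<Longrightarrow> u w \<le> ereal (\<phi> (logabs w) + c)"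
proof -
  obtain c where c: "\<And>z. z \<in> coord_space A \<Longrightarrow> u z \<le> log_support_fun A S z + ereal c"
    using assms by (auto simp: lelong_class_def)
  have "u w \<le> ereal (\<phi> (logabs w) + c)" if "w \<in> torus A" for w
    using c[of w] that log_support_torus[OF that] by (simp add: torus_def)
  then show ?thesis
    by (rule that)
qed

lemma lelongI:
  assumes "psh_on A (coord_space A) u" "\<And>w. w \<in> torus A \<Longrightarrow> u w \<le> ereal (\<phi> (logabs w) + c)"
  shows "u \<in> lelong_class A S"
  using assms psh_le_log_support[OF assms] by (auto simp: lelong_class_def)

lemma lelong_psh: "u \<in> lelong_class A S \<Longrightarrow> psh_on A (coord_space A) u"
  by (simp add: lelong_class_def)

lemma lelong_truncate:
  assumes "u \<in> lelong_class A S"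
  shows "(\<lambda>z. max (u z) (ereal m) + ereal c) \<in> lelong_class A S"
proof -
  obtain d where d: "\<And>w. w \<in> torus A \<Longrightarrow> u w \<le> ereal (\<phi> (logabs w) + d)"
    using lelong_torus[OF assms] by blast
  show ?thesis
  proof (rule lelongI)
    show "psh_on A (coord_space A) (\<lambda>z. max (u z) (ereal m) + ereal c)"
      by (intro psh_shift[of _ _ _ m] psh_max_const lelong_psh assms) simp
    fix w assume "w \<in> torus A"
    then have "max (u w) (ereal m) \<le> ereal (\<phi> (logabs w) + (\<bar>d\<bar> + \<bar>m\<bar>))"
      using d[of w] phi_nonneg[of "logabs w"] order_trans[of "u w" "ereal (\<phi> (logabs w) + d)"] by auto
    then show "max (u w) (ereal m) + ereal c \<le> ereal (\<phi> (logabs w) + (\<bar>d\<bar> + \<bar>m\<bar> + c))"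
      by (cases "max (u w) (ereal m)") (auto simp: algebra_simps)
  qed
qed

lemma lelong_dilate:
  assumes "u \<in> lelong_class A S"
  shows "(\<lambda>z. u (of_real (exp s) *s z)) \<in> lelong_class A S"
proof -
  obtain d where d: "\<And>w. w \<in> torus A \<Longrightarrow> u w \<le> ereal (\<phi> (logabs w) + d)"
    using lelong_torus[OF assms] by blast
  show ?thesis
  proof (rule lelongI)
    show "psh_on A (coord_space A) (\<lambda>z. u (of_real (exp s) *s z))"
      by (intro psh_dilate lelong_psh assms)
    fix w :: "complex ^ 'n" assume w: "w \<in> torus A"
    let ?w = "of_real (exp s) *s w :: complex ^ 'n"
    have "?w \<in> torus A"
      using w by (auto simp: torus_def coord_space_def)
    then have "u ?w \<le> ereal (\<phi> (logabs ?w) + d)"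
      by (rule d)
    moreover have "\<phi> (logabs ?w) \<le> \<phi> (logabs w) + C * CARD('n) * \<bar>s\<bar>"
    proof (rule phi_near)
      fix i assume "i \<in> A"
      then have "ln (cmod (?w $ i)) = ln (exp s) + ln (cmod (w $ i))"
        using w by (simp only: vector_smult_component norm_mult) (simp add: ln_mult_pos torus_def)
      then show "\<bar>logabs ?w $ i - logabs w $ i\<bar> \<le> \<bar>s\<bar>"
        by simp
    qed simp
    ultimately show "u ?w \<le> ereal (\<phi> (logabs w) + (C * CARD('n) * \<bar>s\<bar> + d))"
      using order_trans by fastforce
  qed
qed

end

text \<open>One of the factors: a regular compact set in the coordinate subspace of \<open>A\<close>, with its extremal function.\<close>

locale regular_set = growth_body A S C for A :: "'n::finite set" and S C +
  fixes K :: "(complex ^ 'n) set"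
  assumes A_nonempty: "A \<noteq> {}"
    and K_subset: "K \<subseteq> coord_space A" and K_compact: "compact K" and K_nonempty: "K \<noteq> {}"
    and simplex: "\<exists>a>0. (\<lambda>x. a *\<^sub>R x) ` std_simplex A \<subseteq> S"
    and regular: "z \<in> K \<Longrightarrow> usc_reg (coord_space A) (extremal A S K) z = 0"
begin

abbreviation "X \<equiv> (coord_space A :: (complex ^ 'n) set)"
abbreviation "V \<equiv> extremal A S K"
abbreviation "\<F> \<equiv> {u \<in> lelong_class A S. \<forall>w\<in>K. u w \<le> 0}"

lemma V_eq: "V z = (SUP u\<in>\<F>. u z)"
  by (simp add: weighted_extremal_def)

lemma le_V: "u \<in> \<F> \<Longrightarrow> u z \<le> V z"
  unfolding V_eq by (rule SUP_upper)

lemma V_nonneg: "0 \<le> V z"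
proof -
  have "(\<lambda>_. ereal 0) \<in> lelong_class A S"
    by (rule lelongI[of _ 0]) (auto intro: psh_const simp: phi_nonneg)
  then show ?thesis
    using le_V[of "\<lambda>_. ereal 0" z] by (simp add: zero_ereal_def)
qed

lemma V_small_near_K:
  assumes "0 < e"
  obtains \<delta> where "0 < \<delta>" "\<And>p z. p \<in> K \<Longrightarrow> z \<in> X \<Longrightarrow> dist p z < \<delta> \<Longrightarrow> V z < ereal e"
proof -
  have "\<exists>W. open W \<and> p \<in> W \<and> (\<forall>z\<in>W \<inter> X. V z < ereal e)" if "p \<in> K" for p
  proof -
    have "usc_reg X V p < ereal e"
      using regular[OF that] assms by simp
    then have "eventually (\<lambda>z. V z < ereal e) (inf (nhds p) (principal X))"
      unfolding usc_reg_def by (rule Limsup_lessD)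
    then show ?thesis
      unfolding eventually_usc_reg_filter .
  qed
  then obtain W where W: "\<And>p. p \<in> K \<Longrightarrow> open (W p)" "\<And>p. p \<in> K \<Longrightarrow> p \<in> W p"
      "\<And>p z. p \<in> K \<Longrightarrow> z \<in> W p \<Longrightarrow> z \<in> X \<Longrightarrow> V z < ereal e"
    by (metis IntI)
  have "open (\<Union>p\<in>K. W p)" "K \<subseteq> (\<Union>p\<in>K. W p)"
    using W(1,2) by auto
  then obtain \<delta> where \<delta>: "0 < \<delta>" "(\<Union>p\<in>K. ball p \<delta>) \<subseteq> (\<Union>p\<in>K. W p)"
    using compact_subset_open_imp_ball_epsilon_subset[OF K_compact] by metis
  have "V z < ereal e" if "p \<in> K" "z \<in> X" "dist p z < \<delta>" for p z
  proof -
    have "z \<in> (\<Union>p\<in>K. ball p \<delta>)"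
      using that by auto
    then have "z \<in> (\<Union>p\<in>K. W p)"
      using \<delta>(2) by (rule rev_subsetD)
    then show ?thesis
      using W(3) that(2) by auto
  qed
  with \<delta>(1) show ?thesis
    by (rule that)
qed

text \<open>
  The regularity of \<open>K\<close> bounds all competitors by \<open>1\<close> on a ball about a point of \<open>K\<close>, and the
  Bernstein--Walsh estimate spreads this to bounded sets with a constant common to all of them.
\<close>

lemma competitors_bounded_on_bounded:
  obtains M where "\<And>u z. u \<in> \<F> \<Longrightarrow> z \<in> X \<Longrightarrow> norm z \<le> \<rho> \<Longrightarrow> u z \<le> ereal M"
proof -
  obtain p where p: "p \<in> K"
    using K_nonempty by auto
  have pX: "p \<in> X"
    using p K_subset by auto
  obtain r where r: "0 < r" "\<And>p z. p \<in> K \<Longrightarrow> z \<in> X \<Longrightarrow> dist p z < r \<Longrightarrow> V z < ereal 1"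
    using V_small_near_K[of 1] by (metis zero_less_one)
  define D where "D = C * CARD('n) + 1"
  have D: "0 \<le> D"
    using C_nonneg by (simp add: D_def)
  define M where "M = 1 + D * \<bar>ln (2 * (norm p + \<rho>) / r)\<bar>"
  have "u z \<le> ereal M" if u: "u \<in> \<F>" and z: "z \<in> X" "norm z \<le> \<rho>" for u z
  proof -
    have le1: "u y \<le> 1" if "y \<in> X" "dist p y < r" for y
      using le_V[OF u, of y] r(2)[OF p that] by (auto simp: one_ereal_def)
    show ?thesis
    proof (cases "r / 2 \<le> dist p z")
      case True
      obtain c where c: "\<And>z. z \<in> X \<Longrightarrow> u z \<le> log_support_fun A S z + ereal c"
        using u by (auto simp: lelong_class_def)
      have growth: "u y \<le> ereal (C * CARD('n) * ln (1 + norm y) + c)" if "y \<in> X" for y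
      proof -
        have "u y \<le> log_support_fun A S y + ereal c"
          by (rule c[OF that])
        also have "\<dots> \<le> ereal (C * CARD('n) * ln (1 + norm y)) + ereal c"
          by (intro add_right_mono log_support_le)
        finally show ?thesis by simp
      qed
      have "u z \<le> ereal (1 + (C * CARD('n) + 1) * ln (2 * dist p z / r))"
        using C_nonneg u by (intro bernstein_walsh[OF _ pX le1 r(1) growth _ z(1) True] lelong_psh) auto
      also have "\<dots> \<le> ereal M"
      proof -
        have "dist p z \<le> norm p + \<rho>"
          using norm_triangle_ineq4[of p z] z(2) by (simp add: dist_norm)
        then have "2 * dist p z / r \<le> 2 * (norm p + \<rho>) / r"
          using r(1) by (simp add: divide_right_mono)
        moreover have "0 < 2 * dist p z / r"
          using True r(1) by (intro divide_pos_pos) linarith+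
        ultimately have "ln (2 * dist p z / r) \<le> ln (2 * (norm p + \<rho>) / r)"
          by (intro ln_mono) linarith+
        also have "\<dots> \<le> \<bar>ln (2 * (norm p + \<rho>) / r)\<bar>"
          by simp
        finally have "D * ln (2 * dist p z / r) \<le> D * \<bar>ln (2 * (norm p + \<rho>) / r)\<bar>"
          using D by (rule mult_left_mono)
        then show ?thesis
          by (simp add: M_def D_def)
      qed
      finally show ?thesis .
    next
      case False
      then have "u z \<le> 1"
        using r(1) by (intro le1 z(1)) simp
      also have "1 \<le> ereal M"
        using D by (simp add: M_def one_ereal_def)
      finally show ?thesis .
    qed
  qed
  then show ?thesis
    by (rule that)
qed

text \<open>
  The competitors are bounded near the unit torus by a common constant, hence by \<open>torus_growth\<close> on the
  whole torus with the same constant, and by \<open>psh_le_log_support\<close> everywhere.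
\<close>

lemma V_growth:
  obtains M where "\<And>z. z \<in> torus A \<Longrightarrow> V z \<le> ereal (\<phi> (logabs z) + M)"
    and "\<And>z. z \<in> X \<Longrightarrow> V z \<le> ereal (C * CARD('n) * ln (1 + norm z) + M)"
proof -
  obtain M where M: "\<And>u z. u \<in> \<F> \<Longrightarrow> z \<in> X \<Longrightarrow> norm z \<le> CARD('n) * exp 1 \<Longrightarrow> u z \<le> ereal M"
    using competitors_bounded_on_bounded[of "CARD('n) * exp 1"] by blast
  have torus: "u z \<le> ereal (\<phi> (logabs z) + M)" if u: "u \<in> \<F>" and z: "z \<in> torus A" for u z
  proof -
    obtain c where c: "\<And>w. w \<in> torus A \<Longrightarrow> u w \<le> ereal (\<phi> (logabs w) + c)"
      using lelong_torus u by blast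
    show ?thesis
    proof (rule torus_growth[OF _ c _ z])
      show "psh_on A X u"
        using u by (auto intro: lelong_psh)
      fix w assume w: "w \<in> torus A" "\<And>i. i \<in> A \<Longrightarrow> \<bar>ln (cmod (w $ i))\<bar> \<le> 1"
      have "cmod (w $ i) \<le> exp 1" for i
      proof (cases "i \<in> A")
        case True
        then have "0 < cmod (w $ i)" "ln (cmod (w $ i)) \<le> 1"
          using w by (auto simp: torus_def abs_le_iff)
        then show ?thesis
          using exp_le_cancel_iff[of "ln (cmod (w $ i))" 1] by simp
      next
        case False
        then show ?thesis
          using w(1) by (simp add: torus_def coord_space_def)
      qed
      then have "(\<Sum>i\<in>UNIV. cmod (w $ i)) \<le> CARD('n) * exp 1"
        by (intro sum_bounded_above)
      moreover have "norm w \<le> (\<Sum>i\<in>UNIV. cmod (w $ i))"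
        unfolding norm_vec_def by (intro L2_set_le_sum) simp
      ultimately show "u w \<le> ereal M"
        using w(1) by (intro M[OF u]) (auto simp: torus_def)
    qed
  qed
  have "u z \<le> ereal (C * CARD('n) * ln (1 + norm z) + M)" if u: "u \<in> \<F>" and z: "z \<in> X" for u z
  proof -
    have "u z \<le> log_support_fun A S z + ereal M"
      using u torus[OF u] z by (intro psh_le_log_support lelong_psh) auto
    also have "\<dots> \<le> ereal (C * CARD('n) * ln (1 + norm z)) + ereal M"
      by (intro add_right_mono log_support_le)
    finally show ?thesis by simp
  qed
  with torus show ?thesis
    by (intro that[of M]) (auto simp only: V_eq intro!: SUP_least)
qed

text \<open>
  The regularization of \<open>V\<close> is itself a competitor: it is plurisubharmonic, inherits the growth of
  \<open>V\<close>, and vanishes on \<open>K\<close> by regularity. Hence it does not exceed \<open>V\<close>.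
\<close>

lemma psh_V: "psh_on A X V"
proof -
  obtain M where M: "\<And>z. z \<in> torus A \<Longrightarrow> V z \<le> ereal (\<phi> (logabs z) + M)"
    "\<And>z. z \<in> X \<Longrightarrow> V z \<le> ereal (C * CARD('n) * ln (1 + norm z) + M)"
    using V_growth by blast
  have nz: "1 + norm z \<noteq> 0" for z :: "complex ^ 'n"
    using norm_ge_zero[of z] by linarith
  have psh: "psh_on A X (usc_reg X V)"
  proof (rule psh_usc_reg_SUP[OF _ V_eq V_nonneg M(2)])
    show "continuous_on X (\<lambda>z. C * CARD('n) * ln (1 + norm z) + M)"
      using nz by (intro continuous_intros) auto
  qed (auto intro: lelong_psh)
  have "usc_reg X V \<in> lelong_class A S"
  proof (rule lelongI[OF psh])
    fix z assume z: "z \<in> torus A"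
    define W where "W = (\<Inter>i\<in>A. {w :: complex ^ 'n. w $ i \<noteq> 0})"
    have W: "open W"
      unfolding W_def by (intro open_INT finite ballI open_Collect_neq continuous_intros)
    have WX: "W \<inter> X = torus A"
      by (auto simp: W_def torus_def)
    have phi_cont: "continuous_on UNIV \<phi>"
      unfolding continuous_on_iff
    proof (intro ballI allI impI)
      fix \<xi> :: "real ^ 'n" and e :: real assume e: "0 < e"
      define d where "d = e / (C * CARD('n) + 1)"
      have Cn: "0 \<le> C * CARD('n)"
        using C_nonneg by simp
      then have d: "0 < d" "C * CARD('n) * d < e"
        using e by (auto simp: d_def field_simps)
      have "dist (\<phi> \<xi>') (\<phi> \<xi>) < e" if "dist \<xi>' \<xi> < d" for \<xi>'
      proof -
        have "\<bar>\<xi>' $ i - \<xi> $ i\<bar> \<le> d" for i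
          using component_le_norm_cart[of "\<xi>' - \<xi>" i] that by (simp add: dist_norm)
        then have "\<phi> \<xi>' \<le> \<phi> \<xi> + C * CARD('n) * d" "\<phi> \<xi> \<le> \<phi> \<xi>' + C * CARD('n) * d"
          using d(1) by (auto intro!: phi_near simp: abs_minus_commute)
        then show ?thesis
          using d(2) by (simp add: dist_real_def abs_less_iff)
      qed
      then show "\<exists>d>0. \<forall>\<xi>'\<in>UNIV. dist \<xi>' \<xi> < d \<longrightarrow> dist (\<phi> \<xi>') (\<phi> \<xi>) < e"
        using d(1) by blast
    qed
    \<comment> \<open>Coordinates outside \<open>A\<close>, where the logarithm is discontinuous at \<open>0\<close>, do not influence \<open>\<phi>\<close>.\<close>
    define y :: "complex ^ 'n \<Rightarrow> complex ^ 'n" where "y w = (\<chi> i. if i \<in> A then w $ i else 1)" for w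
    have phi_y: "\<phi> (logabs w) = \<phi> (logabs (y w))" for w
      using phi_near[of "logabs w" "logabs (y w)" 0] phi_near[of "logabs (y w)" "logabs w" 0]
      by (simp add: y_def)
    have "continuous_on (torus A) (\<lambda>w. logabs (y w))"
    proof (intro continuous_on_vec_lambda continuous_on_ln continuous_on_norm ballI)
      show "continuous_on (torus A) (\<lambda>w. y w $ i)" for i
        by (cases "i \<in> A") (auto simp: y_def intro!: continuous_intros)
      show "cmod (y w $ i) \<noteq> 0" if "w \<in> torus A" for w i
        using that by (auto simp: y_def torus_def)
    qed
    then have "continuous_on (torus A) (\<lambda>w. \<phi> (logabs (y w)))"
      by (rule continuous_on_compose2[OF phi_cont]) auto
    then have "continuous_on (torus A) (\<lambda>w. \<phi> (logabs (y w)) + M)"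
      by (intro continuous_on_add continuous_on_const)
    moreover have "(\<lambda>w. \<phi> (logabs (y w)) + M) = (\<lambda>w. \<phi> (logabs w) + M)"
      by (intro ext arg_cong2[where f = "(+)"] phi_y[symmetric] refl)
    ultimately have cont: "continuous_on (W \<inter> X) (\<lambda>w. \<phi> (logabs w) + M)"
      unfolding WX by (simp only:)
    have "z \<in> W" "z \<in> X"
      using z WX by auto
    then show "usc_reg X V z \<le> ereal (\<phi> (logabs z) + M)"
      using M(1) WX by (intro usc_reg_le[OF _ W _ _ cont]) auto
  qed
  then have "usc_reg X V \<in> \<F>"
    using regular by auto
  then have "usc_reg X V z = V z" if "z \<in> X" for z
    using le_V[of "usc_reg X V" z] usc_reg_ge[OF that, of V] by (intro antisym)
  with psh show ?thesis
    by (rule psh_on_cong)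
qed

lemma V_finite: "z \<in> X \<Longrightarrow> V z = ereal (real_of_ereal (V z))"
  using psh_onD(3)[OF psh_V, of z] V_nonneg[of z] by (cases "V z") auto

text \<open>Truncation from below makes all competitors finite, so that constants can be added freely.\<close>

lemma weighted_extremal_const: "weighted_extremal A S K (\<lambda>_. ereal c) z = V z + ereal c"
proof (rule antisym)
  show "weighted_extremal A S K (\<lambda>_. ereal c) z \<le> V z + ereal c"
    unfolding weighted_extremal_def[of A S K "\<lambda>_. ereal c"]
  proof (rule SUP_least)
    fix u assume u: "u \<in> {u \<in> lelong_class A S. \<forall>w\<in>K. u w \<le> ereal c}"
    have "(\<lambda>z. max (u z) (ereal c) + ereal (- c)) \<in> \<F>"
      using u lelong_truncate[of u c "- c"] by (auto simp: max_absorb2 zero_ereal_def)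
    then have "max (u z) (ereal c) + ereal (- c) \<le> V z"
      by (rule le_V)
    then show "u z \<le> V z + ereal c"
      by (cases "u z"; cases "V z") (auto simp: max_def split: if_splits)
  qed
  have "V z \<le> weighted_extremal A S K (\<lambda>_. ereal c) z + ereal (- c)"
    unfolding V_eq
  proof (rule SUP_least)
    fix u assume u: "u \<in> \<F>"
    have "(\<lambda>z. max (u z) (ereal 0) + ereal c) \<in> {u \<in> lelong_class A S. \<forall>w\<in>K. u w \<le> ereal c}"
      using u lelong_truncate[of u 0 c] by (auto simp: max_absorb2 zero_ereal_def)
    then have "max (u z) (ereal 0) + ereal c \<le> weighted_extremal A S K (\<lambda>_. ereal c) z"
      unfolding weighted_extremal_def[of A S K "\<lambda>_. ereal c"] by (rule SUP_upper)
    then show "u z \<le> weighted_extremal A S K (\<lambda>_. ereal c) z + ereal (- c)"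
      by (cases "u z"; cases "weighted_extremal A S K (\<lambda>_. ereal c) z") (auto simp: max_def split: if_splits)
  qed
  then show "V z + ereal c \<le> weighted_extremal A S K (\<lambda>_. ereal c) z"
    by (cases "V z"; cases "weighted_extremal A S K (\<lambda>_. ereal c) z") auto
qed

text \<open>
  The simplex inside \<open>S\<close> makes multiples of \<open>ln (1 + \<bar>z\<^sub>i\<bar>\<^sup>2)\<close>, lowered to be nonpositive on \<open>K\<close>, competitors.
\<close>

lemma V_lower_growth:
  obtains a c where "0 < a" "\<And>z i. z \<in> X \<Longrightarrow> i \<in> A \<Longrightarrow> ereal (a * ln (1 + (cmod (z $ i))\<^sup>2) - c) \<le> V z"
proof -
  obtain a where a: "0 < a" "(\<lambda>x. a *\<^sub>R x) ` std_simplex A \<subseteq> S"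
    using simplex by blast
  obtain k where k: "\<And>z. z \<in> K \<Longrightarrow> norm z \<le> k"
    using compact_imp_bounded[OF K_compact] by (auto simp: bounded_iff)
  define c where "c = a / 2 * ln (1 + k\<^sup>2)"
  have "ereal (a / 2 * ln (1 + (cmod (z $ i))\<^sup>2) + - c) \<le> V z" if i: "i \<in> A" for z i
  proof (rule le_V[of "\<lambda>z. ereal (a / 2 * ln (1 + (cmod (z $ i))\<^sup>2) + - c)"], intro CollectI conjI ballI)
    show "(\<lambda>z. ereal (a / 2 * ln (1 + (cmod (z $ i))\<^sup>2) + - c)) \<in> lelong_class A S"
    proof (rule lelongI)
      show "psh_on A X (\<lambda>z. ereal (a / 2 * ln (1 + (cmod (z $ i))\<^sup>2) + - c))"
        using a(1) by (intro psh_half_ln) simp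
      fix w assume w: "w \<in> torus A"
      define m where "m = cmod (w $ i)"
      have m: "0 < m"
        using w i by (simp add: m_def torus_def)
      have "axis i 1 \<in> std_simplex A"
        using i by (auto simp: std_simplex_def coord_space_def nonneg_orthant_def axis_def)
      then have "a *\<^sub>R axis i 1 \<in> S"
        using a(2) by auto
      from support_fun_upper[OF body_compact this, of "logabs w"]
      have am: "a * ln m \<le> \<phi> (logabs w)"
        by (simp add: inner_axis' m_def)
      have "a / 2 * ln (1 + m\<^sup>2) \<le> a / 2 * ln 2 + \<phi> (logabs w)"
      proof (cases "m \<le> 1")
        case True
        then have "ln (1 + m\<^sup>2) \<le> ln 2"
          using m power_mono[of m 1 2] by (intro ln_mono) (auto intro: add_pos_nonneg)
        then have "a / 2 * ln (1 + m\<^sup>2) \<le> a / 2 * ln 2"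
          using a(1) by (intro mult_left_mono) auto
        then show ?thesis
          using phi_nonneg[of "logabs w"] by linarith
      next
        case False
        then have "1 + m\<^sup>2 \<le> 2 * m\<^sup>2"
          using power_mono[of 1 m 2] by simp
        then have "ln (1 + m\<^sup>2) \<le> ln (2 * m\<^sup>2)"
          using m by (intro ln_mono) (auto intro: add_pos_nonneg)
        also have "\<dots> = ln 2 + 2 * ln m"
          using m by (simp add: ln_mult_pos ln_realpow)
        finally have "a / 2 * ln (1 + m\<^sup>2) \<le> a / 2 * (ln 2 + 2 * ln m)"
          using a(1) by (intro mult_left_mono) auto
        then show ?thesis
          using am by (simp add: algebra_simps)
      qed
      then show "ereal (a / 2 * ln (1 + (cmod (w $ i))\<^sup>2) + - c) \<le> ereal (\<phi> (logabs w) + (a / 2 * ln 2 - c))"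
        by (simp add: m_def)
    qed
    fix w assume "w \<in> K"
    then have "cmod (w $ i) \<le> k"
      using Finite_Cartesian_Product.norm_nth_le[of w i] k[of w] by linarith
    then have "ln (1 + (cmod (w $ i))\<^sup>2) \<le> ln (1 + k\<^sup>2)"
      by (intro ln_mono add_left_mono power_mono) (auto intro: add_pos_nonneg)
    then have "a / 2 * ln (1 + (cmod (w $ i))\<^sup>2) \<le> c"
      unfolding c_def using a(1) by (intro mult_left_mono) auto
    then show "ereal (a / 2 * ln (1 + (cmod (w $ i))\<^sup>2) + - c) \<le> 0"
      by simp
  qed
  then show ?thesis
    using a(1) by (intro that[of "a / 2" c]) auto
qed

lemma V_sublevel_bounded:
  obtains R where "\<And>z. z \<in> X \<Longrightarrow> V z < ereal y \<Longrightarrow> norm z \<le> R"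
proof -
  obtain a c where a: "0 < a" "\<And>z i. z \<in> X \<Longrightarrow> i \<in> A \<Longrightarrow> ereal (a * ln (1 + (cmod (z $ i))\<^sup>2) - c) \<le> V z"
    using V_lower_growth by blast
  define E where "E = 1 + exp ((y + c) / a)"
  have "norm z \<le> CARD('n) * E" if z: "z \<in> X" "V z < ereal y" for z
  proof -
    have "cmod (z $ i) \<le> E" for i
    proof (cases "i \<in> A")
      case True
      have "ereal (a * ln (1 + (cmod (z $ i))\<^sup>2) - c) < ereal y"
        using a(2)[OF z(1) True] z(2) by (rule le_less_trans)
      then have "ln (1 + (cmod (z $ i))\<^sup>2) < (y + c) / a"
        using a(1) by (simp add: field_simps)
      then have "1 + (cmod (z $ i))\<^sup>2 < exp ((y + c) / a)"
        by (metis exp_less_cancel_iff exp_ln add_pos_nonneg zero_less_one zero_le_power2)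
      moreover have "2 * cmod (z $ i) \<le> 1 + (cmod (z $ i))\<^sup>2"
        using zero_le_power2[of "cmod (z $ i) - 1"] by (simp add: power2_diff)
      ultimately show ?thesis
        using exp_gt_zero[of "(y + c) / a"] unfolding E_def by linarith
    next
      case False
      then show ?thesis
        using z(1) by (simp add: E_def coord_space_def add_nonneg_nonneg)
    qed
    then have "(\<Sum>i\<in>UNIV. cmod (z $ i)) \<le> CARD('n) * E"
      by (intro sum_bounded_above)
    moreover have "norm z \<le> (\<Sum>i\<in>UNIV. cmod (z $ i))"
      unfolding norm_vec_def by (intro L2_set_le_sum) simp
    ultimately show ?thesis
      by linarith
  qed
  then show ?thesis
    by (rule that)
qed

text \<open>
  A small dilation keeps \<open>K\<close> inside the region where \<open>V\<close> is small, and the class is invariant under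
  dilations; so a dilated competitor, lowered a little, is again a competitor.
\<close>

lemma V_dilate:
  assumes e: "0 < e"
  obtains \<delta> where "0 < \<delta>"
    "\<And>s z. \<bar>s\<bar> < \<delta> \<Longrightarrow> V (of_real (exp s) *s z) \<le> V z + ereal e"
proof -
  obtain d where d: "0 < d" "\<And>p z. p \<in> K \<Longrightarrow> z \<in> X \<Longrightarrow> dist p z < d \<Longrightarrow> V z < ereal e"
    using V_small_near_K[OF e] by blast
  obtain k where k: "0 < k" "\<And>z. z \<in> K \<Longrightarrow> norm z \<le> k"
    using compact_imp_bounded[OF K_compact] by (auto simp: bounded_pos)
  have "isCont exp (0::real)" "0 < d / k"
    using d(1) k(1) by simp_all
  then have "\<exists>\<delta>>0. \<forall>s :: real. dist s 0 < \<delta> \<longrightarrow> dist (exp s) (exp 0) < d / k"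
    by (intro continuous_at_eps_delta[THEN iffD1, rule_format])
  then obtain \<delta> where \<delta>: "0 < \<delta>" "\<And>s. \<bar>s\<bar> < \<delta> \<Longrightarrow> \<bar>exp s - 1\<bar> < d / k"
    by (auto simp: dist_real_def)
  have "V (of_real (exp s) *s z) \<le> V z + ereal e" if s: "\<bar>s\<bar> < \<delta>" for s z
    unfolding V_eq[of "of_real (exp s) *s z"]
  proof (rule SUP_least)
    fix u assume u: "u \<in> \<F>"
    let ?v = "\<lambda>z. max (u (of_real (exp s) *s z)) (ereal e) + ereal (- e)"
    have "?v w \<le> 0" if w: "w \<in> K" for w
    proof -
      let ?w = "of_real (exp s) *s w :: complex ^ 'n"
      have "w - ?w = of_real (1 - exp s) *s w"
        by (simp add: vec_eq_iff algebra_simps)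
      then have "dist w ?w = \<bar>exp s - 1\<bar> * norm w"
        unfolding dist_norm by (simp only: norm_smult_complex norm_of_real abs_minus_commute)
      also have "\<dots> \<le> \<bar>exp s - 1\<bar> * k"
        using k(2)[OF w] by (intro mult_left_mono) auto
      also have "\<dots> < d"
        using \<delta>(2)[OF s] k(1) by (simp add: field_simps)
      finally have "V ?w < ereal e"
        using w K_subset by (intro d(2)[OF w]) auto
      then have "u ?w \<le> ereal e"
        using le_V[OF u, of ?w] by auto
      then show ?thesis
        by (simp add: max_absorb2)
    qed
    then have "?v \<in> \<F>"
      using u lelong_truncate[OF lelong_dilate[of u s], of e "- e"] by auto
    then have "?v z \<le> V z"
      by (rule le_V)
    then show "u (of_real (exp s) *s z) \<le> V z + ereal e"
      by (cases "u (of_real (exp s) *s z)"; cases "V z") (auto simp: max_def split: if_splits)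
  qed
  with \<delta>(1) show ?thesis
    by (rule that)
qed

text \<open>
  The bound under dilations makes \<open>V\<close> continuous along each ray \<open>exp t p\<close>. On a ray that starts close
  enough to \<open>K\<close>, it therefore takes a given positive value, since sublevel sets are bounded.
\<close>

lemma V_attains:
  assumes y: "0 < y"
  obtains z where "z \<in> X" "V z = ereal y"
proof -
  obtain p0 where p0: "p0 \<in> K"
    using K_nonempty by auto
  obtain d where d: "0 < d" "\<And>p z. p \<in> K \<Longrightarrow> z \<in> X \<Longrightarrow> dist p z < d \<Longrightarrow> V z < ereal y"
    using V_small_near_K[OF y] by blast
  have "p0 \<in> X"
    using p0 K_subset by auto
  then obtain b where b: "b \<in> X" "\<And>t. t \<noteq> 0 \<Longrightarrow> p0 + t *s b \<in> torus A"
    using line_into_torus by metis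
  obtain r where r: "0 < r" "\<And>t. cmod t \<le> r \<Longrightarrow> p0 + t *s b \<in> ball p0 d"
    using line_in_nbhd[of "ball p0 d" p0 b] d(1) by auto
  define p where "p = p0 + of_real r *s b"
  have p: "p \<in> torus A" "dist p0 p < d"
    using b(2)[of "of_real r"] r(2)[of "of_real r"] r(1) by (auto simp: p_def)
  have pX: "of_real t *s p \<in> X" for t
    using p(1) by (auto simp: torus_def)
  define f where "f t = real_of_ereal (V (of_real (exp t) *s p))" for t
  have Vf: "V (of_real (exp t) *s p) = ereal (f t)" for t
    unfolding f_def by (rule V_finite[OF pX])
  have f0: "f 0 < y"
    using d(2)[OF p0 _ p(2)] p(1) Vf[of 0] by (simp add: torus_def)
  have cont: "continuous_on UNIV f"
    unfolding continuous_on_iff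
  proof (intro ballI allI impI)
    fix t e :: real assume e: "0 < e"
    then have "0 < e / 2"
      by simp
    then obtain \<delta> where \<delta>: "0 < \<delta>" "\<And>s z. \<bar>s\<bar> < \<delta> \<Longrightarrow> V (of_real (exp s) *s z) \<le> V z + ereal (e / 2)"
      using V_dilate by blast
    have step: "f x \<le> f x' + e / 2" if "\<bar>x - x'\<bar> < \<delta>" for x x'
    proof -
      have "of_real (exp (x - x')) *s (of_real (exp x') *s p) = of_real (exp x) *s p"
        by (simp add: vec_eq_iff exp_diff)
      then have "V (of_real (exp x) *s p) \<le> V (of_real (exp x') *s p) + ereal (e / 2)"
        using \<delta>(2)[OF that, of "of_real (exp x') *s p"] by (simp only:)
      then show ?thesis
        by (simp add: Vf)
    qed
    have "dist (f x) (f t) < e" if "dist x t < \<delta>" for x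
      using step[of x t] step[of t x] that e by (auto simp: dist_real_def abs_minus_commute abs_less_iff)
    then show "\<exists>d>0. \<forall>x\<in>UNIV. dist x t < d \<longrightarrow> dist (f x) (f t) < e"
      using \<delta>(1) by blast
  qed
  obtain R where R: "\<And>z. z \<in> X \<Longrightarrow> V z < ereal y \<Longrightarrow> norm z \<le> R"
    using V_sublevel_bounded by blast
  obtain i where "i \<in> A"
    using A_nonempty by auto
  then have "p \<noteq> 0"
    using p(1) by (auto simp: torus_def)
  define t where "t = max 0 (R / norm p)"
  have "y \<le> f t"
  proof (rule ccontr)
    assume "\<not> ?thesis"
    then have "norm (of_real (exp t) *s p) \<le> R"
      using Vf[of t] by (intro R[OF pX]) simp
    then have "exp t * norm p \<le> R"
      by (simp only: norm_smult_complex norm_of_real) simp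
    then have "exp t \<le> R / norm p"
      using \<open>p \<noteq> 0\<close> by (simp add: field_simps)
    then show False
      using exp_ge_add_one_self[of t] max.cobounded2[of "R / norm p" 0] unfolding t_def by linarith
  qed
  moreover have "0 \<le> t"
    by (simp add: t_def)
  ultimately obtain s where "f s = y"
    using IVT'[of f 0 y t] f0 continuous_on_subset[OF cont] by auto
  then show ?thesis
    using that[OF pX, of "exp s"] Vf[of s] by simp
qed

end

section \<open>Convex increasing functions of plurisubharmonic functions\<close>

lemma coord_proj_line: "coord_proj A (a + t *s b) = coord_proj A a + t *s coord_proj A b"
  for b :: "complex ^ 'n"
  by (simp add: coord_proj_def vec_eq_iff)

lemma continuous_on_coord_proj: "continuous_on Y (coord_proj A :: complex ^ 'n::finite \<Rightarrow> complex ^ 'n)"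
  unfolding coord_proj_def
proof (intro continuous_on_vec_lambda)
  show "continuous_on Y (\<lambda>z :: complex ^ 'n. if i \<in> A then z $ i else 0)" for i
    by (cases "i \<in> A") (auto intro!: continuous_intros)
qed

lemma dist_coord_proj_le: "dist (coord_proj A x) (coord_proj A y) \<le> dist x y"
  for x y :: "complex ^ 'n::finite"
  unfolding dist_vec_def by (intro L2_set_mono) (auto simp: coord_proj_def)

lemma psh_coord_proj:
  fixes A :: "'n::finite set"
  assumes "psh_on A (coord_space A) u"
  shows "psh_on UNIV UNIV (\<lambda>z. u (coord_proj A z))"
  unfolding psh_on_iff
proof (intro conjI ballI allI impI)
  show "usc_on UNIV (\<lambda>z. u (coord_proj A z))"
    by (rule usc_on_compose[OF psh_onD(2)[OF assms] continuous_on_coord_proj]) auto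
  fix a b :: "complex ^ 'n" and r :: real
  assume r: "0 < r"
  show "u (coord_proj A a) \<le> arc_mean (\<lambda>\<theta>. u (coord_proj A (a + (of_real r * cis \<theta>) *s b)))"
    unfolding coord_proj_line
    by (rule psh_arc_mean[OF assms _ _ r]) (auto intro!: coord_space_add coord_space_mult)
qed (use psh_onD(3)[OF assms] in auto)

lemma support_fun_mono:
  assumes "T \<subseteq> nonneg_orthant" "compact T" "T \<noteq> {}" "\<And>j. \<xi> $ j \<le> \<xi>' $ j"
  shows "support_fun T \<xi> \<le> support_fun T \<xi>'"
proof (rule support_fun_least[OF assms(3)])
  fix x assume x: "x \<in> T"
  then have "x \<bullet> \<xi> \<le> x \<bullet> \<xi>'"
    using assms(1,4) by (auto simp: inner_vec_def nonneg_orthant_def intro!: sum_mono mult_left_mono)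
  also have "\<dots> \<le> support_fun T \<xi>'"
    by (rule support_fun_upper[OF assms(2) x])
  finally show "x \<bullet> \<xi> \<le> support_fun T \<xi>'" .
qed

text \<open>
  The composite is the supremum of the combinations with coefficients in \<open>T\<close>, which are nonnegative, so
  each combination inherits the mean value inequality and is dominated by the composite on the circle.
\<close>

lemma psh_support_fun:
  fixes w :: "'l::finite \<Rightarrow> complex ^ 'n::finite \<Rightarrow> real"
  assumes T: "T \<subseteq> nonneg_orthant" "compact T" "T \<noteq> {}"
    and psh: "\<And>j. psh_on A \<Omega> (\<lambda>z. ereal (w j z))"
    and lower: "\<And>j z. z \<in> \<Omega> \<Longrightarrow> m j \<le> w j z"
  shows "psh_on A \<Omega> (\<lambda>z. ereal (support_fun T (\<chi> j. w j z) + \<kappa>))"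
proof (rule psh_onI_integral)
  show "openin (top_of_set (coord_space A)) \<Omega>"
    using psh_onD(1)[OF psh] .
  show "support_fun T (\<chi> j. m j) + \<kappa> \<le> support_fun T (\<chi> j. w j z) + \<kappa>" if "z \<in> \<Omega>" for z
    using lower[OF that] by (intro add_right_mono support_fun_mono[OF T]) simp
  show "usc_on \<Omega> (\<lambda>z. ereal (support_fun T (\<chi> j. w j z) + \<kappa>))"
  proof (rule usc_onI)
    fix x c assume x: "x \<in> \<Omega>" "ereal (support_fun T (\<chi> j. w j x) + \<kappa>) < c"
    obtain d where d: "support_fun T (\<chi> j. w j x) + \<kappa> < d" "ereal d < c"
      using ereal_dense2[OF x(2)] by auto
    define L where "L = support_fun T (\<chi> j. 1)"
    obtain x0 where "x0 \<in> T"
      using T(3) by auto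
    have "0 \<le> x0 \<bullet> (\<chi> j. 1)"
      using T(1) \<open>x0 \<in> T\<close> by (auto simp: inner_vec_def nonneg_orthant_def intro!: sum_nonneg)
    then have L: "0 \<le> L"
      unfolding L_def using support_fun_upper[OF T(2) \<open>x0 \<in> T\<close>] order_trans by blast
    define \<delta> where "\<delta> = (d - support_fun T (\<chi> j. w j x) - \<kappa>) / (L + 1)"
    have \<delta>: "0 < \<delta>"
      using d(1) L by (simp add: \<delta>_def)
    have "\<delta> * L < \<delta> * (L + 1)"
      using \<delta> by simp
    also have "\<dots> = d - support_fun T (\<chi> j. w j x) - \<kappa>"
      using L by (simp add: \<delta>_def)
    finally have \<delta>L: "support_fun T (\<chi> j. w j x) + \<delta> * L + \<kappa> < d"
      by simp
    have "\<exists>W. open W \<and> x \<in> W \<and> (\<forall>y\<in>W \<inter> \<Omega>. ereal (w j y) < ereal (w j x + \<delta>))" for j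
      using \<delta> by (intro usc_onD[OF psh_onD(2)[OF psh] x(1)]) simp
    then obtain W where W: "\<And>j. open (W j)" "\<And>j. x \<in> W j" "\<And>j y. y \<in> W j \<Longrightarrow> y \<in> \<Omega> \<Longrightarrow> w j y < w j x + \<delta>"
      by (metis IntI less_ereal.simps(1))
    have "ereal (support_fun T (\<chi> j. w j y) + \<kappa>) < c" if y: "y \<in> (\<Inter>j. W j) \<inter> \<Omega>" for y
    proof -
      have "support_fun T (\<chi> j. w j y) \<le> support_fun T (\<chi> j. w j x + \<delta>)"
        using W(3)[of y] y by (intro support_fun_mono[OF T]) (auto intro: less_imp_le)
      also have "\<dots> \<le> support_fun T (\<chi> j. w j x) + \<delta> * L"
      proof (rule support_fun_least[OF T(3)])
        fix z assume z: "z \<in> T"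
        have "(\<chi> j. w j x + \<delta>) = (\<chi> j. w j x) + \<delta> *\<^sub>R (\<chi> j. 1)"
          by (simp add: vec_eq_iff)
        then have "z \<bullet> (\<chi> j. w j x + \<delta>) = z \<bullet> (\<chi> j. w j x) + \<delta> * (z \<bullet> (\<chi> j. 1))"
          by (simp only: inner_add_right inner_scaleR_right)
        also have "\<dots> \<le> support_fun T (\<chi> j. w j x) + \<delta> * L"
          unfolding L_def using \<delta> support_fun_upper[OF T(2) z]
          by (intro add_mono mult_left_mono) auto
        finally show "z \<bullet> (\<chi> j. w j x + \<delta>) \<le> support_fun T (\<chi> j. w j x) + \<delta> * L" .
      qed
      finally have "ereal (support_fun T (\<chi> j. w j y) + \<kappa>) < ereal d"
        using \<delta>L by simp
      then show ?thesis
        using d(2) by (rule less_trans)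
    qed
    then show "\<exists>W. open W \<and> x \<in> W \<and> (\<forall>y\<in>W \<inter> \<Omega>. ereal (support_fun T (\<chi> j. w j y) + \<kappa>) < c)"
      using W(1,2) by (intro exI[of _ "\<Inter>j. W j"]) (auto intro!: open_INT)
  qed
next
  fix a b :: "complex ^ 'n" and r :: real
  let ?c = "\<lambda>\<theta>. a + (of_real r * cis \<theta>) *s b"
  assume a: "a \<in> \<Omega>" and b: "b \<in> coord_space A" and r: "0 < r" and disc: "\<And>t. cmod t \<le> r \<Longrightarrow> a + t *s b \<in> \<Omega>"
    and int: "set_integrable lborel {0..2*pi} (\<lambda>\<theta>. support_fun T (\<chi> j. w j (?c \<theta>)) + \<kappa>)"
  let ?I = "LINT \<theta>:{0..2*pi}|lborel. support_fun T (\<chi> j. w j (?c \<theta>)) + \<kappa>"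
  have c: "?c \<theta> \<in> \<Omega>" for \<theta>
    using r by (intro disc) (simp add: norm_mult)
  have int_w: "set_integrable lborel {0..2*pi} (\<lambda>\<theta>. w j (?c \<theta>))" for j
    using usc_circle_integrable[OF psh_onD(2,3)[OF psh] _ c, of "m j" j] lower by simp
  have mean_w: "w j a \<le> (LINT \<theta>:{0..2*pi}|lborel. w j (?c \<theta>)) / (2 * pi)" for j
    using psh_submean_integral[OF psh _ a b r disc, of "m j" j] lower by simp
  have const: "set_integrable lborel {0..2*pi} (\<lambda>_. \<kappa>)" "(LINT \<theta>:{0..2*pi}|lborel. \<kappa>) = 2 * pi * \<kappa>"
    using set_borel_integral_eq_integral(2)[OF borel_integrable_atLeastAtMost', of 0 "2*pi" "\<lambda>_. \<kappa>"]
    by (auto intro: borel_integrable_atLeastAtMost')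
  have "support_fun T (\<chi> j. w j a) \<le> ?I / (2 * pi) - \<kappa>"
  proof (rule support_fun_least[OF T(3)])
    fix x assume x: "x \<in> T"
    have int_xw: "integrable lborel (\<lambda>\<theta>. indicat_real {0..2*pi} \<theta> *\<^sub>R (x $ j * w j (?c \<theta>)))" for j
      using set_integrable_mult_right[of "x $ j" lborel "{0..2*pi}" "\<lambda>\<theta>. w j (?c \<theta>)"] int_w[of j]
      by (simp add: set_integrable_def)
    have "x \<bullet> (\<chi> j. w j a) = (\<Sum>j\<in>UNIV. x $ j * w j a)"
      by (simp add: inner_vec_def)
    also have "\<dots> \<le> (\<Sum>j\<in>UNIV. x $ j * ((LINT \<theta>:{0..2*pi}|lborel. w j (?c \<theta>)) / (2 * pi)))"
      using T(1) x by (intro sum_mono mult_left_mono mean_w) (auto simp: nonneg_orthant_def)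
    also have "\<dots> = (\<Sum>j\<in>UNIV. LINT \<theta>:{0..2*pi}|lborel. x $ j * w j (?c \<theta>)) / (2 * pi)"
      by (simp add: sum_divide_distrib)
    also have "(\<Sum>j\<in>UNIV. LINT \<theta>:{0..2*pi}|lborel. x $ j * w j (?c \<theta>))
        = (LINT \<theta>:{0..2*pi}|lborel. (\<Sum>j\<in>UNIV. x $ j * w j (?c \<theta>)))"
      unfolding set_lebesgue_integral_def scaleR_sum_right
      by (rule Bochner_Integration.integral_sum[symmetric, OF int_xw])
    also have "\<dots> \<le> ?I - 2 * pi * \<kappa>"
    proof -
      have "(LINT \<theta>:{0..2*pi}|lborel. (\<Sum>j\<in>UNIV. x $ j * w j (?c \<theta>)))
          \<le> (LINT \<theta>:{0..2*pi}|lborel. support_fun T (\<chi> j. w j (?c \<theta>)) + \<kappa> - \<kappa>)"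
      proof (rule set_integral_mono)
        show "set_integrable lborel {0..2*pi} (\<lambda>\<theta>. \<Sum>j\<in>UNIV. x $ j * w j (?c \<theta>))"
          unfolding set_integrable_def scaleR_sum_right
          by (intro Bochner_Integration.integrable_sum int_xw)
        show "set_integrable lborel {0..2*pi} (\<lambda>\<theta>. support_fun T (\<chi> j. w j (?c \<theta>)) + \<kappa> - \<kappa>)"
          using int const(1) by (rule set_integral_diff)
        show "(\<Sum>j\<in>UNIV. x $ j * w j (?c \<theta>)) \<le> support_fun T (\<chi> j. w j (?c \<theta>)) + \<kappa> - \<kappa>" for \<theta>
          using support_fun_upper[OF T(2) x, of "\<chi> j. w j (?c \<theta>)"] by (simp add: inner_vec_def)
      qed
      also have "\<dots> = ?I - 2 * pi * \<kappa>"
        using set_integral_diff(2)[OF int const(1)] const(2) by simp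
      finally show ?thesis .
    qed
    finally show "x \<bullet> (\<chi> j. w j a) \<le> ?I / (2 * pi) - \<kappa>"
      by (simp add: divide_right_mono diff_divide_distrib)
  qed
  then show "support_fun T (\<chi> j. w j a) + \<kappa> \<le> ?I / (2 * pi)"
    by simp
qed

lemma psh_inner:
  fixes w :: "'l::finite \<Rightarrow> complex ^ 'n::finite \<Rightarrow> real"
  assumes "c \<in> nonneg_orthant" "\<And>j. psh_on A \<Omega> (\<lambda>z. ereal (w j z))" "\<And>j z. z \<in> \<Omega> \<Longrightarrow> m j \<le> w j z"
  shows "psh_on A \<Omega> (\<lambda>z. ereal (c \<bullet> (\<chi> j. w j z) + \<kappa>))"
  using psh_support_fun[of "{c}", OF _ _ _ assms(2,3)] assms(1) by (simp add: support_fun_def)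

lemma support_fun_ball:
  assumes "compact T" "cball c \<rho> \<subseteq> T" "0 \<le> \<rho>"
  shows "c \<bullet> \<xi> + \<rho> * norm \<xi> \<le> support_fun T \<xi>"
proof -
  have "c + \<rho> *\<^sub>R sgn \<xi> \<in> cball c \<rho>"
    using assms(3) by (simp add: dist_norm norm_sgn)
  then have "(c + \<rho> *\<^sub>R sgn \<xi>) \<bullet> \<xi> \<le> support_fun T \<xi>"
    using assms(1,2) by (intro support_fun_upper) auto
  moreover have "sgn \<xi> \<bullet> \<xi> = norm \<xi>"
    by (cases "\<xi> = 0") (simp_all add: sgn_div_norm power2_norm_eq_inner[symmetric] power2_eq_square)
  ultimately show ?thesis
    by (simp add: inner_add_left)
qed

section \<open>Failure of maximality\<close>

theorem proposition4p2:
  fixes blk :: "'n::finite \<Rightarrow> 'l::finite"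
    and B :: "'l \<Rightarrow> 'n set"
    and Kj :: "'l \<Rightarrow> (complex ^ 'n) set"
    and K :: "(complex ^ 'n) set"
    and T :: "(real ^ 'l) set"
    and S :: "'l \<Rightarrow> (real ^ 'n) set"
    and q :: "'l \<Rightarrow> real"
  assumes "surj blk"
    and "\<And>j. B j = {i. blk i = j}"
    and "\<And>j. Kj j \<subseteq> coord_space (B j)"
    and "\<And>j. compact (Kj j)"
    and "\<And>j. \<not> pluripolar (B j) (Kj j)"
    and "K = {z. \<forall>j. coord_proj (B j) z \<in> Kj j}"
    and "T \<subseteq> nonneg_orthant" and "compact T" and "convex T" and "interior T \<noteq> {}"
    and "\<And>j. S j \<subseteq> coord_space (B j) \<inter> nonneg_orthant"
    and "\<And>j. compact (S j)" and "\<And>j. convex (S j)" and "\<And>j. 0 \<in> S j"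
    and "\<And>j. \<exists>a>0. (\<lambda>x. a *\<^sub>R x) ` std_simplex (B j) \<subseteq> S j"
    and "\<And>j z. z \<in> Kj j \<Longrightarrow> usc_reg (coord_space (B j)) (extremal (B j) (S j) (Kj j)) z = 0"
    and "\<And>j. q j < 0"
  shows "let V = (\<lambda>z. support_fun T (\<chi> j. real_of_ereal
                   (weighted_extremal (B j) (S j) (Kj j) (\<lambda>_. ereal (q j)) (coord_proj (B j) z))))
         in (\<forall>z. V z = support_fun T (\<chi> j. real_of_ereal
                   (extremal (B j) (S j) (Kj j) (coord_proj (B j) z)) + q j)) \<and>
            psh_on UNIV (- K) (\<lambda>z. ereal (V z)) \<and>
            \<not> maximal_psh_on UNIV (- K) (\<lambda>z. ereal (V z))"
proof -
  \<comment> \<open>The empty set is pluripolar, so no factor of \<open>K\<close> is empty.\<close>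
  have reg: "\<exists>C. regular_set (B j) (S j) C (Kj j)" for j
  proof -
    obtain C where C: "0 < C" "\<And>x. x \<in> S j \<Longrightarrow> norm x \<le> C"
      using compact_imp_bounded[OF assms(12)[of j]] by (auto simp: bounded_pos)
    have "x $ i \<le> C" if "x \<in> S j" for x i
      using component_le_norm_cart[of x i] C(2)[OF that] by simp
    moreover have "B j \<noteq> {}"
      using assms(2)[of j] surjD[OF assms(1), of j] by auto
    moreover have "Kj j \<noteq> {}"
    proof
      assume "Kj j = {}"
      moreover have "psh_on (B j) (coord_space (B j)) (\<lambda>_. ereal 0)"
        by (rule psh_const) simp
      moreover have "\<exists>z :: complex ^ 'n. z \<in> coord_space (B j)"
        using zero_in_coord_space by blast
      ultimately have "pluripolar (B j) (Kj j)"
        unfolding pluripolar_def by (intro exI[of _ "\<lambda>_. ereal 0"]) auto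
      then show False
        using assms(5) by blast
    qed
    ultimately have "regular_set (B j) (S j) C (Kj j)"
      using assms(3,4,11,12,14,15,16) C(1) by unfold_locales auto
    then show ?thesis ..
  qed
  then obtain C where reg: "\<And>j. regular_set (B j) (S j) (C j) (Kj j)"
    by metis
  let ?E = "\<lambda>j. extremal (B j) (S j) (Kj j)"
  define W where "W j z = real_of_ereal (?E j (coord_proj (B j) z))" for j z
  have E_W: "?E j (coord_proj (B j) z) = ereal (W j z)" for j z
    unfolding W_def by (rule regular_set.V_finite[OF reg]) simp
  have W_nonneg: "0 \<le> W j z" for j z
    using regular_set.V_nonneg[OF reg[of j], of "coord_proj (B j) z"] by (simp add: E_W)
  have psh_W: "psh_on UNIV UNIV (\<lambda>z. ereal (W j z))" for j
    using psh_coord_proj[OF regular_set.psh_V[OF reg[of j]]] by (simp add: E_W)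
  define \<psi> where "\<psi> z = (\<chi> j. W j z + q j)" for z
  have psh_w: "psh_on UNIV UNIV (\<lambda>z. ereal (W j z + q j))" for j
    using psh_shift[OF psh_W[of j], of 0 "q j"] W_nonneg by simp
  have lower: "q j \<le> W j z + q j" for j z
    using W_nonneg by simp
  define V where "V z = support_fun T (\<psi> z)" for z
  have weighted: "support_fun T (\<chi> j. real_of_ereal
        (weighted_extremal (B j) (S j) (Kj j) (\<lambda>_. ereal (q j)) (coord_proj (B j) z))) = V z" for z
    by (simp add: V_def \<psi>_def regular_set.weighted_extremal_const[OF reg] E_W)
  have T_ne: "T \<noteq> {}"
    using assms(10) interior_subset by fastforce
  have K_closed: "closed K"
  proof -
    have "K = (\<Inter>j. coord_proj (B j) -` Kj j)"
      using assms(6) by auto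
    moreover have "closed (coord_proj (B j) -` Kj j)" for j
      by (intro closed_vimage compact_imp_closed assms(4) continuous_on_coord_proj)
    ultimately show ?thesis
      by (simp add: closed_INT)
  qed
  have psh_V: "psh_on UNIV UNIV (\<lambda>z. ereal (V z))"
    using psh_support_fun[OF assms(7,8) T_ne psh_w lower, where \<kappa> = 0] by (simp add: V_def \<psi>_def)
  have "psh_on UNIV (- K) (\<lambda>z. ereal (V z))"
    using K_closed by (intro psh_on_subset[OF psh_V]) auto
  moreover have "\<not> maximal_psh_on UNIV (- K) (\<lambda>z. ereal (V z))"
  proof
    assume max: "maximal_psh_on UNIV (- K) (\<lambda>z. ereal (V z))"
    obtain c \<rho> where c: "0 < \<rho>" "cball c \<rho> \<subseteq> T"
      using assms(10) by (auto simp: mem_interior_cball)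
    have "c \<in> cball c \<rho>"
      using c(1) by simp
    then have cT: "c \<in> nonneg_orthant"
      using c(2) assms(7) by blast
    \<comment> \<open>On \<open>K\<close> all \<open>\<psi> z $ j \<le> - 2 \<eta>\<close>, so that \<open>\<psi> z $ j < - \<eta>\<close> persists near \<open>K\<close>.\<close>
    define \<eta> where "\<eta> = Min (range (\<lambda>j. - q j)) / 2"
    have "0 < Min (range (\<lambda>j. - q j))"
      using assms(17) by (subst Min_gr_iff) auto
    moreover have "Min (range (\<lambda>j. - q j)) \<le> - q j" for j
      by (intro Min_le) auto
    then have "q j \<le> - Min (range (\<lambda>j. - q j))" for j
      by (metis minus_le_iff minus_minus)
    ultimately have \<eta>: "0 < \<eta>" "\<And>j. q j \<le> - 2 * \<eta>"
      by (simp_all add: \<eta>_def)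
    have "\<exists>\<delta>>0. \<forall>p z. p \<in> Kj j \<longrightarrow> z \<in> coord_space (B j) \<longrightarrow> dist p z < \<delta> \<longrightarrow> ?E j z < ereal \<eta>" for j
      using regular_set.V_small_near_K[OF reg[of j] \<eta>(1)] by metis
    then obtain d where d: "\<And>j. 0 < d j"
        "\<And>j p z. p \<in> Kj j \<Longrightarrow> z \<in> coord_space (B j) \<Longrightarrow> dist p z < d j \<Longrightarrow> ?E j z < ereal \<eta>"
      by metis
    define \<delta> where "\<delta> = Min (range d)"
    have \<delta>: "0 < \<delta>" "\<And>j. \<delta> \<le> d j"
      using d(1) by (auto simp: \<delta>_def)
    have near: "\<psi> z $ j < - \<eta>" if "p \<in> K" "dist p z < \<delta>" for p z j
    proof -
      have "dist (coord_proj (B j) p) (coord_proj (B j) z) < d j"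
        using dist_coord_proj_le[of "B j" p z] that(2) \<delta>(2)[of j] by linarith
      then have "?E j (coord_proj (B j) z) < ereal \<eta>"
        using that(1) assms(6) by (intro d(2)) auto
      then show ?thesis
        using \<eta>(2)[of j] by (simp add: E_W \<psi>_def)
    qed
    have "\<exists>R. \<forall>z\<in>coord_space (B j). ?E j z < ereal (\<eta> - q j) \<longrightarrow> norm z \<le> R" for j
      using regular_set.V_sublevel_bounded[OF reg[of j]] by metis
    then obtain r where r: "\<And>j z. z \<in> coord_space (B j) \<Longrightarrow> ?E j z < ereal (\<eta> - q j) \<Longrightarrow> norm z \<le> r j"
      by metis
    define R where "R = 1 + (\<Sum>i\<in>UNIV. r (blk i))"
    have bounded: "norm z < R" if small: "\<And>j. \<psi> z $ j < \<eta>" for z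
    proof -
      have "cmod (z $ i) \<le> r (blk i)" for i
      proof -
        have "?E (blk i) (coord_proj (B (blk i)) z) < ereal (\<eta> - q (blk i))"
          using small[of "blk i"] by (simp add: E_W \<psi>_def)
        then have "norm (coord_proj (B (blk i)) z) \<le> r (blk i)"
          by (intro r) simp_all
        moreover have "coord_proj (B (blk i)) z $ i = z $ i"
          by (simp add: coord_proj_def assms(2))
        ultimately show ?thesis
          using Finite_Cartesian_Product.norm_nth_le[of "coord_proj (B (blk i)) z" i] by simp
      qed
      then have "(\<Sum>i\<in>UNIV. cmod (z $ i)) \<le> (\<Sum>i\<in>UNIV. r (blk i))"
        by (intro sum_mono)
      moreover have "norm z \<le> (\<Sum>i\<in>UNIV. cmod (z $ i))"
        unfolding norm_vec_def by (intro L2_set_le_sum) simp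
      ultimately show ?thesis
        by (simp add: R_def)
    qed
    \<comment> \<open>\<open>G\<close> contains all points at which every \<open>\<bar>\<psi> z $ j\<bar> < \<eta>\<close>, and none of these lies on its boundary.\<close>
    define N where "N = (\<Union>x\<in>K. \<Union>y\<in>cball 0 (\<delta> / 2). {x + y})"
    define G where "G = ball 0 R - N"
    have N_iff: "z \<in> N \<longleftrightarrow> (\<exists>p\<in>K. dist p z \<le> \<delta> / 2)" for z
    proof
      assume "\<exists>p\<in>K. dist p z \<le> \<delta> / 2"
      then obtain p where p: "p \<in> K" "dist p z \<le> \<delta> / 2"
        by blast
      then have "z = p + (z - p)" "z - p \<in> cball 0 (\<delta> / 2)"
        by (auto simp: dist_norm norm_minus_commute)
      then show "z \<in> N"
        unfolding N_def using p(1) by blast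
    next
      assume "z \<in> N"
      then obtain p y where "p \<in> K" "norm y \<le> \<delta> / 2" "z = p + y"
        by (auto simp: N_def)
      then show "\<exists>p\<in>K. dist p z \<le> \<delta> / 2"
        by (intro bexI[of _ p]) (auto simp: dist_norm)
    qed
    have N_near: "\<psi> z $ j < - \<eta>" if "z \<in> N" for z j
    proof -
      obtain p where "p \<in> K" "dist p z \<le> \<delta> / 2"
        using \<open>z \<in> N\<close> unfolding N_iff by blast
      then show ?thesis
        using \<delta>(1) by (intro near[of p z j]) auto
    qed
    have "closed N"
      unfolding N_def by (intro closed_compact_sums K_closed compact_cball)
    then have "open G"
      unfolding G_def by (intro open_Diff open_ball)
    have GR: "closure G \<subseteq> cball 0 R"
      unfolding G_def by (rule closure_minimal) auto
    have GK: "closure G \<subseteq> - K"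
    proof
      fix p assume "p \<in> closure G"
      then obtain y where "y \<in> G" "dist y p < \<delta> / 2"
        using \<delta>(1) unfolding closure_approachable by (meson half_gt_zero)
      then show "p \<in> - K"
        using N_iff[of y] by (force simp: G_def dist_commute)
    qed
    define u where "u z = c \<bullet> \<psi> z + \<rho> * \<eta>" for z
    have psh_u: "psh_on UNIV UNIV (\<lambda>z. ereal (u z))"
      unfolding u_def \<psi>_def by (rule psh_inner[OF cT psh_w lower])
    have boundary: "u z \<le> V z" if z: "z \<in> frontier G" for z
    proof -
      have "z \<in> cball 0 R" "z \<notin> G"
        using z GR \<open>open G\<close> by (auto simp: frontier_def interior_open)
      have "\<exists>j. \<eta> \<le> \<bar>\<psi> z $ j\<bar>"
      proof (cases "z \<in> N")
        case True
        then show ?thesis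
          using N_near[OF True, of undefined] by (intro exI[of _ undefined]) simp
      next
        case False
        then have "\<not> norm z < R"
          using \<open>z \<notin> G\<close> by (simp add: G_def)
        then obtain j where "\<not> \<psi> z $ j < \<eta>"
          using bounded by blast
        then show ?thesis
          by (intro exI[of _ j]) simp
      qed
      then obtain j where "\<eta> \<le> \<bar>\<psi> z $ j\<bar>"
        by blast
      then have "\<eta> \<le> norm (\<psi> z)"
        using component_le_norm_cart[of "\<psi> z" j] by linarith
      then have "u z \<le> c \<bullet> \<psi> z + \<rho> * norm (\<psi> z)"
        using c(1) by (simp add: u_def)
      also have "\<dots> \<le> V z"
        unfolding V_def using c by (intro support_fun_ball assms(8)) auto
      finally show ?thesis .
    qed
    have "\<exists>z. z \<in> coord_space (B j) \<and> ?E j z = ereal (- q j)" for j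
      using regular_set.V_attains[OF reg[of j], of "- q j"] assms(17)[of j] by (metis neg_0_less_iff_less)
    then obtain y where y: "\<And>j. y j \<in> coord_space (B j)" "\<And>j. ?E j (y j) = ereal (- q j)"
      by metis
    define z0 where "z0 = (\<chi> i. y (blk i) $ i)"
    have "coord_proj (B j) z0 = y j" for j
      using y(1)[of j] by (auto simp: z0_def coord_proj_def coord_space_def vec_eq_iff assms(2))
    then have "W j z0 = - q j" for j
      using y(2)[of j] by (simp only: W_def real_of_ereal.simps)
    then have z0: "\<psi> z0 = 0"
      by (simp add: \<psi>_def vec_eq_iff)
    have "z0 \<in> G"
      unfolding G_def using bounded[of z0] N_near[of z0] \<eta>(1) by (auto simp: z0)
    have "ereal (u z0) \<le> ereal (V z0)"
    proof -
      have "openin (top_of_set (coord_space UNIV)) G"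
        using \<open>open G\<close> by simp
      moreover have "compact (closure G)"
        using bounded_subset[OF bounded_cball GR] by (simp add: compact_eq_bounded_closed)
      moreover have "usc_on (closure G) (\<lambda>z. ereal (u z))"
        using psh_onD(2)[OF psh_u] by (rule usc_on_subset) simp
      moreover have "psh_on UNIV G (\<lambda>z. ereal (u z))"
        using \<open>open G\<close> by (intro psh_on_subset[OF psh_u]) auto
      moreover have "\<forall>z \<in> top_of_set (coord_space UNIV) frontier_of G. ereal (u z) \<le> ereal (V z)"
        using boundary by simp
      ultimately have "\<forall>z\<in>G. ereal (u z) \<le> ereal (V z)"
        using max GK unfolding maximal_psh_on_def by metis
      then show ?thesis
        using \<open>z0 \<in> G\<close> by blast
    qed
    moreover have "V z0 = 0"
      using T_ne by (simp add: V_def z0 support_fun_def)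
    moreover have "0 < u z0"
      using c(1) \<eta>(1) by (simp add: u_def z0)
    ultimately show False
      by simp
  qed
  ultimately show ?thesis
    unfolding Let_def weighted by (simp add: V_def \<psi>_def W_def)
qed

end
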